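(* Let $D$ be a non-measurable open $SL(m,\mathbb{H})$-orbit in a flag manifold $Z=G/P$ of $G=SL(n,\mathbb{C})$, $n=2m$, with base cycle $C_0$, let $\pi:\hat Z=G/\hat P\to Z$ and $\hat D\subset\hat Z$ be its measurable model, and $\hat C_0$ the base cycle of $\hat D$. A Schubert variety $S_{\hat w}\in\mathcal{S}_{\hat C_0}$ is mapped by $\pi$ to a Schubert variety $S_w\in\mathcal{S}_{C_0}$ if and only if all the blocks $C_j$ of $w$ with $t_j>1$ come from groups of blocks arranged in strictly decreasing order in $\hat w$.
   Context: Let $\mathbf{j}(v)=J\bar v$ on $\mathbb{C}^{2m}$ with $J=\begin{pmatrix}0&I_m\\-I_m&0\end{pmatrix}$. $G_0=SL(m,\mathbb{H})=\{X\in G:\mathbf{j}X=X\mathbf{j}\}$, $K_0=SU(2m)\cap G_0=Sp(m)$. The flag manifold of a dimension sequence $(c_1,\dots,c_r)$ consists of the flags with $\dim V_i/V_{i-1}=c_i$. In each flag manifold $G_0$ has exactly one open orbit; it is measurable if and only if the dimension sequence is symmetric (equal to its reverse). The base cycle of an open $G_0$-orbit is its unique $K_0$-orbit that is a complex submanifold. Measurable model: let $f$ be the (non-symmetric) dimension sequence of $P$ and $\tau(X)=\mathbf{j}X\mathbf{j}^{-1}$. Then $\hat P=P\cap\tau(P^-)$, where $P^-$ is the opposite parabolic and $\tau(P^-)$ has the reversed dimension sequence; $\hat P$ is a parabolic subgroup whose dimension sequence $d=(d_1,\dots,d_s)$ is symmetric and is the common refinement of $f$ and its reverse (e.g. $(2,4,3)$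 gives $(2,1,3,1,2)$ as a refinement). $\pi:G/\hat P\to G/P$ is the projection, and $\hat D$ is the open $G_0$-orbit in $\hat Z$ (so $\pi(\hat D)=D$). There is a unique sequence $t=(t_1,\dots,t_p)$ of positive integers with $t_1+\dots+t_p=s$ such that, with $\delta_0=0$ and $\delta_j=\sum_{i=1}^jt_i$, one has $f=(f_{\delta_1},\dots,f_{\delta_p})$, $f_{\delta_j}=\sum_{i=\delta_{j-1}+1}^{\delta_j}d_i$. Let $(u_1,\dots,u_n)=(e_1,\mathbf{j}(e_1),e_2,\mathbf{j}(e_2),\dots,e_m,\mathbf{j}(e_m))$ and $B_I\subset G$ the (Iwasawa–)Borel subgroup stabilizing the complete flag of this ordered basis. Schubert varieties (with respect to $B_I$) in a flag manifold are indexed by minimal representatives, i.e. permutations in one-line notation increasing in each consecutive block of the dimension sequence: $S_w$ is the closure of the $B_I$-orbit of the flag determined by the ordered basis $(u_{w(1)},\dots,u_{w(n)})$. $\mathcal{S}_{C_0}$ is the set of Schubert varieties $S_w\subset Z$ with $\dim S_w+\dim C_0=\dim Z$ and $S_w\cap C_0\ne\emptyset$; $\mathcal{S}_{\hat C_0}$ is defined likewise in $\hat Z$. Write $\hat w$ in blocks $B_1\dots B_s$ of lengths $d_1,\dots,d_s$. If $S_w=\pi(S_{\hat w})$, then $w=C_1\dots C_p$ with $C_j=\bigcup_{i=\delta_{j-1}+1}^{\delta_j}B_i$ arranged in increasing order. The group of blocks $B_{\delta_{j-1}+1},\dots,B_{\delta_j}$ forming $C_j$ is in strictly decreasing order if,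 for all $\delta_{j-1}+1\le i\le\delta_j-1$, the last element of $B_{i+1}$ is smaller than the first element of $B_i$. *)

theory Defs
  imports "HOL-Analysis.Analysis"
begin

section \<open>Dimension sequences and blocks\<close>

definition composition :: "nat list \<Rightarrow> nat \<Rightarrow> bool" where
  "composition c n \<longleftrightarrow> (\<forall>k\<in>set c. k > 0) \<and> sum_list c = n"

text \<open>Cuts a list into consecutive blocks of the prescribed lengths.\<close>

fun blocks :: "nat list \<Rightarrow> 'a list \<Rightarrow> 'a list list" where
  "blocks [] xs = []"
| "blocks (c # cs) xs = take c xs # blocks cs (drop c xs)"

text \<open>The \<open>t\<close> such that each entry of \<open>f\<close> is the sum of the corresponding group of
  consecutive entries of \<open>d\<close>.\<close>

definition grouping :: "nat list \<Rightarrow> nat list \<Rightarrow> nat list \<Rightarrow> bool" where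
  "grouping t f d \<longleftrightarrow> composition t (length d) \<and> f = map sum_list (blocks t d)"

text \<open>Permutations are words \<open>w(1) \<dots> w(n)\<close> in one-line notation.\<close>

definition minimal_representative :: "nat list \<Rightarrow> nat list \<Rightarrow> bool" where
  "minimal_representative c w \<longleftrightarrow>
     distinct w \<and> set w = {1..sum_list c} \<and> (\<forall>B\<in>set (blocks c w). sorted B)"

definition strictly_decreasing :: "nat list list \<Rightarrow> bool" where
  "strictly_decreasing Bs \<longleftrightarrow> (\<forall>i. Suc i < length Bs \<longrightarrow> last (Bs ! Suc i) < hd (Bs ! i))"


section \<open>Flag manifolds\<close>

text \<open>A flag \<open>0 = V\<^sub>0 \<subseteq> V\<^sub>1 \<subseteq> \<dots> \<subseteq> V\<^sub>r = \<complex>\<^sup>n\<close> is the list \<open>[V\<^sub>1, \<dots>, V\<^sub>r]\<close> of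
  complex subspaces; \<open>vec\<close> refers to linear algebra over the field of scalars.\<close>

type_synonym 'n flag = "(complex^'n) set list"

definition flag_manifold :: "nat list \<Rightarrow> ('n::finite) flag set" where
  "flag_manifold c = {V. length V = length c \<and>
     (\<forall>i<length c. vec.subspace (V ! i) \<and> vec.dim (V ! i) = sum_list (take (Suc i) c)) \<and>
     (\<forall>i. Suc i < length c \<longrightarrow> V ! i \<subseteq> V ! Suc i)}"

definition act :: "complex^'n^'n \<Rightarrow> ('n::finite) flag \<Rightarrow> 'n flag" where
  "act g V = map (\<lambda>U. (*v) g ` U) V"

definition orbit :: "(complex^'n^'n) set \<Rightarrow> ('n::finite) flag \<Rightarrow> 'n flag set" where
  "orbit H V = (\<lambda>g. act g V) ` H"

definition SL :: "(complex^'n^'n::finite) set" where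
  "SL = {g. det g = 1}"

definition stab :: "('n::finite) flag \<Rightarrow> (complex^'n^'n) set" where
  "stab V = {g\<in>SL. act g V = V}"

text \<open>The flag of type \<open>c\<close> determined by an ordered basis.\<close>

definition basis_flag :: "nat list \<Rightarrow> (complex^'n) list \<Rightarrow> ('n::finite) flag" where
  "basis_flag c b = map (\<lambda>i. vec.span (set (take (sum_list (take (Suc i) c)) b))) [0..<length c]"

text \<open>The quotient topology of a flag manifold as a homogeneous space. The open group of
  invertible matrices is used instead of \<open>SL\<close>: it has the same orbits of flags, scalar
  matrices acting trivially, and gives the same topology. No base point is singled out, since
  the condition for one base flag is a right translate of the condition for another.\<close>

definition flag_topology :: "nat list \<Rightarrow> ('n::finite) flag topology" where
  "flag_topology c = topology (\<lambda>W. W \<subseteq> flag_manifold c \<and>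
     (\<forall>V\<in>flag_manifold c. open {g. invertible g \<and> act g V \<in> W}))"

text \<open>The projection keeps, from each group of consecutive subspaces, the last one.\<close>

definition flag_proj :: "nat list \<Rightarrow> 'n flag \<Rightarrow> ('n::finite) flag" where
  "flag_proj t V = map last (blocks t V)"

lemma openin_flag_topology:
  fixes W :: "('n::finite) flag set"
  shows "openin (flag_topology c) W \<longleftrightarrow> W \<subseteq> flag_manifold c \<and>
     (\<forall>V\<in>flag_manifold c. open {g. invertible g \<and> act g V \<in> W})"
proof -
  have "istopology (\<lambda>W :: 'n flag set. W \<subseteq> flag_manifold c \<and>
     (\<forall>V\<in>flag_manifold c. open {g. invertible g \<and> act g V \<in> W}))"
    unfolding istopology_def
  proof (intro conjI allI impI ballI)
    fix S T :: "'n flag set" and V :: "'n flag"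
    assume S: "S \<subseteq> flag_manifold c \<and>
       (\<forall>V\<in>flag_manifold c. open {g. invertible g \<and> act g V \<in> S})"
      and T: "T \<subseteq> flag_manifold c \<and>
       (\<forall>V\<in>flag_manifold c. open {g. invertible g \<and> act g V \<in> T})"
    show "S \<inter> T \<subseteq> flag_manifold c" using S by blast
    assume "V \<in> flag_manifold c"
    then have "open ({g. invertible g \<and> act g V \<in> S} \<inter> {g. invertible g \<and> act g V \<in> T})"
      using S T by (intro open_Int) auto
    moreover have "{g. invertible g \<and> act g V \<in> S} \<inter> {g. invertible g \<and> act g V \<in> T}
       = {g. invertible g \<and> act g V \<in> S \<inter> T}" by blast
    ultimately show "open {g. invertible g \<and> act g V \<in> S \<inter> T}" by simp
  next
    fix \<W> :: "'n flag set set" and V :: "'n flag"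
    assume \<W>: "\<forall>S\<in>\<W>. S \<subseteq> flag_manifold c \<and>
       (\<forall>V\<in>flag_manifold c. open {g. invertible g \<and> act g V \<in> S})"
    show "\<Union>\<W> \<subseteq> flag_manifold c" using \<W> by blast
    assume "V \<in> flag_manifold c"
    then have "open (\<Union>S\<in>\<W>. {g. invertible g \<and> act g V \<in> S})"
      using \<W> by blast
    moreover have "(\<Union>S\<in>\<W>. {g. invertible g \<and> act g V \<in> S})
       = {g. invertible g \<and> act g V \<in> \<Union>\<W>}" by blast
    ultimately show "open {g. invertible g \<and> act g V \<in> \<Union>\<W>}" by simp
  qed
  then show ?thesis
    unfolding flag_topology_def by simp
qed


section \<open>Complex submanifolds and dimension\<close>

definition complex_differentiable_on ::
    "(complex^'n^'n \<Rightarrow> complex^'n^'n) \<Rightarrow> (complex^'n^'n::finite) set \<Rightarrow> bool" where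
  "complex_differentiable_on \<phi> U \<longleftrightarrow> (\<forall>X\<in>U. \<exists>\<phi>'. (\<phi> has_derivative \<phi>') (at X) \<and>
     (\<forall>Y. \<phi>' (map_matrix ((*) \<i>) Y) = map_matrix ((*) \<i>) (\<phi>' Y)))"

text \<open>Near \<open>p\<close>, the set \<open>A\<close> of matrices is a complex submanifold of complex dimension \<open>k\<close>: a
  biholomorphic map straightens it to a complex linear subspace. Here \<open>subspace\<close> and \<open>dim\<close>
  are over the reals.\<close>

definition matrix_submanifold_at :: "nat \<Rightarrow> (complex^'n^'n::finite) set \<Rightarrow> complex^'n^'n \<Rightarrow> bool" where
  "matrix_submanifold_at k A p \<longleftrightarrow> p \<in> A \<and>
     (\<exists>U V \<phi> \<psi> L. open U \<and> p \<in> U \<and> open V \<and> homeomorphism U V \<phi> \<psi> \<and>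
        complex_differentiable_on \<phi> U \<and> complex_differentiable_on \<psi> V \<and>
        subspace L \<and> map_matrix ((*) \<i>) ` L \<subseteq> L \<and> dim L = 2 * k \<and> \<phi> ` (U \<inter> A) = V \<inter> L)"

text \<open>Real dimension of the stabilizer of a flag in the group of invertible matrices, which is
  an open subset of this space of matrices.\<close>

definition stab_real_dim :: "('n::finite) flag \<Rightarrow> nat" where
  "stab_real_dim V = dim {X :: complex^'n^'n. \<forall>U\<in>set V. (*v) X ` U \<subseteq> U}"

text \<open>Near \<open>V\<close>, the set \<open>A\<close> of flags is a complex submanifold of complex dimension \<open>k\<close>. The
  orbit map \<open>g \<mapsto> g V\<close> is a holomorphic submersion, so this holds if and only if the preimage
  of \<open>A\<close> is a submanifold near the identity, of dimension \<open>k\<close> plus that of the stabilizer.\<close>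

definition submanifold_at :: "nat \<Rightarrow> ('n::finite) flag set \<Rightarrow> 'n flag \<Rightarrow> bool" where
  "submanifold_at k A V \<longleftrightarrow> V \<in> A \<and>
     (\<exists>l. 2 * l = 2 * k + stab_real_dim V \<and>
        matrix_submanifold_at l {g. invertible g \<and> act g V \<in> A} (mat 1))"

definition complex_submanifold :: "('n::finite) flag set \<Rightarrow> bool" where
  "complex_submanifold A \<longleftrightarrow> (\<forall>V\<in>A. \<exists>k. submanifold_at k A V)"

text \<open>Dimension of an analytic set: the largest dimension at a regular point.\<close>

definition analytic_dim :: "('n::finite) flag set \<Rightarrow> nat" where
  "analytic_dim A = Max {k. \<exists>V. submanifold_at k A V}"


section \<open>The quaternionic structure and the real form\<close>

text \<open>Coordinates of \<open>\<complex>\<^sup>2\<^sup>m\<close> are indexed by \<open>'m + 'm\<close>, \<open>Inl\<close> giving the first \<open>m\<close> of them.\<close>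

definition quat_J :: "complex^('m + 'm)^('m::finite + 'm)" where
  "quat_J = (\<chi> a b. case (a, b) of (Inl i, Inr k) \<Rightarrow> (if i = k then 1 else 0)
                  | (Inr i, Inl k) \<Rightarrow> (if i = k then -1 else 0) | _ \<Rightarrow> 0)"

definition quat_j :: "complex^('m + 'm) \<Rightarrow> complex^('m::finite + 'm)" where
  "quat_j v = quat_J *v (\<chi> i. cnj (v $ i))"

definition G0 :: "(complex^('m + 'm)^('m::finite + 'm)) set" where
  "G0 = {X\<in>SL. \<forall>v. quat_j (X *v v) = X *v quat_j v}"

definition SU :: "(complex^'n^'n::finite) set" where
  "SU = {X\<in>SL. X ** map_matrix cnj (transpose X) = mat 1}"

definition K0 :: "(complex^('m + 'm)^('m::finite + 'm)) set" where
  "K0 = SU \<inter> G0"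

definition tau :: "complex^('m + 'm)^('m + 'm) \<Rightarrow> complex^('m + 'm)^('m::finite + 'm)" where
  "tau X = matrix (\<lambda>v. quat_j (X *v inv quat_j v))"

definition open_orbit :: "nat list \<Rightarrow> ('m::finite + 'm) flag set \<Rightarrow> bool" where
  "open_orbit c D \<longleftrightarrow> (\<exists>V\<in>flag_manifold c. D = orbit G0 V) \<and> openin (flag_topology c) D"

text \<open>An open orbit is measurable if it carries an invariant volume element, that is, a nonzero
  invariant Radon measure. On the orbit, a Borel measure is Radon if and only if it is finite
  on compact sets.\<close>

definition measurable_orbit :: "nat list \<Rightarrow> ('m::finite + 'm) flag set \<Rightarrow> bool" where
  "measurable_orbit c D \<longleftrightarrow> (\<exists>M. space M = D \<and>
     sets M = sigma_sets D {W. openin (subtopology (flag_topology c) D) W} \<and>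
     (\<forall>g\<in>G0. \<forall>A\<in>sets M. emeasure M (act g ` A) = emeasure M A) \<and>
     (\<forall>Q. compactin (subtopology (flag_topology c) D) Q \<longrightarrow> emeasure M Q < \<infinity>) \<and>
     emeasure M D \<noteq> 0)"

definition base_cycle :: "('m::finite + 'm) flag set \<Rightarrow> ('m + 'm) flag set \<Rightarrow> bool" where
  "base_cycle D C \<longleftrightarrow> (\<exists>V\<in>D. C = orbit K0 V) \<and> complex_submanifold C"

text \<open>With \<open>P\<close> the stabilizer of a point of \<open>D\<close>, the flag of the ordered basis \<open>b\<close>, the opposite
  parabolic \<open>P\<^sup>-\<close> is the stabilizer of the flag of the reversed basis. The intersection of \<open>P\<close>
  with \<open>\<tau>(P\<^sup>-)\<close> is to be a parabolic subgroup, with dimension sequence \<open>d\<close>. The sequence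
  \<open>d\<close> does not depend on the choice of \<open>b\<close>: a parabolic intersection is the stabilizer of the
  flag made of all members of the flags belonging to the two intersected subgroups.\<close>

definition measurable_model :: "('m::finite + 'm) flag set \<Rightarrow> nat list \<Rightarrow> nat list \<Rightarrow> bool" where
  "measurable_model D f d \<longleftrightarrow> composition d (2 * CARD('m)) \<and>
     (\<exists>b. length b = 2 * CARD('m) \<and> distinct b \<and> vec.independent (set b) \<and> basis_flag f b \<in> D \<and>
        (\<exists>V\<in>flag_manifold d.
           stab V = stab (basis_flag f b) \<inter> tau ` stab (basis_flag (rev f) (rev b))))"


section \<open>Iwasawa-Schubert varieties\<close>

text \<open>The parameter \<open>e\<close> enumerates the index type, \<open>e\<^sub>i\<close> being the standard basis vector at
  \<open>Inl (e i)\<close> for \<open>i = 1, \<dots>, m\<close>.\<close>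

definition iwasawa_basis :: "(nat \<Rightarrow> 'm) \<Rightarrow> (complex^('m::finite + 'm)) list" where
  "iwasawa_basis e =
     concat (map (\<lambda>i. [axis (Inl (e i)) 1, quat_j (axis (Inl (e i)) 1)]) [1..<Suc CARD('m)])"

definition iwasawa_borel :: "(nat \<Rightarrow> 'm) \<Rightarrow> (complex^('m + 'm)^('m::finite + 'm)) set" where
  "iwasawa_borel e = stab (basis_flag (replicate (2 * CARD('m)) 1) (iwasawa_basis e))"

definition schubert_variety ::
    "(nat \<Rightarrow> 'm) \<Rightarrow> nat list \<Rightarrow> nat list \<Rightarrow> ('m::finite + 'm) flag set" where
  "schubert_variety e c w = flag_topology c closure_of
     orbit (iwasawa_borel e) (basis_flag c (map (\<lambda>k. iwasawa_basis e ! (k - 1)) w))"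

text \<open>The Schubert varieties of dimension complementary to \<open>C\<close> that meet \<open>C\<close>.\<close>

definition schubert_set ::
    "(nat \<Rightarrow> 'm) \<Rightarrow> nat list \<Rightarrow> ('m::finite + 'm) flag set \<Rightarrow> ('m + 'm) flag set set" where
  "schubert_set e c C = {schubert_variety e c w | w. minimal_representative c w \<and>
     analytic_dim (schubert_variety e c w) + analytic_dim C
       = analytic_dim (flag_manifold c :: ('m + 'm) flag set) \<and>
     schubert_variety e c w \<inter> C \<noteq> {}}"

end

theory Submission
  imports Defs
begin

text \<open>If \<open>K0 V\<close> is a complex submanifold, its tangent space is closed under \<open>\<i>\<close>. This space
  is \<open>\<kk> + \<sigma>\<close> modulo \<open>\<sigma>\<close>, where \<open>\<kk>\<close> is the Lie algebra of \<open>K0\<close> and \<open>\<sigma>\<close>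
  that of the stabilizer of \<open>V\<close>. At a maximum on \<open>K0 V\<close> of the height function of a regular
  diagonal element of \<open>\<i> \<kk>\<close>, this element therefore lies in \<open>\<sigma>\<close>, so the maximum is a
  coordinate flag; swaps of coordinates in \<open>K0\<close> show that it is the standard one, which does not
  depend on the orbit. The cycles \<open>C\<close> and \<open>Ch\<close> are thus the orbits of the two standard flags.
  Each subspace of the flag in the measurable model belongs to the flag in \<open>Z\<close> or is the quaternionic
  image of a complement of one that does, so both standard flags have the same stabilizer in
  \<open>\<kk>\<close>. Hence \<open>\<pi>\<close> maps \<open>Ch\<close> onto \<open>C\<close> and preserves its dimension.

  The dimension of \<open>S\<^sub>w\<close> is the number of inversions of \<open>w\<close> between different blocks, and
  \<open>\<pi>\<close> maps closures of cells onto closures of cells. Since the dimensions of \<open>Ch\<close> and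
  \<open>S\<^sub>w\<close> are complementary upstairs, they are complementary downstairs if and only if the number
  of inversions lost equals the dimension of the fibre of \<open>\<pi>\<close>, that is, if all pairs of positions
  in the same group but in different blocks are inversions. As the blocks are increasing, this says
  that every group is strictly decreasing.\<close>

section \<open>Tangent cones\<close>

text \<open>\<open>submanifold_at\<close> only asserts that some chart exists, and
  \<open>analytic_dim\<close> is a \<open>Max\<close> over all regular points; a dimension becomes
  usable only once it is tied to something independent of charts. The tangent cone serves this
  purpose: it is defined for any set by limits of rescaled secants, and at a submanifold point it is
  a real subspace of dimension \<open>2 * l\<close>, stable under \<open>\<i>\<close>. Homogeneity,
  or density of a homogeneous part, then leaves one candidate in the \<open>Max\<close>. For
  \<open>K0 V\<close> the cone is found by compactness and sequences, with Cayley transforms in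
  place of one-parameter groups. The dimension of a cycle is never evaluated: only the codimension
  in \<open>k0\<close> of its intersection with the flag algebra enters, and this is compared in the
  two flag manifolds. Two orders of the coordinates must be kept apart. In the Iwasawa order, which
  governs the Schubert cells, a vector and its quaternionic partner are adjacent; in the order
  \<open>q\<close> of the standard flag on the cycle, partners occupy mirror positions.\<close>

definition tangent_cone :: "'a::real_normed_vector set \<Rightarrow> 'a \<Rightarrow> 'a set" where
  "tangent_cone A p = {Z. \<exists>x t. (\<forall>n. x n \<in> A \<and> t n > 0) \<and> t \<longlonglongrightarrow> (0::real) \<and>
     (\<lambda>n. (x n - p) /\<^sub>R t n) \<longlonglongrightarrow> Z}"

lemma tangent_coneI:
  assumes "\<And>n. x n \<in> A" "\<And>n. t n > 0" "t \<longlonglongrightarrow> 0" "(\<lambda>n. (x n - p) /\<^sub>R t n) \<longlonglongrightarrow> Z"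
  shows "Z \<in> tangent_cone A p"
  using assms unfolding tangent_cone_def by blast

lemma tangent_coneE:
  assumes "Z \<in> tangent_cone A p"
  obtains x t where "\<And>n. x n \<in> A" "\<And>n. t n > 0" "t \<longlonglongrightarrow> 0"
    "(\<lambda>n. (x n - p) /\<^sub>R t n) \<longlonglongrightarrow> Z" "x \<longlonglongrightarrow> p"
proof -
  obtain x t where x: "\<And>n. x n \<in> A" and t: "\<And>n. t n > 0" "t \<longlonglongrightarrow> 0"
    and Z: "(\<lambda>n. (x n - p) /\<^sub>R t n) \<longlonglongrightarrow> Z"
    using assms unfolding tangent_cone_def by blast
  have "(\<lambda>n. p + t n *\<^sub>R ((x n - p) /\<^sub>R t n)) \<longlonglongrightarrow> p + 0 *\<^sub>R Z"
    by (intro tendsto_intros t Z)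
  moreover have "p + t n *\<^sub>R ((x n - p) /\<^sub>R t n) = x n" for n
    using t(1)[of n] by simp
  ultimately have "x \<longlonglongrightarrow> p" by simp
  then show ?thesis using that x t Z by blast
qed

lemma tangent_cone_image_subset:
  assumes "bounded_linear h"
  shows "h ` tangent_cone A p \<subseteq> tangent_cone (h ` A) (h p)"
proof clarify
  interpret bounded_linear h by fact
  fix Z assume "Z \<in> tangent_cone A p"
  then obtain x t where x: "\<And>n. x n \<in> A" and t: "\<And>n. t n > 0" "t \<longlonglongrightarrow> 0"
    and Z: "(\<lambda>n. (x n - p) /\<^sub>R t n) \<longlonglongrightarrow> Z" by (rule tangent_coneE) blast
  have "(\<lambda>n. h ((x n - p) /\<^sub>R t n)) \<longlonglongrightarrow> h Z" by (rule tendsto[OF Z])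
  then show "h Z \<in> tangent_cone (h ` A) (h p)"
    using x t by (intro tangent_coneI[where x = "h \<circ> x" and t = t]) (auto simp: diff scaleR)
qed

text \<open>Chain rule along secants: the remainder divided by the distance to \<open>p\<close>
  tends to 0, and the rescaled distances converge.\<close>

lemma tangent_cone_seq:
  assumes der: "(g has_derivative g') (at p)"
    and t: "\<And>n. t n > 0" "t \<longlonglongrightarrow> (0::real)" and Z: "(\<lambda>n. (x n - p) /\<^sub>R t n) \<longlonglongrightarrow> Z"
  shows "(\<lambda>n. (g (x n) - g p) /\<^sub>R t n) \<longlonglongrightarrow> g' Z"
proof -
  \<comment> \<open>Nothing prevents \<open>x n = p\<close>; the value 0 there makes \<epsilon>
    continuous at \<open>p\<close>.\<close>
  define \<epsilon> where "\<epsilon> y = (if y = p then 0 else norm (g y - g p - g' (y - p)) / norm (y - p))" for y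
  interpret bounded_linear g' using der by (rule has_derivative_bounded_linear)
  have "(\<lambda>n. p + t n *\<^sub>R ((x n - p) /\<^sub>R t n)) \<longlonglongrightarrow> p + 0 *\<^sub>R Z"
    by (intro tendsto_intros t Z)
  moreover have "p + t n *\<^sub>R ((x n - p) /\<^sub>R t n) = x n" for n
    using t(1)[of n] by simp
  ultimately have xp: "x \<longlonglongrightarrow> p" by simp
  have "((\<lambda>y. norm (g y - g p - g' (y - p)) / norm (y - p)) \<longlongrightarrow> 0) (at p)"
    using der unfolding has_derivative_iff_norm by blast
  then have "(\<epsilon> \<longlongrightarrow> 0) (at p)"
    by (rule Lim_transform_eventually) (auto simp: \<epsilon>_def eventually_at_filter)
  then have "isCont \<epsilon> p" by (simp add: isCont_def \<epsilon>_def)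
  then have e: "(\<lambda>n. \<epsilon> (x n)) \<longlonglongrightarrow> 0"
    using isCont_tendsto_compose[OF _ xp] by (fastforce simp: \<epsilon>_def)
  have "(\<lambda>n. \<epsilon> (x n) * norm ((x n - p) /\<^sub>R t n)) \<longlonglongrightarrow> 0 * norm Z"
    by (intro tendsto_intros e Z)
  moreover have "\<epsilon> (x n) * norm ((x n - p) /\<^sub>R t n)
      = norm ((g (x n) - g p) /\<^sub>R t n - g' ((x n - p) /\<^sub>R t n))" for n
  proof -
    have "(g (x n) - g p) /\<^sub>R t n - g' ((x n - p) /\<^sub>R t n) = (g (x n) - g p - g' (x n - p)) /\<^sub>R t n"
      unfolding scaleR by (simp only: scaleR_diff_right)
    then show ?thesis using t(1)[of n] by (auto simp: \<epsilon>_def zero)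
  qed
  ultimately have "(\<lambda>n. (g (x n) - g p) /\<^sub>R t n - g' ((x n - p) /\<^sub>R t n)) \<longlonglongrightarrow> 0"
    by (simp add: tendsto_norm_zero_iff)
  from tendsto_add[OF this tendsto[OF Z]] show ?thesis by simp
qed

text \<open>The chart carries secants of \<open>A\<close> into \<open>L\<close>, which is closed.
  Conversely a short segment from \<open>\<phi> p\<close> along \<open>L\<close> stays in the open
  set \<open>V\<close>, and its image under \<psi> is a sequence in \<open>A\<close> with the
  required direction.\<close>

lemma tangent_cone_chart:
  fixes \<phi> :: "'a::euclidean_space \<Rightarrow> 'a"
  assumes U: "open U" "p \<in> U" "p \<in> A" and V: "open V" and hom: "homeomorphism U V \<phi> \<psi>"
    and \<phi>': "(\<phi> has_derivative \<phi>') (at p)" and \<psi>': "(\<psi> has_derivative \<psi>') (at (\<phi> p))"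
    and L: "subspace L" and im: "\<phi> ` (U \<inter> A) = V \<inter> L"
  shows "tangent_cone A p = {Z. \<phi>' Z \<in> L}" and "\<And>Z. \<psi>' (\<phi>' Z) = Z" and "\<And>Z. \<phi>' (\<psi>' Z) = Z"
proof -
  have inv1: "\<psi> (\<phi> x) = x" if "x \<in> U" for x using hom that by (simp add: homeomorphism_def)
  have inv2: "\<phi> (\<psi> y) = y" if "y \<in> V" for y using hom that by (simp add: homeomorphism_def)
  have qV: "\<phi> p \<in> V" and qL: "\<phi> p \<in> L" using U im by auto
  have "(\<psi> \<circ> \<phi> has_derivative \<psi>' \<circ> \<phi>') (at p)" by (rule diff_chain_at[OF \<phi>' \<psi>'])
  moreover have "(\<psi> \<circ> \<phi> has_derivative id) (at p)"
    by (rule has_derivative_transform_within_open[OF has_derivative_id U(1,2)]) (simp add: inv1)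
  ultimately have "\<psi>' \<circ> \<phi>' = id" by (rule has_derivative_unique)
  then show a: "\<psi>' (\<phi>' Z) = Z" for Z by (metis comp_apply id_apply)
  have "(\<phi> \<circ> \<psi> has_derivative \<phi>' \<circ> \<psi>') (at (\<phi> p))"
    by (rule diff_chain_at[OF \<psi>']) (simp add: inv1 U \<phi>')
  moreover have "(\<phi> \<circ> \<psi> has_derivative id) (at (\<phi> p))"
    by (rule has_derivative_transform_within_open[OF has_derivative_id V qV]) (simp add: inv2)
  ultimately have "\<phi>' \<circ> \<psi>' = id" by (rule has_derivative_unique)
  then show b: "\<phi>' (\<psi>' Z) = Z" for Z by (metis comp_apply id_apply)
  show "tangent_cone A p = {Z. \<phi>' Z \<in> L}"
  proof (intro equalityI subsetI)
    fix Z assume "Z \<in> tangent_cone A p"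
    then obtain x t where x: "\<And>n. x n \<in> A" and t: "\<And>n. t n > 0" "t \<longlonglongrightarrow> 0"
      and Z: "(\<lambda>n. (x n - p) /\<^sub>R t n) \<longlonglongrightarrow> Z" and xp: "x \<longlonglongrightarrow> p" by (rule tangent_coneE) blast
    have "\<forall>\<^sub>F n in sequentially. x n \<in> U" using topological_tendstoD[OF xp U(1) U(2)] .
    then have "\<forall>\<^sub>F n in sequentially. (\<phi> (x n) - \<phi> p) /\<^sub>R t n \<in> L"
    proof eventually_elim
      case (elim n)
      then have "\<phi> (x n) \<in> L" using x im by blast
      then show ?case using L qL by (simp add: subspace_diff subspace_scale)
    qed
    moreover have "(\<lambda>n. (\<phi> (x n) - \<phi> p) /\<^sub>R t n) \<longlonglongrightarrow> \<phi>' Z"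
      by (rule tangent_cone_seq[OF \<phi>' t Z])
    ultimately show "Z \<in> {Z. \<phi>' Z \<in> L}"
      using closed_subspace[OF L] by (auto intro: Lim_in_closed_set)
  next
    fix Z assume Z: "Z \<in> {Z. \<phi>' Z \<in> L}"
    define y where "y s = \<phi> p + s *\<^sub>R \<phi>' Z" for s
    have "(y \<longlongrightarrow> y 0) (at_right 0)" unfolding y_def by (intro tendsto_intros)
    then have "\<forall>\<^sub>F s in at_right 0. y s \<in> V"
      using topological_tendstoD[OF _ V, of y "y 0"] qV by (simp add: y_def)
    then obtain s0 where s0: "s0 > 0" "\<And>s. 0 < s \<Longrightarrow> s < s0 \<Longrightarrow> y s \<in> V"
      by (auto simp: eventually_at_right_field)
    \<comment> \<open>The factor 2 and \<open>Suc n\<close> keep \<open>t n\<close> strictly between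
      0 and \<open>s0\<close>, so that every \<open>y (t n)\<close> lies in
      \<open>V\<close>.\<close>
    define t where "t n = s0 / (2 * real (Suc n))" for n
    have t: "t n > 0" "t n < s0" for n using s0(1) by (auto simp: t_def divide_simps)
    have "(\<lambda>n. (s0 / 2) * inverse (real (Suc n))) \<longlonglongrightarrow> (s0/2) * 0"
      by (intro tendsto_intros LIMSEQ_inverse_real_of_nat)
    moreover have "(\<lambda>n. (s0 / 2) * inverse (real (Suc n))) = t" by (auto simp: t_def field_simps)
    ultimately have "t \<longlonglongrightarrow> (s0 / 2) * 0" by metis
    then have t0: "t \<longlonglongrightarrow> 0" by simp
    have yV: "y (t n) \<in> V \<inter> L" for n
      using s0(2) t Z qL L by (auto simp: y_def subspace_add subspace_scale)
    have "(y (t n) - \<phi> p) /\<^sub>R t n = \<phi>' Z" for n using t(1)[of n] by (simp add: y_def)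
    then have "(\<lambda>n. (y (t n) - \<phi> p) /\<^sub>R t n) \<longlonglongrightarrow> \<phi>' Z" by simp
    from tangent_cone_seq[OF \<psi>' t(1) t0 this]
    have "(\<lambda>n. (\<psi> (y (t n)) - p) /\<^sub>R t n) \<longlonglongrightarrow> Z" by (simp add: inv1 U a)
    moreover have "\<psi> (y (t n)) \<in> A" for n
    proof -
      obtain x where "x \<in> U \<inter> A" "y (t n) = \<phi> x" using yV[of n] im by blast
      then show ?thesis by (simp add: inv1)
    qed
    ultimately show "Z \<in> tangent_cone A p" using t(1) t0 by (intro tangent_coneI)
  qed
qed

text \<open>The cone is the image of \<open>L\<close> under the derivative of the inverse chart, an
  isomorphism. It is complex because \<open>L\<close> is and because the derivative of the chart
  commutes with \<open>\<i>\<close>.\<close>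

lemma matrix_submanifold_tangent_cone:
  assumes "matrix_submanifold_at l A p"
  shows "subspace (tangent_cone A p)" and "dim (tangent_cone A p) = 2 * l"
    and "\<And>Z. Z \<in> tangent_cone A p \<Longrightarrow> map_matrix ((*) \<i>) Z \<in> tangent_cone A p"
proof -
  obtain U V \<phi> \<psi> L where p: "p \<in> A" "open U" "p \<in> U" "open V" and hom: "homeomorphism U V \<phi> \<psi>"
    and c: "complex_differentiable_on \<phi> U" "complex_differentiable_on \<psi> V"
    and L: "subspace L" "map_matrix ((*) \<i>) ` L \<subseteq> L" "dim L = 2 * l"
    and im: "\<phi> ` (U \<inter> A) = V \<inter> L"
    using assms unfolding matrix_submanifold_at_def by blast
  have qV: "\<phi> p \<in> V" using p im by auto
  obtain \<phi>' where \<phi>': "(\<phi> has_derivative \<phi>') (at p)"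
    and i: "\<And>Y. \<phi>' (map_matrix ((*) \<i>) Y) = map_matrix ((*) \<i>) (\<phi>' Y)"
    using c(1) p(3) unfolding complex_differentiable_on_def by blast
  obtain \<psi>' where \<psi>': "(\<psi> has_derivative \<psi>') (at (\<phi> p))"
    using c(2) qV unfolding complex_differentiable_on_def by blast
  note chart = tangent_cone_chart[OF p(2,3,1,4) hom \<phi>' \<psi>' L(1) im]
  have T: "tangent_cone A p = \<psi>' ` L" unfolding chart(1)
  proof (intro equalityI subsetI)
    fix Z assume "Z \<in> {Z. \<phi>' Z \<in> L}"
    then show "Z \<in> \<psi>' ` L" using chart(2)[of Z] by (metis imageI mem_Collect_eq)
  next
    fix Z assume "Z \<in> \<psi>' ` L"
    then show "Z \<in> {Z. \<phi>' Z \<in> L}" using chart(3) by auto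
  qed
  interpret bounded_linear \<psi>' using \<psi>' by (rule has_derivative_bounded_linear)
  have lin: "linear \<psi>'" by (simp add: linear_axioms)
  show "subspace (tangent_cone A p)" unfolding T using lin L(1) by (rule linear_subspace_image)
  have "inj \<psi>'" using chart(3) by (metis injI)
  then show "dim (tangent_cone A p) = 2 * l" unfolding T using lin L(3)
    by (simp add: dim_image_eq inj_on_subset)
  show "map_matrix ((*) \<i>) Z \<in> tangent_cone A p" if "Z \<in> tangent_cone A p" for Z
    using that L(2) i unfolding chart(1) by auto
qed

section \<open>Products of a compact matrix group with the units of a matrix algebra\<close>

lemma bounded_bilinear_matrix_mult:
  "bounded_bilinear ((**) :: complex^'n^'m \<Rightarrow> complex^'p^'n \<Rightarrow> complex^'p^'m)"
proof -
  have "(r *\<^sub>R A) ** B = r *\<^sub>R (A ** B)" "A ** (r *\<^sub>R B) = r *\<^sub>R (A ** B)"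
    for r and A :: "complex^'n^'m" and B :: "complex^'p^'n"
    by (simp_all add: matrix_matrix_mult_def vec_eq_iff scaleR_sum_right)
  moreover have "(A + B) ** C = A ** C + B ** C" for A B :: "complex^'n^'m" and C :: "complex^'p^'n"
    by (simp add: matrix_matrix_mult_def vec_eq_iff distrib_right sum.distrib)
  ultimately show ?thesis
    unfolding bilinear_conv_bounded_bilinear[symmetric] bilinear_def
    by (auto intro!: linearI simp: matrix_add_ldistrib)
qed

interpretation mmult: bounded_bilinear "(**) :: complex^'n^'n \<Rightarrow> complex^'n^'n \<Rightarrow> complex^'n^'n"
  by (rule bounded_bilinear_matrix_mult)

lemma invertible_near_one:
  obtains \<epsilon> where "\<epsilon> > 0" "\<And>X :: complex^'n^'n. norm X < \<epsilon> \<Longrightarrow> invertible (mat 1 + X)"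
proof -
  have "continuous_on UNIV (det :: complex^'n^'n \<Rightarrow> complex)"
    unfolding det_def by (intro continuous_intros)
  then have "open (det -` (- {0 :: complex}) :: (complex^'n^'n) set)"
    by (intro open_vimage) auto
  moreover have "mat 1 \<in> (det -` (- {0 :: complex}) :: (complex^'n^'n) set)" by simp
  ultimately obtain \<epsilon> where e: "\<epsilon> > 0" "ball (mat 1) \<epsilon> \<subseteq> (det -` (- {0 :: complex}) :: (complex^'n^'n) set)"
    by (meson open_contains_ball)
  have "invertible (mat 1 + X)" if "norm X < \<epsilon>" for X :: "complex^'n^'n"
  proof -
    have "mat 1 + X \<in> ball (mat 1) \<epsilon>" using that by (simp add: dist_norm)
    then show ?thesis using e(2) by (auto simp: invertible_det_nz)
  qed
  then show ?thesis using e(1) that by blast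
qed

lemma Lim_in_subspace:
  fixes L :: "'a::euclidean_space set"
  assumes "subspace L" "\<And>n. x n \<in> L" "x \<longlonglongrightarrow> l"
  shows "l \<in> L"
  using closed_sequentially[OF closed_subspace[OF assms(1)]] assms by blast

text \<open>Whenever \<open>x = k s\<close>, the factor \<open>k\<close> can be chosen closest to the identity within
  \<open>k (K \<inter> S)\<close>. Along a sequence tending to the identity both factors then tend to the identity at
  a comparable rate: otherwise a limiting direction would lie in \<open>\<kk> \<inter> \<sigma>\<close>, and moving
  \<open>k\<close> along it would bring it closer to the identity.\<close>

lemma tangent_cone_compact_mult:
  fixes K :: "(complex^'n^'n) set"
  assumes K: "compact K" "mat 1 \<in> K" "\<And>x y. x \<in> K \<Longrightarrow> y \<in> K \<Longrightarrow> x ** y \<in> K"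
      "\<And>x. x \<in> K \<Longrightarrow> \<exists>y\<in>K. x ** y = mat 1"
    and \<kk>: "subspace \<kk>" "tangent_cone K (mat 1) \<subseteq> \<kk>"
    and curve: "\<And>X. X \<in> \<kk> \<Longrightarrow> \<exists>c. (\<forall>s>0. c s \<in> K \<and> (X \<in> \<sigma> \<longrightarrow> c s \<in> \<sigma>)) \<and>
      ((\<lambda>s::real. (c s - mat 1) /\<^sub>R s) \<longlongrightarrow> X) (at_right 0)"
    and \<sigma>: "subspace \<sigma>" "mat 1 \<in> \<sigma>" "\<And>x y. x \<in> \<sigma> \<Longrightarrow> y \<in> \<sigma> \<Longrightarrow> x ** y \<in> \<sigma>"
      "\<And>x y. x \<in> \<sigma> \<Longrightarrow> x ** y = mat 1 \<Longrightarrow> y \<in> \<sigma>"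
  shows "tangent_cone {k ** s | k s. k \<in> K \<and> s \<in> \<sigma> \<and> invertible s} (mat 1)
    = {X + Y | X Y. X \<in> \<kk> \<and> Y \<in> \<sigma>}" (is "tangent_cone ?A _ = ?R")
proof (intro equalityI subsetI)
  fix Z assume "Z \<in> ?R"
  then obtain X Y where Z: "Z = X + Y" "X \<in> \<kk>" "Y \<in> \<sigma>" by blast
  obtain c where c: "\<And>s. s > 0 \<Longrightarrow> c s \<in> K"
    and cX: "((\<lambda>s::real. (c s - mat 1) /\<^sub>R s) \<longlongrightarrow> X) (at_right 0)" using curve[OF Z(2)] by blast
  obtain \<epsilon> where \<epsilon>: "\<epsilon> > 0" "\<And>X :: complex^'n^'n. norm X < \<epsilon> \<Longrightarrow> invertible (mat 1 + X)"
    by (rule invertible_near_one) blast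
  \<comment> \<open>Chosen so small that the identity plus \<open>t n\<close> times \<open>Y\<close>
    is invertible for every \<open>n\<close>; the summand 1 in the denominator allows
    \<open>Y = 0\<close>.\<close>
  define t where "t n = \<epsilon> / (norm Y + 1) * inverse (real (Suc (Suc n)))" for n
  have t: "t n > 0" for n using \<epsilon>(1) by (simp add: t_def add_nonneg_pos)
  have "norm (t n *\<^sub>R Y) < \<epsilon>" for n
  proof -
    have "t n * norm Y \<le> t n * (norm Y + 1)" using t[of n] by simp
    also have "\<dots> = \<epsilon> * inverse (real (Suc (Suc n)))"
      by (simp add: t_def add_nonneg_eq_0_iff)
    also have "\<dots> < \<epsilon> * 1" using \<epsilon>(1) by (intro mult_strict_left_mono) (auto simp: field_simps)
    finally show ?thesis using t[of n] by simp
  qed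
  then have inv: "invertible (mat 1 + t n *\<^sub>R Y)" for n using \<epsilon>(2) by blast
  have "(\<lambda>n. inverse (real (Suc (Suc n)))) \<longlonglongrightarrow> 0"
    using LIMSEQ_Suc[OF LIMSEQ_inverse_real_of_nat] .
  from tendsto_mult_left[OF this, of "\<epsilon> / (norm Y + 1)"]
  have t0: "t \<longlonglongrightarrow> 0" unfolding t_def[abs_def] by (simp only: mult_zero_right)
  then have tr: "filterlim t (at_right 0) sequentially"
    using t by (intro tendsto_imp_filterlim_at_right) simp_all
  have cn: "(\<lambda>n. (c (t n) - mat 1) /\<^sub>R t n) \<longlonglongrightarrow> X" using filterlim_compose[OF cX tr] .
  have "(\<lambda>n. t n *\<^sub>R ((c (t n) - mat 1) /\<^sub>R t n)) \<longlonglongrightarrow> 0 *\<^sub>R X" by (intro tendsto_intros t0 cn)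
  moreover have "t n *\<^sub>R ((c (t n) - mat 1) /\<^sub>R t n) = c (t n) - mat 1" for n using t[of n] by simp
  ultimately have "(\<lambda>n. c (t n) - mat 1) \<longlonglongrightarrow> 0" by simp
  then have c1: "(\<lambda>n. c (t n)) \<longlonglongrightarrow> mat 1" by (simp add: LIM_zero_iff)
  \<comment> \<open>The secant of the product of \<open>c (t n)\<close> with the identity plus
    \<open>t n\<close> times \<open>Y\<close> splits into the secant of the curve and
    \<open>c (t n) ** Y\<close>.\<close>
  have "(\<lambda>n. (c (t n) - mat 1) /\<^sub>R t n + c (t n) ** Y) \<longlonglongrightarrow> X + mat 1 ** Y"
    by (intro tendsto_intros mmult.tendsto cn c1)
  moreover have "(c (t n) - mat 1) /\<^sub>R t n + c (t n) ** Y
      = (c (t n) ** (mat 1 + t n *\<^sub>R Y) - mat 1) /\<^sub>R t n" for n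
    using t[of n] by (simp add: mmult.add_right mmult.scaleR_right algebra_simps)
  ultimately have "(\<lambda>n. (c (t n) ** (mat 1 + t n *\<^sub>R Y) - mat 1) /\<^sub>R t n) \<longlonglongrightarrow> Z"
    by (simp add: Z(1))
  moreover have "c (t n) ** (mat 1 + t n *\<^sub>R Y) \<in> ?A" for n
    using c[OF t[of n]] inv[of n] \<sigma>(1,2) Z(3) subspace_add subspace_scale by blast
  ultimately show "Z \<in> tangent_cone ?A (mat 1)" using t t0 by (intro tangent_coneI)
next
  fix Z assume "Z \<in> tangent_cone ?A (mat 1)"
  then obtain x t where x: "\<And>n. x n \<in> ?A" and t: "\<And>n. t n > 0" "t \<longlonglongrightarrow> 0"
    and Z: "(\<lambda>n. (x n - mat 1) /\<^sub>R t n) \<longlonglongrightarrow> Z" and x1: "x \<longlonglongrightarrow> mat 1"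
    by (rule tangent_coneE) blast
  have comm: "y ** z = mat 1 \<longleftrightarrow> z ** y = mat 1" for y z :: "complex^'n^'n"
    by (rule matrix_left_right_inverse)
  have cp: "compact (K \<inter> \<sigma>)" using K(1) closed_subspace[OF \<sigma>(1)] by (rule compact_Int_closed)
  have "\<exists>k y s. k \<in> K \<and> y \<in> K \<and> k ** y = mat 1 \<and> s \<in> \<sigma> \<and> x n = k ** s \<and>
     (\<forall>h\<in>K \<inter> \<sigma>. norm (k - mat 1) \<le> norm (k ** h - mat 1))" for n
  proof -
    obtain k s where ks: "x n = k ** s" "k \<in> K" "s \<in> \<sigma>" using x[of n] by blast
    have "continuous_on (K \<inter> \<sigma>) (\<lambda>h. norm (k ** h - mat 1))"
      by (intro continuous_intros mmult.continuous_on)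
    then obtain h where h: "h \<in> K \<inter> \<sigma>"
      "\<And>g. g \<in> K \<inter> \<sigma> \<Longrightarrow> norm (k ** h - mat 1) \<le> norm (k ** g - mat 1)"
      using continuous_attains_inf[OF cp] K(2) \<sigma>(2) by blast
    obtain g where g: "g \<in> K" "h ** g = mat 1" using h(1) K(4) by blast
    have kh: "k ** h \<in> K" using ks(2) h(1) K(3) by blast
    obtain y where y: "y \<in> K" "(k ** h) ** y = mat 1" using K(4)[OF kh] by blast
    have gs: "g ** s \<in> \<sigma>" using \<sigma>(3,4) h(1) g ks(3) by blast
    have "k ** h ** (g ** s) = k ** (h ** g) ** s" by (simp add: matrix_mul_assoc)
    then have "x n = k ** h ** (g ** s)" using ks g by simp
    moreover have "norm (k ** h - mat 1) \<le> norm (k ** h ** h' - mat 1)" if "h' \<in> K \<inter> \<sigma>" for h'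
    proof -
      have "h ** h' \<in> K \<inter> \<sigma>" using K(3) \<sigma>(3) h(1) that by blast
      from h(2)[OF this] show ?thesis by (simp add: matrix_mul_assoc)
    qed
    ultimately show ?thesis using kh y gs by blast
  qed
  then obtain k y s where k: "\<And>n. k n \<in> K" and y: "\<And>n. y n \<in> K" and ky: "\<And>n. k n ** y n = mat 1"
    and s: "\<And>n. s n \<in> \<sigma>" and xn: "\<And>n. x n = k n ** s n"
    and min: "\<And>n h. h \<in> K \<Longrightarrow> h \<in> \<sigma> \<Longrightarrow> norm (k n - mat 1) \<le> norm (k n ** h - mat 1)"
    by (metis (no_types, lifting) IntI)
  have yk: "y n ** k n = mat 1" for n using ky comm by blast
  have ys: "y n ** x n = s n" for n by (simp add: xn matrix_mul_assoc yk)
  \<comment> \<open>Otherwise a subsequence of \<open>k\<close> keeps its distance from the identity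
    and converges to some \<open>k'\<close> with inverse \<open>y'\<close>. As a limit of the
    \<open>s n\<close>, this \<open>y'\<close> lies in \<sigma> and competes in \<open>min\<close>;
    but \<open>k ** y'\<close> tends to the identity along the subsequence.\<close>
  have k1: "k \<longlonglongrightarrow> mat 1"
  proof (rule ccontr)
    assume "\<not> k \<longlonglongrightarrow> mat 1"
    then obtain \<epsilon> where \<epsilon>: "\<epsilon> > 0" "\<not> (\<forall>\<^sub>F n in sequentially. dist (k n) (mat 1) < \<epsilon>)"
      unfolding tendsto_iff by blast
    then have "\<exists>\<^sub>F n in sequentially. dist (k n) (mat 1) \<ge> \<epsilon>"
      by (simp add: not_eventually not_less)
    then have "infinite {n. dist (k n) (mat 1) \<ge> \<epsilon>}"
      by (simp add: frequently_cofinite flip: cofinite_eq_sequentially)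
    then obtain r :: "nat \<Rightarrow> nat" where r: "strict_mono r" "\<And>n. dist (k (r n)) (mat 1) \<ge> \<epsilon>"
      using infinite_enumerate by (metis mem_Collect_eq)
    have ky': "\<forall>n. (\<lambda>n. (k (r n), y (r n))) n \<in> K \<times> K" using k y by blast
    obtain l q where l: "l \<in> K \<times> K" and q: "strict_mono q"
      "((\<lambda>n. (k (r n), y (r n))) \<circ> q) \<longlonglongrightarrow> l"
      by (rule seq_compactE[OF compact_imp_seq_compact[OF compact_Times[OF K(1) K(1)]] ky'])
    define k' y' where "k' = fst l" and "y' = snd l"
    have k': "(\<lambda>n. k (r (q n))) \<longlonglongrightarrow> k'" and y': "(\<lambda>n. y (r (q n))) \<longlonglongrightarrow> y'"
      using tendsto_fst[OF q(2)] tendsto_snd[OF q(2)] by (simp_all add: k'_def y'_def o_def)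
    have sub: "strict_mono (r \<circ> q)" using r(1) q(1) by (rule strict_mono_o)
    have x': "(\<lambda>n. x (r (q n))) \<longlonglongrightarrow> mat 1"
      using LIMSEQ_subseq_LIMSEQ[OF x1 sub] by (simp add: o_def)
    have "(\<lambda>n. k (r (q n)) ** y (r (q n))) \<longlonglongrightarrow> k' ** y'" by (intro mmult.tendsto k' y')
    then have k'y': "k' ** y' = mat 1" using ky by (simp add: LIMSEQ_const_iff)
    have "(\<lambda>n. y (r (q n)) ** x (r (q n))) \<longlonglongrightarrow> y' ** mat 1" by (intro mmult.tendsto x' y')
    then have "y' \<in> \<sigma>" using Lim_in_subspace[OF \<sigma>(1), of "\<lambda>n. s (r (q n))"] s by (simp add: ys)
    moreover have "y' \<in> K" using l by (auto simp: y'_def)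
    ultimately have "norm (k (r (q n)) - mat 1) \<le> norm (k (r (q n)) ** y' - mat 1)" for n
      using min by blast
    then have "\<epsilon> \<le> norm (k (r (q n)) ** y' - mat 1)" for n
      using r(2)[of "q n"] by (metis dist_norm order_trans)
    moreover have "(\<lambda>n. norm (k (r (q n)) ** y' - mat 1)) \<longlonglongrightarrow> norm (k' ** y' - mat 1)"
      by (intro tendsto_intros mmult.tendsto k')
    ultimately have "\<epsilon> \<le> norm (k' ** y' - mat 1)" by (intro LIMSEQ_le_const) auto
    then show False using k'y' \<epsilon>(1) by simp
  qed
  obtain b where b: "\<And>z. z \<in> K \<Longrightarrow> norm z \<le> b" using compact_imp_bounded[OF K(1)] unfolding bounded_iff by auto
  obtain M where M: "M > 0"
    "\<And>(u :: complex^'n^'n) (v :: complex^'n^'n). norm (u ** v) \<le> norm u * norm v * M"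
    using mmult.pos_bounded by blast
  have y1: "y \<longlonglongrightarrow> mat 1"
  proof -
    have "norm (y n - mat 1) \<le> b * M * norm (k n - mat 1)" for n
    proof -
      have "y n - mat 1 = - (y n ** (k n - mat 1))" by (simp add: mmult.diff_right yk)
      then have "norm (y n - mat 1) = norm (y n ** (k n - mat 1))" by simp
      also have "\<dots> \<le> norm (y n) * norm (k n - mat 1) * M" by (rule M(2))
      also have "\<dots> \<le> b * norm (k n - mat 1) * M"
        using b[OF y[of n]] M(1) by (intro mult_right_mono) auto
      finally show ?thesis by (simp add: ac_simps)
    qed
    moreover have "(\<lambda>n. b * M * norm (k n - mat 1)) \<longlonglongrightarrow> b * M * norm (mat 1 - mat 1 :: complex^'n^'n)"
      by (intro tendsto_intros k1)
    ultimately have "(\<lambda>n. y n - mat 1) \<longlonglongrightarrow> 0"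
      by (intro Lim_null_comparison[OF always_eventually, of "\<lambda>n. y n - mat 1"
            "\<lambda>n. b * M * norm (k n - mat 1)"]) simp_all
    then show ?thesis by (simp add: LIM_zero_iff)
  qed
  \<comment> \<open>A common scale for \<open>k n - mat 1\<close> and \<open>t n\<close>; the second
    summand keeps it positive when \<open>k n\<close> is the identity.\<close>
  define \<tau> where "\<tau> n = norm (k n - mat 1) + t n" for n
  have \<tau>: "\<tau> n > 0" for n using t(1)[of n] by (simp add: \<tau>_def add_nonneg_pos)
  have "(\<lambda>n. norm (k n - mat 1) + t n) \<longlonglongrightarrow> norm (mat 1 - mat 1 :: complex^'n^'n) + 0"
    by (intro tendsto_intros k1 t)
  then have \<tau>0: "\<tau> \<longlonglongrightarrow> 0" by (simp add: \<tau>_def[abs_def])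
  define p where "p n = ((k n - mat 1) /\<^sub>R \<tau> n, t n / \<tau> n)" for n
  have pn: "norm ((k n - mat 1) /\<^sub>R \<tau> n) = 1 - t n / \<tau> n" for n
  proof -
    have "norm ((k n - mat 1) /\<^sub>R \<tau> n) = norm (k n - mat 1) / \<tau> n"
      unfolding norm_scaleR using \<tau>[of n] by (simp add: divide_inverse mult.commute)
    also have "norm (k n - mat 1) = \<tau> n - t n" by (simp add: \<tau>_def)
    finally show ?thesis using \<tau>[of n] by (simp add: diff_divide_distrib)
  qed
  have "norm (p n) \<le> 1 + 1" for n
  proof -
    have "norm (p n) \<le> norm ((k n - mat 1) /\<^sub>R \<tau> n) + norm (t n / \<tau> n)"
      unfolding p_def by (rule norm_Pair_le)
    then show ?thesis using pn[of n] \<tau>[of n] t(1)[of n] by (simp add: \<tau>_def)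
  qed
  then have "bounded (range p)" by (auto simp: bounded_iff)
  then obtain l r where r: "strict_mono (r :: nat \<Rightarrow> nat)" "(p \<circ> r) \<longlonglongrightarrow> l"
    using bounded_imp_convergent_subsequence[of p] by blast
  define X \<beta> where "X = fst l" and "\<beta> = snd l"
  have X: "(\<lambda>n. (k (r n) - mat 1) /\<^sub>R \<tau> (r n)) \<longlonglongrightarrow> X" and \<beta>: "(\<lambda>n. t (r n) / \<tau> (r n)) \<longlonglongrightarrow> \<beta>"
    using tendsto_fst[OF r(2)] tendsto_snd[OF r(2)] by (simp_all add: X_def \<beta>_def p_def o_def)
  have sub: "(\<lambda>n. f (r n)) \<longlonglongrightarrow> l" if "f \<longlonglongrightarrow> l" for f :: "nat \<Rightarrow> 'b::topological_space" and l
    using LIMSEQ_subseq_LIMSEQ[OF that r(1)] by (simp add: o_def)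
  \<comment> \<open>The normalized pair cannot vanish in the limit: if \<open>\<beta> = 0\<close>,
    then \<open>X\<close> is a unit vector.\<close>
  have nX: "norm X = 1 - \<beta>"
  proof -
    have "(\<lambda>n. 1 - t (r n) / \<tau> (r n)) \<longlonglongrightarrow> norm X" using tendsto_norm[OF X] by (simp only: pn)
    moreover have "(\<lambda>n. 1 - t (r n) / \<tau> (r n)) \<longlonglongrightarrow> 1 - \<beta>" by (intro tendsto_intros \<beta>)
    ultimately show ?thesis by (rule LIMSEQ_unique)
  qed
  have "X \<in> tangent_cone K (mat 1)"
    using k \<tau> sub[OF \<tau>0] X by (intro tangent_coneI[where x = "\<lambda>n. k (r n)" and t = "\<lambda>n. \<tau> (r n)"])
  then have X\<kk>: "X \<in> \<kk>" using \<kk> by blast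
  \<comment> \<open>From \<open>s n = y n ** x n\<close>: on the scale \<tau> the secants of
    \<open>s\<close> converge to \<beta> times \<open>Z\<close> minus \<open>X\<close>, which
    therefore lies in \<sigma>.\<close>
  have "(\<lambda>n. y (r n) ** ((t (r n) / \<tau> (r n)) *\<^sub>R ((x (r n) - mat 1) /\<^sub>R t (r n))
      - (k (r n) - mat 1) /\<^sub>R \<tau> (r n))) \<longlonglongrightarrow> mat 1 ** (\<beta> *\<^sub>R Z - X)"
    by (intro mmult.tendsto tendsto_intros sub[OF y1] \<beta> sub[OF Z] X)
  moreover have "y n ** ((t n / \<tau> n) *\<^sub>R ((x n - mat 1) /\<^sub>R t n) - (k n - mat 1) /\<^sub>R \<tau> n)
      = (s n - mat 1) /\<^sub>R \<tau> n" for n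
  proof -
    have "(t n / \<tau> n) *\<^sub>R ((x n - mat 1) /\<^sub>R t n) = (x n - mat 1) /\<^sub>R \<tau> n"
      using t(1)[of n] by (simp add: field_simps)
    then have "(t n / \<tau> n) *\<^sub>R ((x n - mat 1) /\<^sub>R t n) - (k n - mat 1) /\<^sub>R \<tau> n = (x n - k n) /\<^sub>R \<tau> n"
      by (simp add: algebra_simps)
    then show ?thesis by (simp add: mmult.scaleR_right mmult.diff_right ys yk)
  qed
  ultimately have "(\<lambda>n. (s (r n) - mat 1) /\<^sub>R \<tau> (r n)) \<longlonglongrightarrow> \<beta> *\<^sub>R Z - X" by simp
  moreover have "(s (r n) - mat 1) /\<^sub>R \<tau> (r n) \<in> \<sigma>" for n
    using s \<sigma>(1,2) by (intro subspace_scale subspace_diff)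
  ultimately have W: "\<beta> *\<^sub>R Z - X \<in> \<sigma>"
    by (rule Lim_in_subspace[OF \<sigma>(1), rotated])
  show "Z \<in> ?R"
  proof (cases "\<beta> = 0")
    case False
    then have "Z = X /\<^sub>R \<beta> + (\<beta> *\<^sub>R Z - X) /\<^sub>R \<beta>" by (simp add: algebra_simps)
    moreover have "X /\<^sub>R \<beta> \<in> \<kk>" "(\<beta> *\<^sub>R Z - X) /\<^sub>R \<beta> \<in> \<sigma>"
      using X\<kk> W \<kk> \<sigma> by (auto intro: subspace_scale)
    ultimately show ?thesis by blast
  next
    case True
    then have "- X \<in> \<sigma>" "- X \<in> \<kk>" using W X\<kk> \<kk>(1) by (auto intro: subspace_neg)
    then obtain c where c: "\<And>s. s > 0 \<Longrightarrow> c s \<in> K" "\<And>s. s > 0 \<Longrightarrow> c s \<in> \<sigma>"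
      and cX: "((\<lambda>s::real. (c s - mat 1) /\<^sub>R s) \<longlongrightarrow> - X) (at_right 0)" using curve by blast
    \<comment> \<open>\<open>h n\<close> lies in both \<open>K\<close> and \<sigma>, so
      \<open>min\<close> applies to it. Its direction \<open>- X\<close> cancels \<open>k\<close> to
      first order, which forces \<open>X = 0\<close> although \<open>X\<close> has norm 1.\<close>
    define h where "h n = c (\<tau> (r n))" for n
    have "filterlim (\<lambda>n. \<tau> (r n)) (at_right 0) sequentially"
      using \<tau> sub[OF \<tau>0] by (intro tendsto_imp_filterlim_at_right) simp_all
    then have hX: "(\<lambda>n. (h n - mat 1) /\<^sub>R \<tau> (r n)) \<longlonglongrightarrow> - X"
      unfolding h_def using filterlim_compose[OF cX] by blast
    have "(\<lambda>n. (k (r n) - mat 1) /\<^sub>R \<tau> (r n) + k (r n) ** ((h n - mat 1) /\<^sub>R \<tau> (r n)))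
        \<longlonglongrightarrow> X + mat 1 ** (- X)"
      by (intro tendsto_intros mmult.tendsto X hX sub[OF k1])
    moreover have "(k (r n) - mat 1) /\<^sub>R \<tau> (r n) + k (r n) ** ((h n - mat 1) /\<^sub>R \<tau> (r n))
        = (k (r n) ** h n - mat 1) /\<^sub>R \<tau> (r n)" for n
      by (simp add: mmult.scaleR_right mmult.diff_right algebra_simps)
    ultimately have "(\<lambda>n. (k (r n) ** h n - mat 1) /\<^sub>R \<tau> (r n)) \<longlonglongrightarrow> 0" by simp
    then have lim0: "(\<lambda>n. norm ((k (r n) ** h n - mat 1) /\<^sub>R \<tau> (r n))) \<longlonglongrightarrow> 0"
      by (rule tendsto_norm_zero)
    have "norm ((k (r n) - mat 1) /\<^sub>R \<tau> (r n))
        \<le> norm ((k (r n) ** h n - mat 1) /\<^sub>R \<tau> (r n))" for n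
      using min[of "h n" "r n"] c \<tau>[of "r n"] by (simp add: h_def divide_right_mono mult_left_mono)
    then have "norm X \<le> 0" by (intro LIMSEQ_le[OF tendsto_norm[OF X] lim0]) auto
    then show ?thesis using nX True by simp
  qed
qed

section \<open>Group actions on flags\<close>

lemma matrix_inv_mult:
  fixes g :: "complex^'n^'n"
  assumes "invertible g"
  shows "g ** matrix_inv g = mat 1" "matrix_inv g ** g = mat 1" "invertible (matrix_inv g)"
proof -
  show 1: "g ** matrix_inv g = mat 1" "matrix_inv g ** g = mat 1"
    using assms unfolding invertible_def matrix_inv_def by (metis (mono_tags, lifting) someI_ex)+
  then show "invertible (matrix_inv g)" unfolding invertible_def by blast
qed

lemma mult_matrix_inv_cancel:
  fixes g :: "complex^'n^'n"
  assumes "invertible g"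
  shows "g ** (matrix_inv g ** X) = X" "matrix_inv g ** (g ** X) = X"
    "X ** g ** matrix_inv g = X" "X ** matrix_inv g ** g = X"
  using matrix_inv_mult[OF assms]
  by (simp_all add: matrix_mul_assoc) (simp_all flip: matrix_mul_assoc)

lemma act_act: "act g (act h V) = act (g ** h) V"
  by (simp add: act_def image_image matrix_vector_mul_assoc)

lemma act_one [simp]: "act (mat 1) V = V"
  by (simp add: act_def map_idI)

lemma act_inv:
  assumes "invertible g"
  shows "act (matrix_inv g) (act g V) = V" "act g (act (matrix_inv g) V) = V"
  using matrix_inv_mult[OF assms] by (simp_all add: act_act)

lemma length_act [simp]: "length (act g V) = length V" by (simp add: act_def)

lemma nth_act [simp]: "i < length V \<Longrightarrow> act g V ! i = (*v) g ` (V ! i)" by (simp add: act_def)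

lemma dim_image_invertible:
  fixes g :: "complex^'n^'n"
  assumes "invertible g"
  shows "vec.dim ((*v) g ` U) = vec.dim U"
  using vec.dim_image_eq[OF matrix_vector_mul_linear_gen] inj_matrix_vector_mult[OF assms]
  by (metis inj_on_subset subset_UNIV)

lemma act_flag_manifold:
  assumes "V \<in> flag_manifold c" "invertible g"
  shows "act g V \<in> flag_manifold c"
  using assms unfolding flag_manifold_def
  by (auto simp: dim_image_invertible image_mono
      intro!: vec.linear_subspace_image[OF matrix_vector_mul_linear_gen])

text \<open>The Lie algebra of the stabilizer in the general linear group. It is also a unital
  associative algebra whose invertible elements form the stabilizer itself, so one set plays both
  roles.\<close>

definition flag_algebra :: "('n::finite) flag \<Rightarrow> (complex^'n^'n) set" where
  "flag_algebra V = {X. \<forall>U\<in>set V. (*v) X ` U \<subseteq> U}"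

lemma stab_real_dim_eq: "stab_real_dim V = dim (flag_algebra V)"
  by (simp add: stab_real_dim_def flag_algebra_def)

lemma flag_manifold_subspace:
  assumes "V \<in> flag_manifold c" "U \<in> set V"
  shows "vec.subspace U"
  using assms by (auto simp: flag_manifold_def in_set_conv_nth)

lemma scaleR_matrix_vector: "(r *\<^sub>R X) *v v = r *\<^sub>R (X *v v)"
  for X :: "complex^'n^'m"
  by (simp add: matrix_vector_mult_def vec_eq_iff scaleR_sum_right)

lemma scaleR_eq_smult: "r *\<^sub>R v = complex_of_real r *s v" for v :: "complex^'n"
  unfolding vec_eq_iff by (simp, simp only: scaleR_conv_of_real, simp)

lemma map_matrix_mult_vector: "map_matrix ((*) c) X *v v = c *s (X *v v)"
  for X :: "complex^'n^'m"
  by (simp add: matrix_vector_mult_def vec_eq_iff sum_distrib_left mult.assoc)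

lemma subspace_flag_algebra:
  assumes "\<And>U. U \<in> set V \<Longrightarrow> vec.subspace U"
  shows "subspace (flag_algebra V)"
proof -
  have 1: "0 *v v = 0" for v :: "complex^'a"
    by (simp add: matrix_vector_mult_def vec_eq_iff)
  show ?thesis unfolding subspace_def flag_algebra_def
    using assms by (auto simp: 1 matrix_vector_mult_add_rdistrib scaleR_matrix_vector scaleR_eq_smult
        image_subset_iff intro: vec.subspace_0 vec.subspace_add vec.subspace_scale)
qed

lemma flag_algebra_one: "mat 1 \<in> flag_algebra V"
  by (simp add: flag_algebra_def)

lemma flag_algebra_mult: "X \<in> flag_algebra V \<Longrightarrow> Y \<in> flag_algebra V \<Longrightarrow> X ** Y \<in> flag_algebra V"
  by (auto simp: flag_algebra_def image_subset_iff simp flip: matrix_vector_mul_assoc)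

text \<open>An invertible matrix that sends a subspace into itself maps it onto itself, by
  dimension.\<close>

lemma act_eq_iff:
  assumes V: "\<And>U. U \<in> set V \<Longrightarrow> vec.subspace U" and g: "invertible g"
  shows "act g V = V \<longleftrightarrow> g \<in> flag_algebra V"
proof
  assume "act g V = V"
  then have "\<forall>U\<in>set V. (*v) g ` U = U" by (simp add: act_def map_idI map_eq_conv[of _ _ id, simplified])
  then show "g \<in> flag_algebra V" by (simp add: flag_algebra_def)
next
  assume a: "g \<in> flag_algebra V"
  have "(*v) g ` U = U" if "U \<in> set V" for U
  proof (rule vec.subspace_dim_equal)
    show "vec.subspace ((*v) g ` U)"
      by (intro vec.linear_subspace_image[OF matrix_vector_mul_linear_gen] V that)
    show "vec.subspace U" by (rule V[OF that])
    show "(*v) g ` U \<subseteq> U" using a that by (simp add: flag_algebra_def)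
  qed (simp add: dim_image_invertible g)
  then show "act g V = V" by (simp add: act_def map_idI)
qed

lemma flag_algebra_inverse:
  assumes V: "\<And>U. U \<in> set V \<Longrightarrow> vec.subspace U" and "X \<in> flag_algebra V" "X ** Y = mat 1"
  shows "Y \<in> flag_algebra V"
proof -
  have YX: "Y ** X = mat 1" using assms(3) matrix_left_right_inverse by blast
  have inv: "invertible X" "invertible Y" using YX assms(3) invertible_def by blast+
  have "act X V = V" using act_eq_iff[OF V inv(1)] assms(2) by blast
  then have "act Y V = act Y (act X V)" by simp
  also have "\<dots> = V" by (simp add: act_act YX)
  finally show ?thesis using act_eq_iff[OF V inv(2)] by blast
qed

definition preimage_flags :: "('n::finite) flag \<Rightarrow> 'n flag set \<Rightarrow> (complex^'n^'n) set" where
  "preimage_flags V A = {g. invertible g \<and> act g V \<in> A}"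

lemma submanifold_at_tangent_cone:
  assumes "submanifold_at k A V"
  shows "V \<in> A" "subspace (tangent_cone (preimage_flags V A) (mat 1))"
    "dim (tangent_cone (preimage_flags V A) (mat 1)) = 2 * k + dim (flag_algebra V)"
    "\<And>Z. Z \<in> tangent_cone (preimage_flags V A) (mat 1)
      \<Longrightarrow> map_matrix ((*) \<i>) Z \<in> tangent_cone (preimage_flags V A) (mat 1)"
proof -
  obtain l where "V \<in> A" "2 * l = 2 * k + dim (flag_algebra V)"
    "matrix_submanifold_at l (preimage_flags V A) (mat 1)"
    using assms unfolding submanifold_at_def preimage_flags_def stab_real_dim_eq by blast
  note this(1,2) and T = matrix_submanifold_tangent_cone[OF this(3)]
  then show "V \<in> A" "dim (tangent_cone (preimage_flags V A) (mat 1)) = 2 * k + dim (flag_algebra V)"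
    by simp_all
  show "subspace (tangent_cone (preimage_flags V A) (mat 1))" by (rule T(1))
  show "map_matrix ((*) \<i>) Z \<in> tangent_cone (preimage_flags V A) (mat 1)"
    if "Z \<in> tangent_cone (preimage_flags V A) (mat 1)" for Z by (rule T(3)[OF that])
qed

lemma tangent_cone_iso_dim:
  fixes h :: "'a::euclidean_space \<Rightarrow> 'a"
  assumes h: "linear h" and h': "linear h'" and inv: "\<And>x. h' (h x) = x" "\<And>x. h (h' x) = x"
  shows "tangent_cone (h ` A) (h p) = h ` tangent_cone A p"
    and "dim (tangent_cone (h ` A) (h p)) = dim (tangent_cone A p)"
proof -
  have "h' ` tangent_cone (h ` A) (h p) \<subseteq> tangent_cone (h' ` h ` A) (h' (h p))"
    using h' by (intro tangent_cone_image_subset) (simp add: linear_conv_bounded_linear)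
  then have "h ` h' ` tangent_cone (h ` A) (h p) \<subseteq> h ` tangent_cone A p"
    by (intro image_mono) (simp add: image_image inv)
  then have "tangent_cone (h ` A) (h p) \<subseteq> h ` tangent_cone A p"
    by (simp add: image_image inv)
  moreover have "h ` tangent_cone A p \<subseteq> tangent_cone (h ` A) (h p)"
    using h by (intro tangent_cone_image_subset) (simp add: linear_conv_bounded_linear)
  ultimately show e: "tangent_cone (h ` A) (h p) = h ` tangent_cone A p"
    by blast
  have "inj h" using inv(1) by (metis injI)
  then show "dim (tangent_cone (h ` A) (h p)) = dim (tangent_cone A p)"
    unfolding e using h by (simp add: dim_image_eq inj_on_subset)
qed

lemma linear_conjugate: "linear (\<lambda>X. g ** X ** h)" for g h :: "complex^'n^'n"
  by (auto intro!: linearI simp: mmult.add_left mmult.add_right mmult.scaleR_left mmult.scaleR_right)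

text \<open>The factor \<open>mat 1\<close> gives the right translation the two-sided form treated
  in \<open>invertible_left_mult_linear\<close>.\<close>

lemma preimage_flags_act:
  assumes "invertible h"
  shows "preimage_flags (act h V) A = (\<lambda>g. mat 1 ** g ** matrix_inv h) ` preimage_flags V A"
proof (intro equalityI subsetI)
  fix g assume "g \<in> preimage_flags (act h V) A"
  then have "g ** h \<in> preimage_flags V A"
    using assms by (auto simp: preimage_flags_def act_act invertible_mult)
  moreover have "g = mat 1 ** (g ** h) ** matrix_inv h"
    using assms by (simp add: mult_matrix_inv_cancel)
  ultimately show "g \<in> (\<lambda>g. mat 1 ** g ** matrix_inv h) ` preimage_flags V A" by blast
next
  fix g assume "g \<in> (\<lambda>g. mat 1 ** g ** matrix_inv h) ` preimage_flags V A"
  then show "g \<in> preimage_flags (act h V) A"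
    using assms by (auto simp: preimage_flags_def act_act mult_matrix_inv_cancel
        intro!: invertible_mult matrix_inv_mult)
qed

lemma flag_algebra_act:
  assumes "invertible h"
  shows "flag_algebra (act h V) = (\<lambda>X. h ** X ** matrix_inv h) ` flag_algebra V"
proof -
  have sub: "h ** X ** matrix_inv h \<in> flag_algebra (act h V)"
    if "invertible h" "X \<in> flag_algebra V" for h X and V :: "'a flag"
    using that
    by (auto simp: flag_algebra_def act_def image_subset_iff mult_matrix_inv_cancel matrix_vector_mul_assoc)
      (auto simp flip: matrix_vector_mul_assoc)
  show ?thesis
  proof (intro equalityI subsetI)
    fix X assume "X \<in> flag_algebra (act h V)"
    from sub[OF matrix_inv_mult(3)[OF assms] this]
    have "matrix_inv h ** X ** matrix_inv (matrix_inv h) \<in> flag_algebra V"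
      using assms by (simp add: act_inv)
    moreover have "h ** (matrix_inv h ** X ** matrix_inv (matrix_inv h)) ** matrix_inv h
        = h ** (matrix_inv h ** (X ** matrix_inv (matrix_inv h) ** matrix_inv h))"
      by (simp only: matrix_mul_assoc)
    then have "X = h ** (matrix_inv h ** X ** matrix_inv (matrix_inv h)) ** matrix_inv h"
      using assms matrix_inv_mult(3)[OF assms] by (simp add: mult_matrix_inv_cancel)
    ultimately show "X \<in> (\<lambda>X. h ** X ** matrix_inv h) ` flag_algebra V" by blast
  qed (use sub assms in blast)
qed

lemma dim_conjugate:
  fixes S :: "(complex^'n^'n) set" and h :: "complex^'n^'n"
  assumes "invertible h"
  shows "dim ((\<lambda>X. h ** X ** matrix_inv h) ` S) = dim S"
proof -
  have "matrix_inv h ** (h ** X ** matrix_inv h) ** h = X" for X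
  proof -
    have "matrix_inv h ** (h ** X ** matrix_inv h) ** h = matrix_inv h ** (h ** (X ** matrix_inv h ** h))"
      by (simp only: matrix_mul_assoc)
    then show ?thesis using assms by (simp add: mult_matrix_inv_cancel)
  qed
  then have inj: "inj (\<lambda>X. h ** X ** matrix_inv h)"
    by (rule inj_on_inverseI[where g = "\<lambda>X. matrix_inv h ** X ** h"])
  show ?thesis by (rule dim_image_eq[OF linear_conjugate inj_on_subset[OF inj subset_UNIV]])
qed

lemma dim_flag_algebra_act:
  assumes "invertible h"
  shows "dim (flag_algebra (act h V)) = dim (flag_algebra V)"
  using assms by (simp add: flag_algebra_act dim_conjugate)

lemma invertible_left_mult_linear:
  fixes h g X :: "complex^'n^'n"
  assumes "invertible h" "invertible g"
  shows "linear (\<lambda>X. h ** X ** g)" "linear (\<lambda>X. matrix_inv h ** X ** matrix_inv g)"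
    "matrix_inv h ** (h ** X ** g) ** matrix_inv g = X"
    "h ** (matrix_inv h ** X ** matrix_inv g) ** g = X"
proof -
  have "matrix_inv h ** (h ** X ** g) ** matrix_inv g = matrix_inv h ** (h ** (X ** g ** matrix_inv g))"
    by (simp only: matrix_mul_assoc)
  then show "matrix_inv h ** (h ** X ** g) ** matrix_inv g = X"
    using assms by (simp add: mult_matrix_inv_cancel)
  have "h ** (matrix_inv h ** X ** matrix_inv g) ** g = h ** (matrix_inv h ** (X ** matrix_inv g ** g))"
    by (simp only: matrix_mul_assoc)
  then show "h ** (matrix_inv h ** X ** matrix_inv g) ** g = X"
    using assms by (simp add: mult_matrix_inv_cancel)
qed (rule linear_conjugate)+

text \<open>Replacing the base flag \<open>V\<close> by its translate is a right translation of the
  preimage, and it moves the point \<open>h\<close> to the identity.\<close>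

lemma dim_tangent_cone_preimage_act:
  fixes V :: "('n::finite) flag"
  assumes h: "invertible h"
  shows "dim (tangent_cone (preimage_flags (act h V) A) (mat 1))
    = dim (tangent_cone (preimage_flags V A) h)"
proof -
  note inv = matrix_inv_mult[OF h]
  have 1: "invertible (mat 1 :: complex^'n^'n)" by (simp add: invertible_det_nz)
  have "dim (tangent_cone ((\<lambda>g. mat 1 ** g ** matrix_inv h) ` preimage_flags V A)
      (mat 1 ** h ** matrix_inv h)) = dim (tangent_cone (preimage_flags V A) h)"
    by (rule tangent_cone_iso_dim(2)[OF invertible_left_mult_linear[OF 1 inv(3)]])
  then show ?thesis unfolding preimage_flags_act[OF h] using inv by simp
qed

lemma preimage_flags_left_mult:
  assumes h: "invertible h" and A: "act h ` A = A"
  shows "(\<lambda>g. h ** g ** mat 1) ` preimage_flags V A = preimage_flags V A"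
proof -
  have 1: "h ** g \<in> preimage_flags V A" if "g \<in> preimage_flags V A" for g
    using that h A by (auto simp: preimage_flags_def invertible_mult simp flip: act_act)
  have 2: "matrix_inv h ** g \<in> preimage_flags V A" if "g \<in> preimage_flags V A" for g
  proof -
    have "act g V \<in> act h ` A" using that A by (simp add: preimage_flags_def)
    then obtain W where "W \<in> A" "act g V = act h W" by blast
    then have "act (matrix_inv h) (act g V) \<in> A" by (simp add: act_inv(1)[OF h])
    then show ?thesis using that matrix_inv_mult(3)[OF h]
      by (auto simp: preimage_flags_def invertible_mult act_act)
  qed
  show ?thesis
  proof (intro equalityI subsetI)
    fix g assume "g \<in> preimage_flags V A"
    then have "g = h ** (matrix_inv h ** g) ** mat 1" "matrix_inv h ** g \<in> preimage_flags V A"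
      using 2 h by (simp_all add: mult_matrix_inv_cancel)
    then show "g \<in> (\<lambda>g. h ** g ** mat 1) ` preimage_flags V A" by (rule image_eqI)
  qed (use 1 in auto)
qed

text \<open>Left translation by \<open>h\<close> preserves the preimage of an invariant set and
  moves the identity to \<open>h\<close>; right translation then brings \<open>h\<close> back to the
  identity.\<close>

lemma dim_tangent_cone_preimage_invariant:
  fixes V :: "('n::finite) flag"
  assumes h: "invertible h" and A: "act h ` A = A"
  shows "dim (tangent_cone (preimage_flags (act h V) A) (mat 1))
    = dim (tangent_cone (preimage_flags V A) (mat 1))"
proof -
  have 1: "invertible (mat 1 :: complex^'n^'n)" by (simp add: invertible_det_nz)
  have "dim (tangent_cone ((\<lambda>g. h ** g ** mat 1) ` preimage_flags V A) (h ** mat 1 ** mat 1))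
      = dim (tangent_cone (preimage_flags V A) (mat 1))"
    by (rule tangent_cone_iso_dim(2)[OF invertible_left_mult_linear[OF h 1]])
  then show ?thesis
    unfolding preimage_flags_left_mult[OF h A] dim_tangent_cone_preimage_act[OF h] by simp
qed

text \<open>A chart of the preimage at the identity is also a chart at any nearby point of it, and the
  right translation by such a point identifies preimages.\<close>

lemma submanifold_at_nearby:
  fixes V :: "('n::finite) flag"
  assumes "submanifold_at k A V" "mat 1 \<in> closure (preimage_flags V B)" "B \<subseteq> A"
  obtains h where "invertible h" "act h V \<in> B"
    "dim (tangent_cone (preimage_flags (act h V) A) (mat 1)) = 2 * k + dim (flag_algebra (act h V))"
proof -
  obtain l where l: "2 * l = 2 * k + dim (flag_algebra V)"
    "matrix_submanifold_at l (preimage_flags V A) (mat 1)"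
    using assms unfolding submanifold_at_def preimage_flags_def stab_real_dim_eq by blast
  from l(2) obtain U W \<phi> \<psi> L where *: "open U" "mat 1 \<in> U" "open W" "homeomorphism U W \<phi> \<psi>"
     "complex_differentiable_on \<phi> U" "complex_differentiable_on \<psi> W"
     "subspace L" "map_matrix ((*) \<i>) ` L \<subseteq> L" "dim L = 2 * l"
     "\<phi> ` (U \<inter> preimage_flags V A) = W \<inter> L"
    unfolding matrix_submanifold_at_def by blast
  obtain h where h: "h \<in> U" "h \<in> preimage_flags V B"
    using assms(2) *(1,2) by (meson closure_iff_nhds_not_empty disjoint_iff order_refl)
  have "h \<in> preimage_flags V A" using h(2) assms(3) by (auto simp: preimage_flags_def)
  then have "matrix_submanifold_at l (preimage_flags V A) h"
    unfolding matrix_submanifold_at_def using * h(1) by blast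
  then have "dim (tangent_cone (preimage_flags V A) h) = 2 * l"
    by (rule matrix_submanifold_tangent_cone(2))
  moreover have "invertible h" "act h V \<in> B" using h(2) by (auto simp: preimage_flags_def)
  ultimately show ?thesis
    using that l(1) by (simp add: dim_tangent_cone_preimage_act dim_flag_algebra_act)
qed

section \<open>The topology of flag manifolds\<close>

lemma open_invertible: "open {g :: complex^'n^'n. invertible g}"
proof -
  have "continuous_on UNIV (det :: complex^'n^'n \<Rightarrow> complex)"
    unfolding det_def by (intro continuous_intros)
  then have "open (det -` (- {0 :: complex}) :: (complex^'n^'n) set)"
    by (intro open_vimage) auto
  moreover have "det -` (- {0 :: complex}) = {g :: complex^'n^'n. invertible g}"
    by (auto simp: invertible_det_nz)
  ultimately show ?thesis by simp
qed

lemma topspace_flag_topology [simp]: "topspace (flag_topology c) = flag_manifold c"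
proof
  show "topspace (flag_topology c) \<subseteq> flag_manifold c"
    by (auto simp: topspace_def openin_flag_topology)
  have "openin (flag_topology c) (flag_manifold c)"
    unfolding openin_flag_topology
  proof (intro conjI ballI)
    fix V :: "'b flag" assume "V \<in> flag_manifold c"
    then have "{g. invertible g \<and> act g V \<in> flag_manifold c} = {g. invertible g}"
      using act_flag_manifold by blast
    then show "open {g. invertible g \<and> act g V \<in> flag_manifold c}" using open_invertible by simp
  qed simp
  then show "flag_manifold c \<subseteq> topspace (flag_topology c)" by (rule openin_subset)
qed

lemma open_right_translate:
  fixes h :: "complex^'n^'n"
  assumes "open S"
  shows "open {g :: complex^'n^'n. g ** h \<in> S}"
proof -
  have "continuous_on UNIV (\<lambda>g :: complex^'n^'n. g ** h)" by (intro mmult.continuous_on continuous_intros)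
  then have "open ((\<lambda>g. g ** h) -` S)" using assms by (simp add: open_vimage)
  then show ?thesis by (simp add: vimage_def)
qed

text \<open>The orbit map of \<open>V\<close> is continuous and open, so closures in the quotient
  topology can be computed among matrices.\<close>

lemma closure_of_flag_topology:
  assumes V: "V \<in> flag_manifold c" and X: "X \<subseteq> flag_manifold c" and g: "invertible g"
  shows "act g V \<in> flag_topology c closure_of X \<longleftrightarrow> g \<in> closure (preimage_flags V X)"
proof
  assume a: "act g V \<in> flag_topology c closure_of X"
  show "g \<in> closure (preimage_flags V X)"
  proof (rule ccontr)
    assume n: "g \<notin> closure (preimage_flags V X)"
    define S where "S = {g. invertible g} - closure (preimage_flags V X)"
    have S: "open S" "g \<in> S" unfolding S_def using n g open_invertible by auto
    define W where "W = (\<lambda>h. act h V) ` S"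
    have "openin (flag_topology c) W" unfolding openin_flag_topology
    proof (intro conjI ballI)
      show "W \<subseteq> flag_manifold c" using V act_flag_manifold by (auto simp: W_def S_def)
      fix V' :: "'a flag" assume V': "V' \<in> flag_manifold c"
      \<comment> \<open>Openness of the orbit map: the preimage over any base flag \<open>V'\<close>
        is a union of right translates of \<open>S\<close>, one for each \<open>c\<close> taking
        \<open>V\<close> to \<open>V'\<close>.\<close>
      have "{g. invertible g \<and> act g V' \<in> W} = (\<Union>c\<in>{c. invertible c \<and> V' = act c V}. {g. g ** c \<in> S})"
      proof (intro equalityI subsetI)
        fix g' assume "g' \<in> {g. invertible g \<and> act g V' \<in> W}"
        then obtain h where h: "invertible g'" "h \<in> S" "act g' V' = act h V" by (auto simp: W_def)
        then have "V' = act (matrix_inv g' ** h) V" by (metis act_act act_inv(1))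
        moreover have "g' ** (matrix_inv g' ** h) = h" using h(1) by (simp add: mult_matrix_inv_cancel)
        moreover have "invertible (matrix_inv g' ** h)"
          using h by (auto simp: S_def intro: invertible_mult matrix_inv_mult)
        ultimately show "g' \<in> (\<Union>c\<in>{c. invertible c \<and> V' = act c V}. {g. g ** c \<in> S})"
          using h(2) by auto
      next
        fix g' assume "g' \<in> (\<Union>c\<in>{c. invertible c \<and> V' = act c V}. {g. g ** c \<in> S})"
        then obtain c where c: "invertible c" "V' = act c V" "g' ** c \<in> S" by blast
        then have "invertible (g' ** c ** matrix_inv c)"
          by (auto simp: S_def intro: invertible_mult matrix_inv_mult)
        then show "g' \<in> {g. invertible g \<and> act g V' \<in> W}"
          using c by (auto simp: mult_matrix_inv_cancel W_def act_act)
      qed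
      then show "open {g. invertible g \<and> act g V' \<in> W}"
        using open_right_translate[OF S(1)] by (simp only:) (intro open_UN ballI)
    qed
    moreover have "act g V \<in> W" using S(2) by (auto simp: W_def)
    ultimately obtain h where "h \<in> S" "act h V \<in> X" using a by (auto simp: in_closure_of W_def)
    then have "h \<in> preimage_flags V X" by (auto simp: S_def preimage_flags_def)
    then show False using \<open>h \<in> S\<close> closure_subset unfolding S_def by blast
  qed
next
  assume a: "g \<in> closure (preimage_flags V X)"
  show "act g V \<in> flag_topology c closure_of X"
    unfolding in_closure_of
  proof (intro conjI allI impI)
    show "act g V \<in> topspace (flag_topology c)" using V g by (simp add: act_flag_manifold)
    fix W assume W: "act g V \<in> W \<and> openin (flag_topology c) W"
    then have "open (preimage_flags V W)" "g \<in> preimage_flags V W"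
      using V g by (auto simp: openin_flag_topology preimage_flags_def)
    then obtain h where "h \<in> preimage_flags V W" "h \<in> preimage_flags V X"
      using a by (meson closure_iff_nhds_not_empty disjoint_iff order_refl)
    then show "\<exists>W'. W' \<in> X \<and> W' \<in> W" by (auto simp: preimage_flags_def)
  qed
qed

lemma preimage_flags_closure_of:
  assumes "V \<in> flag_manifold c" "X \<subseteq> flag_manifold c"
  shows "preimage_flags V (flag_topology c closure_of X)
    = {g. invertible g} \<inter> closure (preimage_flags V X)"
  using closure_of_flag_topology[OF assms] by (auto simp: preimage_flags_def)

section \<open>Unitary frames of flags\<close>

definition psum :: "nat list \<Rightarrow> nat \<Rightarrow> nat" where "psum c i = sum_list (take i c)"

lemma psum_0 [simp]: "psum c 0 = 0" by (simp add: psum_def)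

lemma psum_Suc: "i < length c \<Longrightarrow> psum c (Suc i) = psum c i + c ! i"
  by (simp add: psum_def take_Suc_conv_app_nth)

lemma psum_length: "psum c (length c) = sum_list c" by (simp add: psum_def)

lemma psum_Cons_Suc: "psum (k # c) (Suc i) = k + psum c i" by (simp add: psum_def)

lemma psum_add: "psum c (i + k) = psum c i + sum_list (take k (drop i c))"
  by (simp add: psum_def take_add)

lemma psum_mono: "i \<le> j \<Longrightarrow> psum c i \<le> psum c j"
  using psum_add[of c i "j - i"] by simp

lemma psum_le: "psum c i \<le> sum_list c"
  using psum_mono[of i "max i (length c)" c] by (simp add: psum_def)

lemma psum_strict_mono:
  assumes "composition c n" "i < j" "j \<le> length c"
  shows "psum c i < psum c j"
proof -
  have "psum c (Suc i) \<le> psum c j" using assms by (intro psum_mono) simp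
  moreover have "c ! i > 0" using assms by (auto simp: composition_def)
  ultimately show ?thesis using assms psum_Suc[of i c] by simp
qed

lemma flag_manifold_iff:
  "V \<in> flag_manifold c \<longleftrightarrow> length V = length c \<and>
    (\<forall>i<length c. vec.subspace (V ! i) \<and> vec.dim (V ! i) = psum c (Suc i)) \<and>
    (\<forall>i j. i \<le> j \<longrightarrow> j < length c \<longrightarrow> V ! i \<subseteq> V ! j)" (is "?L \<longleftrightarrow> ?R")
proof
  assume L: ?L
  have "V ! i \<subseteq> V ! j" if "i \<le> j" "j < length c" for i j
    using that
  proof (induction j rule: dec_induct)
    case (step k)
    then show ?case using L by (auto simp: flag_manifold_def)
  qed simp
  then show ?R using L by (auto simp: flag_manifold_def psum_def)
next
  assume ?R
  then show ?L by (auto simp: flag_manifold_def psum_def)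
qed

section \<open>The Hermitian form and orthonormal bases adapted to a flag\<close>

definition herm :: "complex^'n \<Rightarrow> complex^'n \<Rightarrow> complex" where
  "herm x y = (\<Sum>i\<in>UNIV. x $ i * cnj (y $ i))"

lemma herm_add_left: "herm (x + y) z = herm x z + herm y z"
  by (simp add: herm_def distrib_right sum.distrib)

lemma herm_diff_left: "herm (x - y) z = herm x z - herm y z"
  by (simp add: herm_def left_diff_distrib sum_subtractf)

lemma herm_smult_left: "herm (c *s x) z = c * herm x z"
  by (simp add: herm_def sum_distrib_left mult.assoc)

lemma herm_sum_left: "herm (\<Sum>a\<in>A. f a) z = (\<Sum>a\<in>A. herm (f a) z)"
proof (cases "finite A")
  case True
  then show ?thesis by (induction A) (simp_all add: herm_add_left, simp add: herm_def)
qed (simp add: herm_def)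

lemma herm_commute: "herm y x = cnj (herm x y)"
  by (simp add: herm_def mult.commute)

lemma herm_self: "herm x x = of_real ((norm x)\<^sup>2)"
proof -
  have "herm x x = (\<Sum>i\<in>UNIV. of_real ((cmod (x $ i))\<^sup>2))"
    unfolding herm_def by (intro sum.cong refl) (simp add: complex_norm_square del: of_real_power)
  also have "\<dots> = of_real ((norm x)\<^sup>2)"
    by (simp add: norm_vec_def L2_set_def sum_nonneg)
  finally show ?thesis .
qed

definition orthonormal :: "(complex^'n) set \<Rightarrow> bool" where
  "orthonormal B \<longleftrightarrow> finite B \<and> (\<forall>x\<in>B. \<forall>y\<in>B. herm x y = (if x = y then 1 else 0))"

lemma orthonormal_independent:
  assumes "orthonormal B"
  shows "vec.independent B"
proof -
  have fin: "finite B" using assms by (simp add: orthonormal_def)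
  have "u v = 0" if u: "(\<Sum>v\<in>B. u v *s v) = 0" and v: "v \<in> B" for u v
  proof -
    have "0 = herm (\<Sum>w\<in>B. u w *s w) v" unfolding u by (simp add: herm_def)
    also have "\<dots> = (\<Sum>w\<in>B. u w * herm w v)" by (simp add: herm_sum_left herm_smult_left)
    also have "\<dots> = (\<Sum>w\<in>B. if w = v then u w else 0)"
      using assms v by (intro sum.cong) (auto simp: orthonormal_def)
    also have "\<dots> = u v" using fin v by (simp add: sum.delta)
    finally show ?thesis by simp
  qed
  then show ?thesis using vec.dependent_finite[OF fin] by blast
qed

text \<open>One Gram-Schmidt step adds a unit vector of \<open>U\<close> orthogonal to
  \<open>B\<close> and lowers \<open>vec.dim U - card B\<close>.\<close>

lemma orthonormal_extend:
  assumes U: "vec.subspace U" and B: "orthonormal B" "B \<subseteq> U"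
  shows "\<exists>B'. orthonormal B' \<and> B \<subseteq> B' \<and> vec.span B' = U"
  using B
proof (induction "vec.dim U - card B" arbitrary: B rule: less_induct)
  case less
  have fin: "finite B" using less.prems by (simp add: orthonormal_def)
  have sub: "vec.span B \<subseteq> U" using less.prems U by (simp add: vec.span_minimal)
  show ?case
  proof (cases "vec.span B = U")
    case True
    then show ?thesis using less.prems by blast
  next
    case False
    then obtain x where x: "x \<in> U" "x \<notin> vec.span B" using sub by blast
    define p where "p = (\<Sum>b\<in>B. herm x b *s b)"
    define y where "y = x - p"
    have p: "p \<in> vec.span B" unfolding p_def
      by (intro vec.span_sum vec.span_scale vec.span_base)
    have y0: "y \<noteq> 0" 
    proof
      assume "y = 0"
      then have "x = p" by (simp add: y_def)
      then show False using x(2) p by simp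
    qed
    have yU: "y \<in> U" unfolding y_def using x(1) p sub U
      by (intro vec.subspace_diff) auto
    have yb: "herm y b = 0" if b: "b \<in> B" for b
    proof -
      have "herm p b = (\<Sum>a\<in>B. herm x a * herm a b)"
        by (simp add: p_def herm_sum_left herm_smult_left)
      also have "\<dots> = (\<Sum>a\<in>B. if a = b then herm x a else 0)"
        using less.prems b by (intro sum.cong) (auto simp: orthonormal_def)
      also have "\<dots> = herm x b" using fin b by (simp add: sum.delta)
      finally show ?thesis by (simp add: y_def herm_diff_left)
    qed
    define z where "z = of_real (1 / norm y) *s y"
    have z: "herm z z = 1"
    proof -
      have "norm z = 1" using y0 unfolding z_def scaleR_eq_smult[symmetric] by simp
      then show ?thesis by (simp add: herm_self)
    qed
    have zb: "herm z b = 0" "herm b z = 0" if "b \<in> B" for b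
      using yb[OF that] herm_commute[of z b] by (simp_all add: z_def herm_smult_left)
    have zB: "z \<notin> B" using zb z by (metis zero_neq_one)
    have on: "orthonormal (insert z B)"
      using less.prems z zb zB unfolding orthonormal_def by auto
    have zU: "insert z B \<subseteq> U" using less.prems yU U by (auto simp: z_def vec.subspace_scale)
    have "card (insert z B) \<le> vec.dim U"
      using vec.independent_card_le_dim[OF zU orthonormal_independent[OF on]] .
    then have "vec.dim U - card (insert z B) < vec.dim U - card B" using fin zB by simp
    from less.hyps[OF this on zU] show ?thesis by blast
  qed
qed

text \<open>An orthonormal basis of each member is extended to one of the next. The enumeration is
  kept on the positions already filled, so earlier members remain spans of initial segments.\<close>

lemma flag_frame_partial:
  assumes V: "V \<in> flag_manifold c" and k: "k \<le> length c"
  shows "\<exists>f. inj_on f {..<psum c k} \<and> orthonormal (f ` {..<psum c k}) \<and>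
    (\<forall>i<k. V ! i = vec.span (f ` {..<psum c (Suc i)}))"
  using k
proof (induction k)
  case 0
  then show ?case by (simp add: orthonormal_def)
next
  case (Suc k)
  then obtain f where f: "inj_on f {..<psum c k}" "orthonormal (f ` {..<psum c k})"
    "\<And>i. i < k \<Longrightarrow> V ! i = vec.span (f ` {..<psum c (Suc i)})" by auto
  let ?B = "f ` {..<psum c k}"
  have BV: "?B \<subseteq> V ! k"
  proof (cases k)
    case (Suc i)
    then have "V ! i = vec.span ?B" using f(3) by simp
    then have "?B \<subseteq> V ! i" by (simp add: vec.span_superset)
    also have "\<dots> \<subseteq> V ! k" using V \<open>Suc k \<le> length c\<close> Suc by (auto simp: flag_manifold_iff)
    finally show ?thesis .
  qed simp
  have Vk: "vec.subspace (V ! k)" "vec.dim (V ! k) = psum c (Suc k)"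
    using V Suc.prems by (auto simp: flag_manifold_iff)
  obtain B' where B': "orthonormal B'" "?B \<subseteq> B'" "vec.span B' = V ! k"
    using orthonormal_extend[OF Vk(1) f(2) BV] by blast
  have fin: "finite B'" using B'(1) by (simp add: orthonormal_def)
  have "card B' = psum c (Suc k)"
    using vec.dim_span_eq_card_independent[OF orthonormal_independent[OF B'(1)]] B'(3) Vk(2) by simp
  moreover have "card ?B = psum c k" using f(1) by (simp add: card_image)
  ultimately have "card (B' - ?B) = card {psum c k..<psum c (Suc k)}"
    using B'(2) by (simp add: card_Diff_subset)
  then obtain h where h: "bij_betw h {psum c k..<psum c (Suc k)} (B' - ?B)"
    using fin by (metis finite_Diff finite_atLeastLessThan finite_same_card_bij)
  define g where "g j = (if j < psum c k then f j else h j)" for j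
  have le: "psum c k \<le> psum c (Suc k)" by (simp add: psum_mono)
  have gf: "g ` {..<N} = f ` {..<N}" if "N \<le> psum c k" for N
    using that by (intro image_cong) (auto simp: g_def)
  have gh: "g ` {psum c k..<psum c (Suc k)} = B' - ?B"
    using h by (auto simp: g_def bij_betw_def)
  have split: "{..<psum c (Suc k)} = {..<psum c k} \<union> {psum c k..<psum c (Suc k)}" using le by auto
  have im: "g ` {..<psum c (Suc k)} = B'"
    unfolding split image_Un gh gf[OF order_refl] using B'(2) by blast
  have "inj_on g {..<psum c (Suc k)}"
    by (rule eq_card_imp_inj_on) (simp_all add: im \<open>card B' = psum c (Suc k)\<close>)
  moreover have "V ! i = vec.span (g ` {..<psum c (Suc i)})" if "i < Suc k" for i
  proof (cases "i = k")
    case False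
    then have "i < k" using that by simp
    then show ?thesis using f(3) gf[of "psum c (Suc i)"] psum_mono[of "Suc i" k c] by simp
  qed (simp add: im B'(3))
  ultimately show ?case using im B'(1) by (intro exI[of _ g]) simp
qed

section \<open>Unitary matrices and coordinate flags\<close>

definition cadj :: "complex^'n^'n \<Rightarrow> complex^'n^'n" where
  "cadj X = map_matrix cnj (transpose X)"

definition unitary :: "(complex^'n^'n::finite) set" where
  "unitary = {u. u ** cadj u = mat 1}"

lemma cadj_nth [simp]: "cadj X $ a $ b = cnj (X $ b $ a)"
  by (simp add: cadj_def transpose_def)

lemma unitary_invertible: "u \<in> unitary \<Longrightarrow> invertible u"
  unfolding unitary_def invertible_def using matrix_left_right_inverse by blast

definition coord :: "'n set \<Rightarrow> (complex^'n) set" where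
  "coord S = {v. \<forall>a. a \<notin> S \<longrightarrow> v $ a = 0}"

lemma subspace_coord: "vec.subspace (coord S)"
  by (auto simp: vec.subspace_def coord_def)

lemma dim_coord: "vec.dim (coord S) = card S" for S :: "'n::finite set"
  unfolding coord_def by (rule dim_substandard_cart)

lemma span_axis: "vec.span ((\<lambda>a. axis a 1) ` S) = coord S" for S :: "'n::finite set"
proof
  show "vec.span ((\<lambda>a. axis a 1) ` S) \<subseteq> coord S"
    by (rule vec.span_minimal[OF _ subspace_coord]) (auto simp: coord_def axis_def)
  show "coord S \<subseteq> vec.span ((\<lambda>a. axis a 1) ` S)"
  proof
    fix v assume v: "v \<in> coord S"
    have "v = (\<Sum>a\<in>UNIV. v $ a *s axis a 1)" by (simp add: basis_expansion)
    also have "\<dots> \<in> vec.span ((\<lambda>a. axis a 1) ` S)"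
    proof (rule vec.span_sum)
      fix a
      show "v $ a *s axis a 1 \<in> vec.span ((\<lambda>a. axis a 1) ` S)"
      proof (cases "a \<in> S")
        case True
        then show ?thesis by (intro vec.span_scale vec.span_base) blast
      qed (use v in \<open>simp add: coord_def vec.span_zero\<close>)
    qed
    finally show "v \<in> vec.span ((\<lambda>a. axis a 1) ` S)" .
  qed
qed

lemma coord_subset_iff: "coord S \<subseteq> coord T \<longleftrightarrow> S \<subseteq> T"
proof
  assume a: "coord S \<subseteq> coord T"
  show "S \<subseteq> T"
  proof
    fix x assume "x \<in> S"
    then have "axis x 1 \<in> coord S" by (auto simp: coord_def axis_def)
    then have "axis x 1 \<in> coord T" using a by blast
    then show "x \<in> T" by (auto simp: coord_def axis_def split: if_splits)
  qed
qed (auto simp: coord_def)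

text \<open>The coordinate flag whose \<open>i\<close>-th subspace is spanned by the basis vectors occupying the
  first \<open>psum c i\<close> of the positions \<open>p\<close>, which count from \<open>0\<close>.\<close>

definition coord_flag :: "nat list \<Rightarrow> ('n \<Rightarrow> nat) \<Rightarrow> 'n::finite flag" where
  "coord_flag c p = map (\<lambda>i. coord {a. p a < psum c (Suc i)}) [0..<length c]"

lemma length_coord_flag [simp]: "length (coord_flag c p) = length c"
  by (simp add: coord_flag_def)

lemma nth_coord_flag: "i < length c \<Longrightarrow> coord_flag c p ! i = coord {a. p a < psum c (Suc i)}"
  by (simp add: coord_flag_def)

lemma card_position:
  assumes "bij_betw p (UNIV :: 'n::finite set) {..<CARD('n)}" "N \<le> CARD('n)"
  shows "card {a. p a < N} = N"
proof -
  have "p ` {a. p a < N} = {..<N}"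
  proof
    show "{..<N} \<subseteq> p ` {a. p a < N}"
    proof
      fix x assume x: "x \<in> {..<N}"
      then have "x \<in> range p" using assms by (auto simp: bij_betw_def)
      then show "x \<in> p ` {a. p a < N}" using x by auto
    qed
  qed auto
  moreover have "inj_on p {a. p a < N}" using assms(1) by (auto simp: bij_betw_def inj_on_def)
  ultimately show ?thesis by (metis card_image card_lessThan)
qed

lemma coord_flag_manifold:
  assumes "bij_betw p (UNIV :: 'n::finite set) {..<CARD('n)}" "composition c CARD('n)"
  shows "coord_flag c p \<in> (flag_manifold c :: 'n flag set)"
proof -
  have "vec.dim (coord {a. p a < psum c i}) = psum c i" for i
    unfolding dim_coord using assms psum_le[of c i]
    by (intro card_position) (auto simp: composition_def)
  moreover have "coord {a. p a < psum c (Suc i)} \<subseteq> coord {a. p a < psum c (Suc j)}" if "i \<le> j" for i j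
    unfolding coord_subset_iff using psum_mono[of "Suc i" "Suc j" c] that by auto
  ultimately show ?thesis by (auto simp: flag_manifold_iff nth_coord_flag subspace_coord)
qed

text \<open>An adapted orthonormal frame becomes the columns of a unitary matrix. This makes the
  flag manifold an orbit of a compact group, the source of all convergent subsequences of
  flags.\<close>

lemma flag_unitary:
  fixes V :: "('n::finite) flag"
  assumes p: "bij_betw p (UNIV :: 'n set) {..<CARD('n)}" and c: "composition c CARD('n)"
    and V: "V \<in> flag_manifold c"
  obtains u where "u \<in> unitary" "act u (coord_flag c p) = V"
proof -
  obtain f where f: "inj_on f {..<CARD('n)}" "orthonormal (f ` {..<CARD('n)})"
    "\<And>i. i < length c \<Longrightarrow> V ! i = vec.span (f ` {..<psum c (Suc i)})"
    using flag_frame_partial[OF V order_refl] c by (auto simp: psum_length composition_def)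
  \<comment> \<open>Column \<open>b\<close> is the frame vector whose place in the frame is the
    position of \<open>b\<close>.\<close>
  define u :: "complex^'n^'n" where "u = (\<chi> a b. f (p b) $ a)"
  have pb: "p b \<in> {..<CARD('n)}" for b using p by (auto simp: bij_betw_def)
  have pinj: "p a = p b \<longleftrightarrow> a = b" for a b using p by (auto simp: bij_betw_def inj_def)
  have "cadj u ** u = mat 1"
  proof -
    have "(cadj u ** u) $ a $ b = mat 1 $ a $ b" for a b
    proof -
      have "(cadj u ** u) $ a $ b = herm (f (p b)) (f (p a))"
        by (simp add: matrix_matrix_mult_def u_def herm_def mult.commute)
      also have "\<dots> = (if f (p b) = f (p a) then 1 else 0)"
        using f(2) pb unfolding orthonormal_def by blast
      also have "\<dots> = mat 1 $ a $ b"
        using inj_on_eq_iff[OF f(1) pb pb] pinj by (auto simp: mat_def)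
      finally show ?thesis .
    qed
    then show ?thesis by (simp add: vec_eq_iff)
  qed
  then have u: "u \<in> unitary" unfolding unitary_def using matrix_left_right_inverse by blast
  have ua: "u *v axis a 1 = f (p a)" for a
    by (simp add: vec_eq_iff matrix_vector_mult_def u_def axis_def if_distrib[of "(*) _"] cong: if_cong)
  have im: "(*v) u ` coord {a. p a < N} = vec.span (f ` {..<N})" if "N \<le> CARD('n)" for N
  proof -
    have "p ` {a. p a < N} = {..<N}"
    proof
      show "{..<N} \<subseteq> p ` {a. p a < N}"
      proof
        fix x assume x: "x \<in> {..<N}"
        then have "x \<in> range p" using p that by (auto simp: bij_betw_def)
        then show "x \<in> p ` {a. p a < N}" using x by auto
      qed
    qed auto
    then have "f ` {..<N} = f ` p ` {a. p a < N}" by simp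
    also have "\<dots> = (\<lambda>a. u *v axis a 1) ` {a. p a < N}" by (simp add: image_image ua)
    finally show ?thesis
      unfolding span_axis[symmetric]
        vec.linear_span_image[OF matrix_vector_mul_linear_gen, symmetric]
      by (simp add: image_image)
  qed
  have "act u (coord_flag c p) = V"
  proof (rule nth_equalityI)
    show "length (act u (coord_flag c p)) = length V" using V by (simp add: flag_manifold_def)
    fix i assume "i < length (act u (coord_flag c p))"
    then have i: "i < length c" by simp
    have "psum c (Suc i) \<le> CARD('n)" using psum_le[of c "Suc i"] c by (simp add: composition_def)
    then show "act u (coord_flag c p) ! i = V ! i" using i f(3) im by (simp add: nth_coord_flag)
  qed
  then show ?thesis using that u by blast
qed

lemma cadj_mult: "cadj (X ** Y) = cadj Y ** cadj X"
  by (simp add: vec_eq_iff matrix_matrix_mult_def mult.commute)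

lemma cadj_cadj [simp]: "cadj (cadj X) = X" by (simp add: vec_eq_iff)

lemma unitary_mult:
  assumes "u \<in> unitary" "v \<in> unitary"
  shows "u ** v \<in> unitary"
proof -
  have "u ** v ** cadj (u ** v) = u ** (v ** cadj v) ** cadj u"
    by (simp only: cadj_mult matrix_mul_assoc)
  then show ?thesis using assms by (simp add: unitary_def)
qed

lemma unitary_cadj:
  assumes "u \<in> unitary"
  shows "cadj u \<in> unitary" "cadj u ** u = mat 1"
  using assms matrix_left_right_inverse unfolding unitary_def by (auto simp: matrix_left_right_inverse)

lemma flag_manifold_unitary_transitive:
  fixes V W :: "('n::finite) flag"
  assumes "composition c CARD('n)" "V \<in> flag_manifold c" "W \<in> flag_manifold c"
  obtains u where "u \<in> unitary" "act u V = W"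
proof -
  obtain p where p: "bij_betw p (UNIV :: 'n set) {..<CARD('n)}"
    using finite_same_card_bij[of "UNIV :: 'n set" "{..<CARD('n)}"] by auto
  obtain u where u: "u \<in> unitary" "act u (coord_flag c p) = V"
    using flag_unitary[OF p assms(1,2)] .
  obtain v where v: "v \<in> unitary" "act v (coord_flag c p) = W"
    using flag_unitary[OF p assms(1,3)] .
  have "act (v ** cadj u) V = W"
    unfolding v(2)[symmetric] u(2)[symmetric] act_act
    using unitary_cadj(2)[OF u(1)] by (simp flip: matrix_mul_assoc)
  then show ?thesis using that unitary_mult[OF v(1) unitary_cadj(1)[OF u(1)]] by blast
qed

lemma continuous_on_cadj: "continuous_on S cadj"
  unfolding cadj_def map_matrix_def transpose_def
  by (intro continuous_intros)

lemma compact_unitary: "compact (unitary :: (complex^'n^'n::finite) set)"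
proof -
  have "continuous_on UNIV (\<lambda>u :: complex^'n^'n. u ** cadj u)"
    by (intro mmult.continuous_on continuous_intros continuous_on_cadj)
  then have "closed ((\<lambda>u :: complex^'n^'n. u ** cadj u) -` {mat 1})"
    by (simp add: closed_vimage)
  then have "closed (unitary :: (complex^'n^'n) set)" by (simp add: unitary_def vimage_def)
  moreover have "norm u \<le> real CARD('n)" if u: "u \<in> unitary" for u :: "complex^'n^'n"
  proof -
    have "norm (u $ a) = 1" for a
    proof -
      have "of_real ((norm (u $ a))\<^sup>2) = (u ** cadj u) $ a $ a"
        unfolding herm_self[symmetric] by (simp add: herm_def matrix_matrix_mult_def)
      also have "\<dots> = 1" using u by (simp add: unitary_def mat_def)
      finally have "(norm (u $ a))\<^sup>2 = 1" using of_real_eq_1_iff by blast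
      then show ?thesis by (simp add: power2_eq_1_iff) (metis norm_ge_zero neg_0_le_iff_le not_one_le_zero)
    qed
    then have "norm u = L2_set (\<lambda>a. 1) (UNIV :: 'n set)" by (simp add: norm_vec_def)
    also have "\<dots> \<le> (\<Sum>a\<in>(UNIV :: 'n set). 1)" by (rule L2_set_le_sum) simp
    finally show ?thesis by simp
  qed
  then have "bounded (unitary :: (complex^'n^'n) set)" unfolding bounded_iff by blast
  ultimately show ?thesis by (simp add: compact_eq_bounded_closed)
qed

section \<open>Projections of flag manifolds\<close>

lemma length_blocks [simp]: "length (blocks cs xs) = length cs"
  by (induction cs arbitrary: xs) auto

lemma blocks_nth: "j < length cs \<Longrightarrow> blocks cs xs ! j = take (cs ! j) (drop (psum cs j) xs)"
proof (induction cs arbitrary: xs j)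
  case (Cons k cs)
  then show ?case by (cases j) (simp_all add: psum_Cons_Suc add.commute)
qed simp

lemma grouping_length: "grouping t f d \<Longrightarrow> length f = length t"
  by (simp add: grouping_def)

lemma grouping_psum:
  assumes "grouping t f d" "j \<le> length t"
  shows "psum f j = psum d (psum t j)"
  using assms(2)
proof (induction j)
  case (Suc j)
  have "f ! j = sum_list (take (t ! j) (drop (psum t j) d))"
    using assms(1) Suc.prems by (simp add: grouping_def blocks_nth)
  then show ?case
    using Suc grouping_length[OF assms(1)] by (simp add: psum_Suc psum_add)
qed simp

lemma grouping_psum_pos:
  assumes "grouping t f d" "j < length t"
  shows "0 < psum t (Suc j)" "psum t (Suc j) \<le> length d"
  using assms psum_strict_mono[of t "length d" 0 "Suc j"] psum_le[of t "Suc j"]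
  by (auto simp: grouping_def composition_def)

lemma nth_flag_proj:
  assumes g: "grouping t f d" and V: "length V = length d" and j: "j < length t"
  shows "flag_proj t V ! j = V ! (psum t (Suc j) - 1)"
proof -
  have tj: "0 < t ! j" using g j by (simp add: grouping_def composition_def)
  have le: "psum t j + t ! j \<le> length d" using grouping_psum_pos(2)[OF g j] j by (simp add: psum_Suc)
  have "flag_proj t V ! j = last (take (t ! j) (drop (psum t j) V))"
    using j by (simp add: flag_proj_def blocks_nth)
  also have "\<dots> = V ! (psum t j + t ! j - 1)"
    using tj le V by (subst last_conv_nth) (auto simp: nth_append)
  finally show ?thesis using j by (simp add: psum_Suc)
qed

lemma length_flag_proj [simp]: "length (flag_proj t V) = length t"
  by (simp add: flag_proj_def)

lemma flag_proj_manifold: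
  assumes g: "grouping t f d" and V: "V \<in> flag_manifold d"
  shows "flag_proj t V \<in> flag_manifold f"
proof -
  have len: "length V = length d" using V by (simp add: flag_manifold_def)
  have "vec.subspace (flag_proj t V ! j) \<and> vec.dim (flag_proj t V ! j) = psum f (Suc j)"
    if "j < length t" for j
    using V nth_flag_proj[OF g len that] grouping_psum_pos[OF g that] grouping_psum[OF g, of "Suc j"] that
    unfolding flag_manifold_iff by (cases "psum t (Suc j)") auto
  moreover have "flag_proj t V ! i \<subseteq> flag_proj t V ! j" if "i \<le> j" "j < length t" for i j
    using V nth_flag_proj[OF g len] grouping_psum_pos[OF g that(2)] psum_mono[of "Suc i" "Suc j" t] that
    unfolding flag_manifold_iff by auto
  ultimately show ?thesis
    unfolding flag_manifold_iff using grouping_length[OF g] by auto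
qed

lemma flag_proj_act:
  assumes g: "grouping t f d" and V: "length V = length d"
  shows "flag_proj t (act h V) = act h (flag_proj t V)"
proof (rule nth_equalityI)
  fix j assume "j < length (flag_proj t (act h V))"
  then have j: "j < length t" by simp
  have "psum t (Suc j) - 1 < length V" using grouping_psum_pos[OF g j] V by simp
  then show "flag_proj t (act h V) ! j = act h (flag_proj t V) ! j"
    using j nth_flag_proj[OF g V j] nth_flag_proj[OF g _ j, of "act h V"] V by simp
qed simp

lemma flag_proj_coord_flag:
  assumes g: "grouping t f d"
  shows "flag_proj t (coord_flag d p) = coord_flag f p"
proof (rule nth_equalityI)
  show "length (flag_proj t (coord_flag d p)) = length (coord_flag f p)"
    using grouping_length[OF g] by simp
  fix j assume "j < length (flag_proj t (coord_flag d p))"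
  then have j: "j < length t" by simp
  have "psum t (Suc j) - 1 < length d" "Suc (psum t (Suc j) - 1) = psum t (Suc j)"
    using grouping_psum_pos[OF g j] by simp_all
  then show "flag_proj t (coord_flag d p) ! j = coord_flag f p ! j"
    using j nth_flag_proj[OF g _ j, of "coord_flag d p"] grouping_psum[OF g, of "Suc j"]
      grouping_length[OF g] by (simp add: nth_coord_flag)
qed

lemma grouping_composition:
  assumes g: "grouping t f d" and d: "composition d n"
  shows "composition f n"
proof -
  have "sum_list f = psum d (psum t (length t))"
    using grouping_psum[OF g order_refl] grouping_length[OF g] psum_length[of f] by simp
  also have "\<dots> = n" using g d by (simp add: psum_length grouping_def composition_def)
  finally have "sum_list f = n" .
  moreover have "0 < f ! j" if j: "j < length t" for j
  proof -
    have "t ! j > 0" using g j by (simp add: grouping_def composition_def)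
    then have "psum d (psum t j) < psum d (psum t (Suc j))"
      using grouping_psum_pos[OF g j] j by (intro psum_strict_mono[OF d]) (simp_all add: psum_Suc)
    then have "psum f j < psum f (Suc j)" using grouping_psum[OF g] j by simp
    then show ?thesis using j grouping_length[OF g] by (simp add: psum_Suc)
  qed
  ultimately show ?thesis using grouping_length[OF g] by (auto simp: composition_def in_set_conv_nth)
qed

text \<open>The projection is a closed map: flags tending to a limit can be moved to a fixed flag by
  elements of the compact unitary group.\<close>

lemma flag_proj_closure_of:
  fixes X :: "('n::finite) flag set"
  assumes g: "grouping t f d" and d: "composition d CARD('n)" and X: "X \<subseteq> flag_manifold d"
  shows "flag_proj t ` (flag_topology d closure_of X) = flag_topology f closure_of (flag_proj t ` X)"
proof (cases "flag_manifold d = ({} :: 'n flag set)")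
  case True
  then have "X = {}" using X by blast
  then show ?thesis by simp
next
  case False
  then obtain V :: "'n flag" where V: "V \<in> flag_manifold d" by blast
  have pV: "flag_proj t V \<in> flag_manifold f" by (rule flag_proj_manifold[OF g V])
  have pX: "flag_proj t ` X \<subseteq> flag_manifold f" using flag_proj_manifold[OF g] X by blast
  have len: "length V = length d" using V by (simp add: flag_manifold_def)
  note act = flag_proj_act[OF g len]
  have f: "composition f CARD('n)" by (rule grouping_composition[OF g d])
  have sub: "vec.subspace U" if "U \<in> set (flag_proj t V)" for U
    using flag_manifold_subspace[OF pV that] .
  show ?thesis
  proof (intro equalityI subsetI)
    fix W assume "W \<in> flag_proj t ` (flag_topology d closure_of X)"
    then obtain W' where W': "W' \<in> flag_topology d closure_of X" "W = flag_proj t W'" by blast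
    then have "W' \<in> flag_manifold d" by (metis in_closure_of topspace_flag_topology)
    then obtain u where u: "u \<in> unitary" "W' = act u V"
      using flag_manifold_unitary_transitive[OF d V] by metis
    have "u \<in> closure (preimage_flags V X)"
      using closure_of_flag_topology[OF V X unitary_invertible[OF u(1)]] W' u by simp
    moreover have "preimage_flags V X \<subseteq> preimage_flags (flag_proj t V) (flag_proj t ` X)"
      by (auto simp: preimage_flags_def act[symmetric])
    ultimately have "u \<in> closure (preimage_flags (flag_proj t V) (flag_proj t ` X))"
      using closure_mono by blast
    then show "W \<in> flag_topology f closure_of (flag_proj t ` X)"
      using closure_of_flag_topology[OF pV pX unitary_invertible[OF u(1)]] W'(2) u(2) act by simp
  next
    fix W assume W: "W \<in> flag_topology f closure_of (flag_proj t ` X)"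
    then have "W \<in> flag_manifold f" by (metis in_closure_of topspace_flag_topology)
    then obtain v where v: "v \<in> unitary" "W = act v (flag_proj t V)"
      using flag_manifold_unitary_transitive[OF f pV] by metis
    have "v \<in> closure (preimage_flags (flag_proj t V) (flag_proj t ` X))"
      using closure_of_flag_topology[OF pV pX unitary_invertible[OF v(1)]] W v by simp
    then obtain h where h: "\<And>n. h n \<in> preimage_flags (flag_proj t V) (flag_proj t ` X)"
      and hv: "h \<longlonglongrightarrow> v" unfolding closure_sequential by blast
    have "\<exists>u\<in>unitary. act u V \<in> X \<and> act (h n) (flag_proj t V) = act u (flag_proj t V)" for n
    proof -
      obtain Y where Y: "Y \<in> X" "act (h n) (flag_proj t V) = flag_proj t Y"
        using h[of n] by (auto simp: preimage_flags_def)
      then obtain u where "u \<in> unitary" "Y = act u V"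
        using flag_manifold_unitary_transitive[OF d V] X by (metis subsetD)
      then show ?thesis using Y act by metis
    qed
    then obtain u where u: "\<And>n. u n \<in> unitary" "\<And>n. act (u n) V \<in> X"
      "\<And>n. act (h n) (flag_proj t V) = act (u n) (flag_proj t V)" by metis
    have "\<forall>n. u n \<in> unitary" using u(1) by blast
    then obtain l r where l: "l \<in> unitary" and r: "strict_mono r" "(u \<circ> r) \<longlonglongrightarrow> l"
      by (rule seq_compactE[OF compact_imp_seq_compact[OF compact_unitary]])
    have ul: "(\<lambda>n. u (r n)) \<longlonglongrightarrow> l" using r(2) by (simp add: o_def)
    have "(\<lambda>n. cadj (u (r n))) \<longlonglongrightarrow> cadj l"
      using continuous_on_tendsto_compose[OF continuous_on_cadj[of UNIV] ul] by simp
    moreover have "(\<lambda>n. h (r n)) \<longlonglongrightarrow> v"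
      using LIMSEQ_subseq_LIMSEQ[OF hv r(1)] by (simp add: o_def)
    ultimately have lim: "(\<lambda>n. cadj (u (r n)) ** h (r n)) \<longlonglongrightarrow> cadj l ** v"
      by (intro mmult.tendsto)
    \<comment> \<open>\<open>h n\<close> and \<open>u n\<close> move the projected flag to the same
      flag, so their quotient stabilizes it. The flag algebra is closed, hence \<open>v\<close> and
      the limit \<open>l\<close> also agree on the projected flag.\<close>
    have mem: "cadj (u n) ** h n \<in> flag_algebra (flag_proj t V)" for n
    proof -
      have "act (cadj (u n) ** h n) (flag_proj t V) = flag_proj t V"
        using unitary_cadj(2)[OF u(1)[of n]] u(3)[of n] by (simp flip: act_act) (simp add: act_act)
      moreover have "invertible (cadj (u n) ** h n)"
        using h[of n] unitary_invertible[OF unitary_cadj(1)[OF u(1)[of n]]]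
        by (simp add: preimage_flags_def invertible_mult)
      ultimately show ?thesis using act_eq_iff[OF sub] by blast
    qed
    have "cadj l ** v \<in> flag_algebra (flag_proj t V)"
      by (rule Lim_in_subspace[OF subspace_flag_algebra[OF sub] mem lim])
    moreover have "invertible (cadj l ** v)"
      using unitary_cadj(1)[OF l] v(1) by (intro invertible_mult unitary_invertible)
    ultimately have "act (cadj l ** v) (flag_proj t V) = flag_proj t V" using act_eq_iff[OF sub] by blast
    then have "act l (act (cadj l ** v) (flag_proj t V)) = act l (flag_proj t V)" by simp
    moreover have "l ** (cadj l ** v) = v"
      using l by (simp add: matrix_mul_assoc unitary_def)
    ultimately have "W = flag_proj t (act l V)" by (simp add: act_act v(2) act)
    moreover have "l \<in> closure (preimage_flags V X)"
      unfolding closure_sequential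
      using ul u by (intro exI[of _ "\<lambda>n. u (r n)"]) (simp add: preimage_flags_def unitary_invertible)
    then have "act l V \<in> flag_topology d closure_of X"
      using closure_of_flag_topology[OF V X unitary_invertible[OF l]] by blast
    ultimately show "W \<in> flag_proj t ` (flag_topology d closure_of X)" by blast
  qed
qed

section \<open>Matrix patterns\<close>

definition pattern :: "('n \<times> 'n) set \<Rightarrow> (complex^'n^'n::finite) set" where
  "pattern R = {X. \<forall>a b. (a, b) \<notin> R \<longrightarrow> X $ a $ b = 0}"

lemma subspace_pattern: "subspace (pattern R)"
  by (auto simp: subspace_def pattern_def)

lemma pattern_scale: "X \<in> pattern R \<Longrightarrow> map_matrix ((*) c) X \<in> pattern R"
  by (simp add: pattern_def)

text \<open>The dimension is real: each free entry contributes the two basis matrices with 1 and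
  \<open>\<i>\<close> in its place.\<close>

lemma dim_pattern: "dim (pattern R) = 2 * card R" for R :: "('n::finite \<times> 'n) set"
proof -
  define B where "B = (\<lambda>((a, b), z). axis a (axis b z) :: complex^'n^'n) ` (R \<times> {1, \<i>})"
  have inj: "inj_on (\<lambda>((a, b), z). axis a (axis b z) :: complex^'n^'n) (R \<times> {1, \<i>})"
    by (auto simp: inj_on_def axis_eq_axis)
  have BB: "B \<subseteq> Basis"
    by (auto simp: B_def Basis_vec_def Basis_complex_def)
  have "pattern R = {X. \<forall>i\<in>Basis. i \<notin> B \<longrightarrow> X \<bullet> i = 0}"
  proof (intro equalityI subsetI CollectI ballI impI)
    fix X and i :: "complex^'n^'n" assume X: "X \<in> pattern R" and i: "i \<in> Basis" "i \<notin> B"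
    obtain a b z where abz: "i = axis a (axis b z)" "z = 1 \<or> z = \<i>"
      using i(1) by (auto simp: Basis_vec_def Basis_complex_def)
    then have "(a, b) \<notin> R" using i(2) by (force simp: B_def)
    then show "X \<bullet> i = 0" using X abz by (simp add: pattern_def inner_axis)
  next
    fix X assume X: "X \<in> {X :: complex^'n^'n. \<forall>i\<in>Basis. i \<notin> B \<longrightarrow> X \<bullet> i = 0}"
    have "X $ a $ b = 0" if ab: "(a, b) \<notin> R" for a b
    proof -
      have 0: "X $ a $ b \<bullet> z = 0" if z: "z \<in> {1, \<i>}" for z
      proof -
        have "axis a (axis b z) \<in> (Basis :: (complex^'n^'n) set)"
          using z by (auto simp: Basis_vec_def Basis_complex_def)
        moreover have "axis a (axis b z) \<notin> B" using ab z by (auto simp: B_def axis_eq_axis)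
        ultimately have "X \<bullet> axis a (axis b z) = 0" using X by blast
        then show ?thesis by (simp add: inner_axis)
      qed
      from 0[of 1] 0[of \<i>] show ?thesis by (simp add: complex_eq_iff inner_complex_def)
    qed
    then show "X \<in> pattern R" by (simp add: pattern_def)
  qed
  then have "dim (pattern R) = card B" by (simp add: dim_substandard[OF BB])
  also have "\<dots> = card (R \<times> {1, \<i>})" unfolding B_def by (rule card_image[OF inj])
  also have "\<dots> = 2 * card R" by (simp add: card_cartesian_product)
  finally show ?thesis .
qed

text \<open>The pairs for which some member of the coordinate flag contains the basis vector of
  \<open>b\<close> but not that of \<open>a\<close>. These are the entries excluded from the flag
  algebra, hence the complex coordinates of the open cell around the flag.\<close>

definition later :: "nat list \<Rightarrow> ('n \<Rightarrow> nat) \<Rightarrow> ('n \<times> 'n) set" where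
  "later c p = {(a, b). \<exists>i<length c. p b < psum c (Suc i) \<and> psum c (Suc i) \<le> p a}"

lemma image_coord_subset:
  fixes X :: "complex^'n^'n::finite"
  shows "(*v) X ` coord S \<subseteq> coord T \<longleftrightarrow> (\<forall>a b. a \<notin> T \<longrightarrow> b \<in> S \<longrightarrow> X $ a $ b = 0)"
proof
  assume L: "(*v) X ` coord S \<subseteq> coord T"
  show "\<forall>a b. a \<notin> T \<longrightarrow> b \<in> S \<longrightarrow> X $ a $ b = 0"
  proof (intro allI impI)
    fix a b assume ab: "a \<notin> T" "b \<in> S"
    have "axis b 1 \<in> coord S" using ab by (auto simp: coord_def axis_def)
    then have "(X *v axis b 1) $ a = 0" using L ab by (auto simp: coord_def)
    then show "X $ a $ b = 0"
      by (simp add: matrix_vector_mult_def axis_def if_distrib[of "(*) _"] cong: if_cong)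
  qed
next
  assume R: "\<forall>a b. a \<notin> T \<longrightarrow> b \<in> S \<longrightarrow> X $ a $ b = 0"
  show "(*v) X ` coord S \<subseteq> coord T"
  proof clarify
    fix v assume v: "v \<in> coord S"
    have "(X *v v) $ a = 0" if "a \<notin> T" for a
    proof -
      have "X $ a $ b * v $ b = 0" for b
        using R v that by (cases "b \<in> S") (auto simp: coord_def)
      then show ?thesis unfolding matrix_vector_mult_def by (simp add: sum.neutral)
    qed
    then show "X *v v \<in> coord T" by (simp add: coord_def)
  qed
qed

lemma flag_algebra_coord_flag: "flag_algebra (coord_flag c p) = pattern (- later c p)"
proof (rule set_eqI)
  fix X
  have "X \<in> flag_algebra (coord_flag c p) \<longleftrightarrow> (\<forall>i<length c.
      (*v) X ` coord {a. p a < psum c (Suc i)} \<subseteq> coord {a. p a < psum c (Suc i)})"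
    by (simp add: flag_algebra_def coord_flag_def) (simp add: Ball_def)
  also have "\<dots> \<longleftrightarrow> X \<in> pattern (- later c p)"
    unfolding image_coord_subset pattern_def later_def
    by (simp only: mem_Collect_eq Compl_iff not_not case_prod_conv not_less) iprover
  finally show "X \<in> flag_algebra (coord_flag c p) \<longleftrightarrow> X \<in> pattern (- later c p)" .
qed

section \<open>Dimensions of flag manifolds and Schubert varieties\<close>

lemma card_Compl_pairs: "card (- R) + card R = CARD('n) * CARD('n)"
  for R :: "('n::finite \<times> 'n) set"
proof -
  have "card (- R \<union> R) = card (- R) + card R" by (rule card_Un_disjoint) auto
  moreover have "- R \<union> R = UNIV \<times> UNIV" by auto
  ultimately show ?thesis by (simp add: card_cartesian_product del: UNIV_Times_UNIV)
qed

text \<open>The preimage of the whole flag manifold is the open set of invertible matrices, for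
  which the identity map is a chart; subtracting the stabilizer leaves the entries in
  \<open>later c p\<close>.\<close>

lemma submanifold_at_flag_manifold:
  fixes p :: "'n::finite \<Rightarrow> nat"
  assumes p: "bij_betw p UNIV {..<CARD('n)}" and c: "composition c CARD('n)"
  shows "submanifold_at (card (later c p)) (flag_manifold c) (coord_flag c p)"
proof -
  note V = coord_flag_manifold[OF p c]
  have GL: "{g. invertible g \<and> act g (coord_flag c p) \<in> flag_manifold c} = {g. invertible g}"
    using act_flag_manifold[OF V] by blast
  have one: "mat 1 \<in> {g :: complex^'n^'n. invertible g}" by (simp add: invertible_det_nz)
  have hom: "homeomorphism {g :: complex^'n^'n. invertible g} {g. invertible g} id id"
    by (simp add: homeomorphism_def continuous_on_id')
  have cd: "complex_differentiable_on id {g :: complex^'n^'n. invertible g}"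
    unfolding complex_differentiable_on_def by (auto intro!: exI[of _ id] has_derivative_id)
  have "pattern (UNIV :: ('n \<times> 'n) set) = UNIV" by (simp add: pattern_def)
  then have "dim (UNIV :: (complex^'n^'n) set) = 2 * card (UNIV :: ('n \<times> 'n) set)"
    by (metis dim_pattern)
  then have sub: "matrix_submanifold_at (card (UNIV :: ('n \<times> 'n) set)) {g :: complex^'n^'n. invertible g} (mat 1)"
    unfolding matrix_submanifold_at_def
    using one open_invertible hom cd
    by (intro conjI exI[of _ "{g. invertible g}"] exI[of _ id] exI[of _ UNIV])
      (simp_all add: subspace_UNIV)
  have "card (UNIV :: ('n \<times> 'n) set) = CARD('n) * CARD('n)"
    by (metis card_cartesian_product UNIV_Times_UNIV)
  then have "2 * card (UNIV :: ('n \<times> 'n) set) = 2 * card (later c p) + stab_real_dim (coord_flag c p)"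
    using card_Compl_pairs[of "later c p"]
    by (simp add: stab_real_dim_eq flag_algebra_coord_flag dim_pattern)
  then show ?thesis
    unfolding submanifold_at_def GL using V sub by (intro conjI exI) 
qed

text \<open>\<open>k\<close> is determined by the dimensions of the tangent cone and of the flag
  algebra, and neither changes between \<open>V\<close> and its translate.\<close>

lemma submanifold_at_unique_homogeneous:
  fixes V W :: "('n::finite) flag"
  assumes "submanifold_at k A V" "submanifold_at k' A W" "invertible h" "W = act h V" "act h ` A = A"
  shows "k = k'"
  using submanifold_at_tangent_cone(3)[OF assms(1)] submanifold_at_tangent_cone(3)[OF assms(2)]
    dim_tangent_cone_preimage_invariant[OF assms(3,5), of V] dim_flag_algebra_act[OF assms(3), of V]
    assms(4) by simp

lemma analytic_dim_flag_manifold: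
  fixes p :: "'n::finite \<Rightarrow> nat"
  assumes p: "bij_betw p UNIV {..<CARD('n)}" and c: "composition c CARD('n)"
  shows "analytic_dim (flag_manifold c :: 'n flag set) = card (later c p)"
proof -
  note S = submanifold_at_flag_manifold[OF p c]
  have "k = card (later c p)" if k: "submanifold_at k (flag_manifold c) V" for k and V :: "'n flag"
  proof -
    have V: "V \<in> flag_manifold c" by (rule submanifold_at_tangent_cone(1)[OF k])
    obtain u where u: "u \<in> unitary" "act u (coord_flag c p) = V" using flag_unitary[OF p c V] .
    have inv: "invertible u" by (rule unitary_invertible[OF u(1)])
    have "act u ` flag_manifold c = flag_manifold c"
    proof (intro equalityI subsetI)
      fix W :: "'n flag" assume "W \<in> flag_manifold c"
      then have "act (matrix_inv u) W \<in> flag_manifold c"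
        using act_flag_manifold matrix_inv_mult(3)[OF inv] by blast
      then show "W \<in> act u ` flag_manifold c" using act_inv(2)[OF inv] by (metis imageI)
    qed (use act_flag_manifold inv in blast)
    from submanifold_at_unique_homogeneous[OF S k inv u(2)[symmetric] this] show ?thesis by simp
  qed
  then have "{k. \<exists>V. submanifold_at k (flag_manifold c) (V :: 'n flag)} = {card (later c p)}"
    using S by blast
  then show ?thesis by (simp add: analytic_dim_def)
qed

section \<open>The triangular group of an order of the coordinates and its orbits\<close>

definition upper :: "('n \<Rightarrow> nat) \<Rightarrow> (complex^'n^'n::finite) set" where
  "upper \<rho> = pattern {(a, b). \<rho> a \<le> \<rho> b}"

definition upper_group :: "('n \<Rightarrow> nat) \<Rightarrow> (complex^'n^'n::finite) set" where
  "upper_group \<rho> = {g \<in> upper \<rho>. invertible g}"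

lemma upper_iff:
  fixes X :: "complex^'n^'n::finite"
  shows "X \<in> upper \<rho> \<longleftrightarrow> (\<forall>k. (*v) X ` coord {a. \<rho> a < k} \<subseteq> coord {a. \<rho> a < k})"
  unfolding upper_def pattern_def image_coord_subset
proof (intro iffI allI impI CollectI)
  fix a b assume *: "\<forall>k a b. a \<notin> {a. \<rho> a < k} \<longrightarrow> b \<in> {a. \<rho> a < k} \<longrightarrow> X $ a $ b = 0"
    and "(a, b) \<notin> {(a, b). \<rho> a \<le> \<rho> b}"
  then show "X $ a $ b = 0" using *[rule_format, of a "\<rho> a" b] by simp
qed auto

lemma upper_mult:
  fixes X Y :: "complex^'n^'n::finite"
  assumes "X \<in> upper \<rho>" "Y \<in> upper \<rho>"
  shows "X ** Y \<in> upper \<rho>"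
  using assms unfolding upper_iff image_subset_iff by (simp flip: matrix_vector_mul_assoc)

lemma upper_inverse:
  fixes X :: "complex^'n^'n::finite"
  assumes "X \<in> upper \<rho>" "invertible X"
  shows "matrix_inv X \<in> upper \<rho>"
  unfolding upper_iff
proof
  fix k
  have "X \<in> flag_algebra [coord {a. \<rho> a < k}]" using assms(1) by (simp add: upper_iff flag_algebra_def)
  then have "matrix_inv X \<in> flag_algebra [coord {a. \<rho> a < k}]"
    by (rule flag_algebra_inverse[rotated]) (auto simp: subspace_coord matrix_inv_mult[OF assms(2)])
  then show "(*v) (matrix_inv X) ` coord {a. \<rho> a < k} \<subseteq> coord {a. \<rho> a < k}"
    by (simp add: flag_algebra_def)
qed

lemma upper_group_mult: "X \<in> upper_group \<rho> \<Longrightarrow> Y \<in> upper_group \<rho> \<Longrightarrow> X ** Y \<in> upper_group \<rho>"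
  by (auto simp: upper_group_def upper_mult invertible_mult)

lemma upper_group_inverse: "X \<in> upper_group \<rho> \<Longrightarrow> matrix_inv X \<in> upper_group \<rho>"
  by (auto simp: upper_group_def upper_inverse matrix_inv_mult)

lemma upper_one: "mat 1 \<in> upper \<rho>" by (auto simp: upper_def pattern_def mat_def)

text \<open>A vector outside \<open>coord {a. \<rho> a < k}\<close> stays outside under the triangular group, so the
  position of the last nonzero entry of a column is preserved.\<close>

lemma upper_cell_unique:
  fixes N :: "complex^'n^'n::finite"
  assumes b: "b \<in> upper_group \<rho>" and N: "N \<in> pattern (later c p)"
    and eq: "act b (coord_flag c p) = act (mat 1 + N) (coord_flag c p)"
    and \<rho>: "inj \<rho>"
  shows "N \<in> upper \<rho>"
proof (rule ccontr)
  assume "N \<notin> upper \<rho>"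
  then obtain a0 \<beta> where a0: "N $ a0 $ \<beta> \<noteq> 0" "\<not> \<rho> a0 \<le> \<rho> \<beta>"
    by (auto simp: upper_def pattern_def)
  \<comment> \<open>The offending entries of column \<beta>. The highest of them, at \<gamma>, is
    also the last nonzero entry of this column of \<open>mat 1 + N\<close>, because the diagonal 1
    sits at the lower position \<beta>.\<close>
  define M where "M = {a. N $ a $ \<beta> \<noteq> 0 \<and> \<rho> \<beta> < \<rho> a}"
  have "finite M" "M \<noteq> {}" using a0 by (auto simp: M_def)
  then obtain \<gamma> where \<gamma>: "\<gamma> \<in> M" "\<And>a. a \<in> M \<Longrightarrow> \<rho> a \<le> \<rho> \<gamma>"
    using obtains_MAX[of M \<rho>] by (metis Max_ge finite_imageI imageI)
  have "(\<gamma>, \<beta>) \<in> later c p" using \<gamma>(1) N by (auto simp: M_def pattern_def)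
  then obtain i where i: "i < length c" "p \<beta> < psum c (Suc i)" "psum c (Suc i) \<le> p \<gamma>"
    by (auto simp: later_def)
  define S where "S = {a. p a < psum c (Suc i)}"
  have S: "\<beta> \<in> S" "\<gamma> \<notin> S" using i by (auto simp: S_def)
  define w where "w = (mat 1 + N) *v axis \<beta> 1"
  have wn: "w $ a = (if a = \<beta> then 1 else 0) + N $ a $ \<beta>" for a
    by (simp add: w_def matrix_vector_mult_def axis_def mat_def if_distrib[of "(*) _"] cong: if_cong)
  have "axis \<beta> 1 \<in> coord S" using S by (auto simp: coord_def axis_def)
  moreover have "(*v) b ` coord S = (*v) (mat 1 + N) ` coord S"
    using arg_cong[OF eq, of "\<lambda>V. V ! i"] i by (simp add: nth_coord_flag S_def)
  ultimately obtain v where v: "v \<in> coord S" "w = b *v v" unfolding w_def by blast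
  have inv: "invertible b" and bu: "b \<in> upper \<rho>" using b by (auto simp: upper_group_def)
  have vw: "v = matrix_inv b *v w"
    using matrix_inv_mult[OF inv] by (simp add: v(2) matrix_vector_mul_assoc)
  have "w \<in> coord {a. \<rho> a < Suc (\<rho> \<gamma>)}"
  proof -
    have "w $ a = 0" if "\<not> \<rho> a < Suc (\<rho> \<gamma>)" for a
    proof -
      have "a \<notin> M" using \<gamma>(2)[of a] that by auto
      moreover have "\<rho> \<beta> < \<rho> a" using that \<gamma>(1) by (auto simp: M_def)
      ultimately show ?thesis by (auto simp: wn M_def)
    qed
    then show ?thesis by (simp add: coord_def)
  qed
  then have "v \<in> coord {a. \<rho> a < Suc (\<rho> \<gamma>)}"
    unfolding vw using upper_inverse[OF bu inv] unfolding upper_iff by blast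
  \<comment> \<open>\<open>v\<close> has no entry at \<gamma>, which lies outside \<open>S\<close>.
    So its last position is below that of \<gamma>, and the triangular matrix \<open>b\<close>
    cannot raise it again to give \<open>w\<close>.\<close>
  have "v \<in> coord {a. \<rho> a < \<rho> \<gamma>}"
  proof -
    have "v $ a = 0" if "\<not> \<rho> a < \<rho> \<gamma>" for a
    proof (cases "a = \<gamma>")
      case True
      then show ?thesis using v(1) S(2) by (simp add: coord_def)
    next
      case False
      then have "\<rho> a \<noteq> \<rho> \<gamma>" using \<rho> by (simp add: inj_eq)
      then show ?thesis using that \<open>v \<in> coord {a. \<rho> a < Suc (\<rho> \<gamma>)}\<close> by (simp add: coord_def)
    qed
    then show ?thesis by (simp add: coord_def)
  qed
  then have "w \<in> coord {a. \<rho> a < \<rho> \<gamma>}" unfolding v(2) using bu unfolding upper_iff by blast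
  then have "w $ \<gamma> = 0" by (simp add: coord_def)
  then show False using S \<gamma>(1) by (auto simp: wn M_def split: if_splits)
qed

definition restrict_pattern :: "('n \<times> 'n) set \<Rightarrow> complex^'n^'n \<Rightarrow> complex^'n^'n::finite" where
  "restrict_pattern R X = (\<chi> a b. if (a, b) \<in> R then X $ a $ b else 0)"

lemma restrict_pattern_mem: "restrict_pattern R X \<in> pattern R"
  by (simp add: restrict_pattern_def pattern_def)

lemma linear_restrict_pattern: "linear (restrict_pattern R)"
  by (auto intro!: linearI simp: restrict_pattern_def vec_eq_iff)

lemma restrict_pattern_Compl: "restrict_pattern R X + restrict_pattern (- R) X = X"
  by (simp add: restrict_pattern_def vec_eq_iff)

lemma restrict_pattern_scale:
  "restrict_pattern R (map_matrix ((*) c) X) = map_matrix ((*) c) (restrict_pattern R X)"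
  by (simp add: restrict_pattern_def vec_eq_iff)

lemma map_matrix_mult_left: "map_matrix ((*) c) X ** Y = map_matrix ((*) c) (X ** Y)"
  for X Y :: "complex^'n^'n"
  by (simp add: matrix_matrix_mult_def vec_eq_iff sum_distrib_left mult.assoc)

lemma map_matrix_mult_right: "X ** map_matrix ((*) c) Y = map_matrix ((*) c) (X ** Y)"
  for X Y :: "complex^'n^'n"
  by (simp add: matrix_matrix_mult_def vec_eq_iff sum_distrib_left mult.left_commute)

lemma map_matrix_add: "map_matrix ((*) c) (X + Y) = map_matrix ((*) c) X + map_matrix ((*) c) Y"
  for X Y :: "complex^'n^'n"
  by (simp add: vec_eq_iff distrib_left)

text \<open>The orbit of the coordinate flag under the unipotent matrices \<open>1 + N\<close> is an open cell, and
  \<open>1 + N\<close> lies over the orbit of the triangular group exactly if \<open>N\<close> is triangular.\<close>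

lemma cell_chart:
  fixes R :: "('n::finite \<times> 'n) set"
  assumes N_def: "N = restrict_pattern R" and D_def: "D = restrict_pattern (- R)"
    and \<Phi>: "\<And>X. \<Phi> X = (mat 1 + N X) ** (mat 1 + D X)"
  obtains U V g where "open U" "0 \<in> U" "open V" "mat 1 \<in> V" "homeomorphism U V \<Phi> g"
    "complex_differentiable_on \<Phi> U" "complex_differentiable_on g V"
    "\<And>X. X \<in> U \<Longrightarrow> invertible (mat 1 + N X)" "\<And>X. X \<in> U \<Longrightarrow> invertible (mat 1 + D X)"
proof -
  have bN: "bounded_linear N" and bD: "bounded_linear D"
    using linear_restrict_pattern by (simp_all add: N_def D_def linear_conv_bounded_linear)
  have ND: "N X + D X = X" "D X + N X = X" for X
    using restrict_pattern_Compl[of R X] by (simp_all add: N_def D_def add.commute)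
  define \<Phi>' where "\<Phi>' X Y = (mat 1 + N X) ** D Y + N Y ** (mat 1 + D X)" for X Y
  have bl: "bounded_linear (\<Phi>' X)" for X
  proof -
    have "linear (\<Phi>' X)" unfolding \<Phi>'_def
      by (auto intro!: linearI simp: linear_simps[OF bN] linear_simps[OF bD] mmult.add_left
          mmult.add_right mmult.scaleR_left mmult.scaleR_right scaleR_add_right)
    then show ?thesis by (simp add: linear_conv_bounded_linear)
  qed
  have der: "(\<Phi> has_derivative \<Phi>' X) (at X)" for X
  proof -
    have "((\<lambda>X. (mat 1 + N X) ** (mat 1 + D X)) has_derivative
        (\<lambda>Y. (mat 1 + N X) ** D Y + N Y ** (mat 1 + D X))) (at X)"
      by (rule mmult.FDERIV)
        (auto intro!: derivative_eq_intros bounded_linear_imp_has_derivative[OF bN]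
          bounded_linear_imp_has_derivative[OF bD])
    then show ?thesis by (simp only: \<Phi>'_def[abs_def] \<Phi>[abs_def])
  qed
  have \<Phi>0: "\<Phi> 0 = mat 1" by (simp add: \<Phi> linear_simps[OF bN] linear_simps[OF bD])
  define F where "F X = Blinfun (\<Phi>' X)" for X
  have F: "blinfun_apply (F X) = \<Phi>' X" for X
    by (simp add: F_def bounded_linear_Blinfun_apply bl)
  have cN: "continuous_on S N" and cD: "continuous_on S D" for S
    using bN bD by (auto intro: linear_continuous_on)
  have contF: "continuous_on S F" for S
    by (rule continuous_on_blinfun_componentwise)
      (auto simp: F \<Phi>'_def intro!: continuous_intros mmult.continuous_on cN cD)
  define G where "G = {X. invertible (mat 1 + N X) \<and> invertible (mat 1 + D X)}"
  have oG: "open G"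
  proof -
    have "open ((\<lambda>X. mat 1 + N X) -` {g. invertible g})" "open ((\<lambda>X. mat 1 + D X) -` {g. invertible g})"
      by (intro open_vimage open_invertible continuous_intros cN cD)+
    from open_Int[OF this] show ?thesis by (simp add: G_def vimage_def Int_def)
  qed
  have G0: "0 \<in> G" by (simp add: G_def linear_simps[OF bN] linear_simps[OF bD] invertible_det_nz)
  \<comment> \<open>At 0 the derivative is \<open>N + D\<close>, the identity, so the inverse
    function theorem applies.\<close>
  have id: "id_blinfun o\<^sub>L F 0 = id_blinfun"
    by (rule blinfun_eqI) (simp add: F \<Phi>'_def linear_simps[OF bN] linear_simps[OF bD] ND add.commute)
  have derF: "\<And>X. X \<in> G \<Longrightarrow> (\<Phi> has_derivative blinfun_apply (F X)) (at X)" using der F by simp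
  obtain U V g g' where UV: "open U" "U \<subseteq> G" "0 \<in> U" "open V" "\<Phi> 0 \<in> V" "homeomorphism U V \<Phi> g"
    and g: "\<And>y. y \<in> V \<Longrightarrow> (g has_derivative (g' y)) (at y)"
    and g': "\<And>y. y \<in> V \<Longrightarrow> g' y = inv (blinfun_apply (F (g y)))"
    and bij: "\<And>y. y \<in> V \<Longrightarrow> bij (blinfun_apply (F (g y)))"
    using inverse_function_theorem[OF oG derF contF G0 id] by metis
  have sc: "\<Phi>' X (map_matrix ((*) \<i>) Y) = map_matrix ((*) \<i>) (\<Phi>' X Y)" for X Y
    by (simp add: \<Phi>'_def N_def D_def restrict_pattern_scale map_matrix_mult_left
        map_matrix_mult_right map_matrix_add)
  have "complex_differentiable_on \<Phi> U"
    unfolding complex_differentiable_on_def using der sc by blast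
  moreover have "complex_differentiable_on g V"
    unfolding complex_differentiable_on_def
  proof
    fix y assume y: "y \<in> V"
    have b: "bij (\<Phi>' (g y))" using bij[OF y] by (simp add: F)
    have "inv (\<Phi>' (g y)) (map_matrix ((*) \<i>) Y) = map_matrix ((*) \<i>) (inv (\<Phi>' (g y)) Y)" for Y
      using b by (intro inv_f_eq bij_is_inj) (simp_all add: sc bij_is_surj surj_f_inv_f)
    then show "\<exists>g'. (g has_derivative g') (at y) \<and>
        (\<forall>Y. g' (map_matrix ((*) \<i>) Y) = map_matrix ((*) \<i>) (g' Y))"
      using g[OF y] g'[OF y] F by metis
  qed
  ultimately show ?thesis
    using that[of U V g] UV unfolding \<Phi>0 by (auto simp: G_def)
qed

text \<open>\<rho> is the order defining the triangular group, \<open>p\<close> the order defining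
  the flag; the permutation of the cell is encoded in comparing the two.\<close>

definition schubert_cell :: "nat list \<Rightarrow> ('n \<Rightarrow> nat) \<Rightarrow> ('n \<Rightarrow> nat) \<Rightarrow> 'n::finite flag set" where
  "schubert_cell c \<rho> p = orbit (upper_group \<rho>) (coord_flag c p)"

lemma upper_group_one: "mat 1 \<in> upper_group \<rho>"
  by (simp add: upper_group_def upper_one invertible_det_nz)

lemma schubert_cell_subset:
  fixes p :: "'n::finite \<Rightarrow> nat"
  assumes "bij_betw p UNIV {..<CARD('n)}" "composition c CARD('n)"
  shows "schubert_cell c \<rho> p \<subseteq> flag_manifold c"
  using coord_flag_manifold[OF assms]
  by (auto simp: schubert_cell_def orbit_def upper_group_def intro: act_flag_manifold)

text \<open>In the coordinates of \<open>cell_chart\<close> the preimage of the cell is the linear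
  subspace on which \<open>N X\<close> is triangular, while \<open>D X\<close> is free because it
  only moves along the stabilizer. The remaining free entries of \<open>N X\<close> are the
  inversions counted here.\<close>

lemma submanifold_at_schubert:
  fixes p \<rho> :: "'n::finite \<Rightarrow> nat"
  assumes p: "bij_betw p UNIV {..<CARD('n)}" and c: "composition c CARD('n)" and \<rho>: "inj \<rho>"
  shows "submanifold_at (card {(a, b) \<in> later c p. \<rho> a \<le> \<rho> b})
    (flag_topology c closure_of schubert_cell c \<rho> p) (coord_flag c p)"
proof -
  let ?W = "coord_flag c p" and ?S = "flag_topology c closure_of schubert_cell c \<rho> p"
  note W = coord_flag_manifold[OF p c] and sub = schubert_cell_subset[OF p c, of \<rho>]
  let ?R = "later c p" and ?T = "{(a, b). \<rho> a \<le> \<rho> b}"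
  let ?P = "preimage_flags ?W (schubert_cell c \<rho> p)"
  define N where "N = restrict_pattern ?R"
  define D where "D = restrict_pattern (- ?R)"
  define \<Phi> where "\<Phi> X = (mat 1 + N X) ** (mat 1 + D X)" for X
  obtain U V g where UV: "open U" "0 \<in> U" "open V" "mat 1 \<in> V" "homeomorphism U V \<Phi> g"
    "complex_differentiable_on \<Phi> U" "complex_differentiable_on g V"
    and invN: "\<And>X. X \<in> U \<Longrightarrow> invertible (mat 1 + N X)"
    and invD: "\<And>X. X \<in> U \<Longrightarrow> invertible (mat 1 + D X)"
    by (rule cell_chart[OF N_def D_def \<Phi>_def]) (rule that)
  have gU: "g y \<in> U" "\<Phi> (g y) = y" if "y \<in> V" for y
    using UV(5) that by (auto simp: homeomorphism_def)
  have g\<Phi>: "g (\<Phi> X) = X" "\<Phi> X \<in> V" if "X \<in> U" for X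
    using UV(5) that by (auto simp: homeomorphism_def)
  define L where "L = pattern (- ?R \<union> ?T)"
  have L: "X \<in> L \<longleftrightarrow> N X \<in> upper \<rho>" for X
    by (auto simp: L_def N_def pattern_def upper_def restrict_pattern_def)
  have inv\<Phi>: "invertible (\<Phi> X)" if "X \<in> U" for X
    unfolding \<Phi>_def by (intro invertible_mult invN invD that)
  have act\<Phi>: "act (\<Phi> X) ?W = act (mat 1 + N X) ?W" if "X \<in> U" for X
  proof -
    have "D X \<in> flag_algebra ?W" unfolding flag_algebra_coord_flag D_def by (rule restrict_pattern_mem)
    moreover have s: "vec.subspace Y" if "Y \<in> set ?W" for Y by (rule flag_manifold_subspace[OF W that])
    ultimately have "mat 1 + D X \<in> flag_algebra ?W"
      using flag_algebra_one subspace_flag_algebra by (intro subspace_add) auto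
    then have "act (mat 1 + D X) ?W = ?W" using act_eq_iff[OF s invD[OF that]] by blast
    then show ?thesis by (simp add: \<Phi>_def flip: act_act)
  qed
  have cell: "\<Phi> X \<in> ?P \<longleftrightarrow> X \<in> L" if X: "X \<in> U" for X
  proof
    assume "\<Phi> X \<in> ?P"
    then obtain b where "b \<in> upper_group \<rho>" "act b ?W = act (mat 1 + N X) ?W"
      using act\<Phi>[OF X] by (auto simp: preimage_flags_def schubert_cell_def orbit_def)
    then show "X \<in> L" unfolding L
      using upper_cell_unique[OF _ restrict_pattern_mem _ \<rho>] unfolding N_def by blast
  next
    assume "X \<in> L"
    then have "mat 1 + N X \<in> upper \<rho>"
      using upper_one subspace_pattern unfolding L upper_def by (intro subspace_add)
    then have "mat 1 + N X \<in> upper_group \<rho>" using invN[OF X] by (simp add: upper_group_def)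
    then show "\<Phi> X \<in> ?P" using inv\<Phi>[OF X] act\<Phi>[OF X]
      by (auto simp: preimage_flags_def schubert_cell_def orbit_def)
  qed
  have sL: "subspace L" unfolding L_def by (rule subspace_pattern)
  \<comment> \<open>Within the chart the cell is relatively closed, being cut out by a closed
    subspace, so passing to the Schubert variety adds no point there.\<close>
  have closed_cell: "X \<in> L" if X: "X \<in> U" "\<Phi> X \<in> closure ?P" for X
  proof -
    obtain x where x: "\<And>n. x n \<in> ?P" "x \<longlonglongrightarrow> \<Phi> X" using X(2) unfolding closure_sequential by blast
    have "isCont g (\<Phi> X)"
      using UV(7) g\<Phi>(2)[OF X(1)] unfolding complex_differentiable_on_def
      by (meson has_derivative_continuous)
    then have "(\<lambda>n. g (x n)) \<longlonglongrightarrow> g (\<Phi> X)" using x(2) by (rule isCont_tendsto_compose)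
    moreover have "\<forall>\<^sub>F n in sequentially. x n \<in> V"
      by (rule topological_tendstoD[OF x(2) UV(3) g\<Phi>(2)[OF X(1)]])
    then have "\<forall>\<^sub>F n in sequentially. g (x n) \<in> L"
    proof eventually_elim
      case (elim n)
      then show ?case using cell[OF gU(1)[OF elim]] gU(2)[OF elim] x(1) by simp
    qed
    ultimately show ?thesis
      using Lim_in_closed_set[OF closed_subspace[OF sL]] g\<Phi>(1)[OF X(1)] by fastforce
  qed
  have pre: "preimage_flags ?W ?S = {g. invertible g} \<inter> closure ?P"
    by (rule preimage_flags_closure_of[OF W sub])
  have one: "?W \<in> schubert_cell c \<rho> p"
    unfolding schubert_cell_def orbit_def using upper_group_one[of \<rho>] by (metis act_one image_eqI)
  then have WS: "?W \<in> ?S" using closure_of_subset[of "schubert_cell c \<rho> p" "flag_topology c"] sub by auto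
  \<comment> \<open>The straightening map required by \<open>matrix_submanifold_at\<close> is
    \<open>g\<close>; \<Phi> is its inverse.\<close>
  have im: "g ` (V \<inter> preimage_flags ?W ?S) = U \<inter> L"
  proof (intro equalityI subsetI)
    fix X assume "X \<in> g ` (V \<inter> preimage_flags ?W ?S)"
    then obtain y where y: "y \<in> V" "y \<in> closure ?P" "X = g y" unfolding pre by blast
    then show "X \<in> U \<inter> L" using closed_cell[of X] gU[OF y(1)] by simp
  next
    fix X assume X: "X \<in> U \<inter> L"
    then have "\<Phi> X \<in> closure ?P" using cell closure_subset[of ?P] by auto
    then have "\<Phi> X \<in> V \<inter> preimage_flags ?W ?S" unfolding pre using X g\<Phi> inv\<Phi> by auto
    then show "X \<in> g ` (V \<inter> preimage_flags ?W ?S)" using g\<Phi>(1)[of X] X by (metis IntD1 image_eqI)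
  qed
  define l where "l = card (- ?R \<union> ?T)"
  have "matrix_submanifold_at l (preimage_flags ?W ?S) (mat 1)"
    unfolding matrix_submanifold_at_def
  proof (intro conjI exI)
    show "mat 1 \<in> preimage_flags ?W ?S" using WS by (simp add: preimage_flags_def invertible_det_nz)
    show "open V" "mat 1 \<in> V" "open U" by (fact UV)+
    show "homeomorphism V U g \<Phi>" using UV(5) by (rule homeomorphism_symD)
    show "complex_differentiable_on g V" "complex_differentiable_on \<Phi> U" by (fact UV)+
    show "subspace L" by (rule sL)
    show "map_matrix ((*) \<i>) ` L \<subseteq> L" by (auto simp: L_def pattern_scale)
    show "dim L = 2 * l" by (simp add: L_def dim_pattern l_def)
    show "g ` (V \<inter> preimage_flags ?W ?S) = U \<inter> L" by (rule im)
  qed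
  moreover have "2 * l = 2 * card {(a, b) \<in> ?R. \<rho> a \<le> \<rho> b} + stab_real_dim ?W"
  proof -
    have "- ?R \<union> ?T = - ?R \<union> {(a, b) \<in> ?R. \<rho> a \<le> \<rho> b}" by auto
    moreover have "card \<dots> = card (- ?R) + card {(a, b) \<in> ?R. \<rho> a \<le> \<rho> b}"
      by (intro card_Un_disjoint) auto
    ultimately show ?thesis
      by (simp add: l_def stab_real_dim_eq flag_algebra_coord_flag dim_pattern)
  qed
  ultimately show ?thesis
    unfolding submanifold_at_def using WS unfolding preimage_flags_def by blast
qed

lemma act_closure_subset:
  fixes X :: "('n::finite) flag set"
  assumes c: "composition c CARD('n)" and X: "X \<subseteq> flag_manifold c" and h: "invertible h"
    and hX: "act h ` X \<subseteq> X"
  shows "act h ` (flag_topology c closure_of X) \<subseteq> flag_topology c closure_of X"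
proof clarify
  fix W assume W: "W \<in> flag_topology c closure_of X"
  then have Wc: "W \<in> flag_manifold c" by (metis in_closure_of topspace_flag_topology)
  have 1: "invertible (mat 1 :: complex^'n^'n)" by (simp add: invertible_det_nz)
  have "mat 1 \<in> closure (preimage_flags W X)"
    using closure_of_flag_topology[OF Wc X 1] W by simp
  then obtain x where x: "\<And>n. x n \<in> preimage_flags W X" "x \<longlonglongrightarrow> mat 1"
    unfolding closure_sequential by blast
  have "(\<lambda>n. h ** x n) \<longlonglongrightarrow> h ** mat 1" by (intro mmult.tendsto tendsto_const x(2))
  moreover have "h ** x n \<in> preimage_flags W X" for n
    using x(1)[of n] h hX by (auto simp: preimage_flags_def invertible_mult simp flip: act_act)
  ultimately have "h \<in> closure (preimage_flags W X)"
    unfolding closure_sequential by (metis matrix_mul_rid)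
  then show "act h W \<in> flag_topology c closure_of X"
    using closure_of_flag_topology[OF Wc X h] by blast
qed

text \<open>A regular point outside the cell gives no new dimension: its chart also covers points of
  the cell, which is dense, and all points of the cell are equivalent under the triangular
  group.\<close>

lemma analytic_dim_schubert:
  fixes p \<rho> :: "'n::finite \<Rightarrow> nat"
  assumes p: "bij_betw p UNIV {..<CARD('n)}" and c: "composition c CARD('n)" and \<rho>: "inj \<rho>"
  shows "analytic_dim (flag_topology c closure_of schubert_cell c \<rho> p)
    = card {(a, b) \<in> later c p. \<rho> a \<le> \<rho> b}"
proof -
  let ?W = "coord_flag c p" and ?S = "flag_topology c closure_of schubert_cell c \<rho> p"
  let ?k = "card {(a, b) \<in> later c p. \<rho> a \<le> \<rho> b}"
  note sub = schubert_cell_subset[OF p c, of \<rho>] and S = submanifold_at_schubert[OF p c \<rho>]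
  have 1: "invertible (mat 1 :: complex^'n^'n)" by (simp add: invertible_det_nz)
  have "k = ?k" if k: "submanifold_at k ?S V" for k V
  proof -
    have V: "V \<in> ?S" by (rule submanifold_at_tangent_cone(1)[OF k])
    then have Vc: "V \<in> flag_manifold c" by (metis in_closure_of topspace_flag_topology)
    have "mat 1 \<in> closure (preimage_flags V (schubert_cell c \<rho> p))"
      using closure_of_flag_topology[OF Vc sub 1] V by simp
    moreover have "schubert_cell c \<rho> p \<subseteq> ?S" using sub by (intro closure_of_subset) simp
    ultimately obtain h where h: "act h V \<in> schubert_cell c \<rho> p"
      "dim (tangent_cone (preimage_flags (act h V) ?S) (mat 1)) = 2 * k + dim (flag_algebra (act h V))"
      using submanifold_at_nearby[OF k] by metis
    then obtain b where b: "b \<in> upper_group \<rho>" "act h V = act b ?W"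
      by (auto simp: schubert_cell_def orbit_def)
    have inv: "invertible b" using b(1) by (simp add: upper_group_def)
    have cl: "act x ` ?S \<subseteq> ?S" if x: "x \<in> upper_group \<rho>" for x
    proof (rule act_closure_subset[OF c sub])
      show "invertible x" using x by (simp add: upper_group_def)
      show "act x ` schubert_cell c \<rho> p \<subseteq> schubert_cell c \<rho> p"
        using upper_group_mult[OF x] by (auto simp: schubert_cell_def orbit_def act_act)
    qed
    have "act b ` ?S = ?S"
    proof
      have "act b ` act (matrix_inv b) ` ?S \<subseteq> act b ` ?S"
        using cl[OF upper_group_inverse[OF b(1)]] by (rule image_mono)
      then show "?S \<subseteq> act b ` ?S" by (simp add: image_image act_inv(2)[OF inv])
    qed (rule cl[OF b(1)])
    from dim_tangent_cone_preimage_invariant[OF inv this, of ?W]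
    have "dim (tangent_cone (preimage_flags (act b ?W) ?S) (mat 1)) = 2 * ?k + dim (flag_algebra ?W)"
      using submanifold_at_tangent_cone(3)[OF S] by simp
    then show ?thesis using h(2) dim_flag_algebra_act[OF inv, of ?W] by (simp add: b(2))
  qed
  then have "{k. \<exists>V. submanifold_at k ?S V} = {?k}" using S by blast
  then show ?thesis by (simp add: analytic_dim_def)
qed

section \<open>The compact symplectic group\<close>

text \<open>The permutation underlying the monomial matrix \<open>quat_J\<close>;
  \<open>parity\<close> collects its signs. Together they describe \<open>quat_j\<close> entrywise
  in \<open>quat_j_nth\<close>.\<close>

definition twin :: "'m + 'm \<Rightarrow> 'm + 'm" where
  "twin a = (case a of Inl i \<Rightarrow> Inr i | Inr i \<Rightarrow> Inl i)"

definition parity :: "'m + 'm \<Rightarrow> complex" where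
  "parity a = (case a of Inl i \<Rightarrow> 1 | Inr i \<Rightarrow> -1)"

lemma twin_twin [simp]: "twin (twin a) = a" by (cases a) (simp_all add: twin_def)

lemma twin_neq [simp]: "twin a \<noteq> a" by (cases a) (simp_all add: twin_def)

lemma twin_eq_iff [simp]: "twin a = twin b \<longleftrightarrow> a = b" by (metis twin_twin)

lemma bij_twin: "bij twin" by (rule o_bij[of twin]) (auto simp: fun_eq_iff)

lemma parity_twin [simp]: "parity (twin a) = - parity a"
  by (cases a) (simp_all add: parity_def twin_def)

lemma parity_simps [simp]: "parity a * parity a = 1" "cnj (parity a) = parity a" "parity a \<noteq> 0"
  by (cases a; simp add: parity_def)+

lemma quat_j_nth: "quat_j v $ a = parity a * cnj (v $ twin a)" for a :: "'m::finite + 'm"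
proof -
  have *: "(\<Sum>b\<in>(UNIV :: ('m + 'm) set). g b) = (\<Sum>i\<in>UNIV. g (Inl i)) + (\<Sum>i\<in>UNIV. g (Inr i))"
    for g :: "'m + 'm \<Rightarrow> complex"
    unfolding UNIV_sum by (subst sum.union_disjoint) (auto simp: sum.reindex)
  show ?thesis
    by (cases a) (simp_all add: quat_j_def quat_J_def matrix_vector_mult_def * parity_def twin_def
        if_distrib[of "\<lambda>x. x * _"] cong: if_cong)
qed

lemma quat_j_quat_j: "quat_j (quat_j v) = - v"
  by (simp add: vec_eq_iff quat_j_nth)

definition quat_linear :: "(complex^('m + 'm)^('m::finite + 'm)) set" where
  "quat_linear = {X. \<forall>v. quat_j (X *v v) = X *v quat_j v}"

lemma quat_linear_iff:
  fixes X :: "complex^('m + 'm)^('m::finite + 'm)"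
  shows "X \<in> quat_linear \<longleftrightarrow> (\<forall>a b. X $ twin a $ twin b = parity a * parity b * cnj (X $ a $ b))"
proof
  assume X: "X \<in> quat_linear"
  show "\<forall>a b. X $ twin a $ twin b = parity a * parity b * cnj (X $ a $ b)"
  proof (intro allI)
    fix a b :: "'m + 'm"
    have col: "(X *v axis b z) $ c = X $ c $ b * z" for c b :: "'m + 'm" and z
      by (simp add: matrix_vector_mult_def axis_def if_distrib[of "(*) _"] cong: if_cong)
    have "quat_j (axis b 1) = axis (twin b) (- parity b)"
      by (auto simp: vec_eq_iff quat_j_nth axis_def)
    then have "quat_j (X *v axis b 1) $ twin a = X $ twin a $ twin b * - parity b"
      using X by (simp add: quat_linear_def col)
    moreover have "quat_j (X *v axis b 1) $ twin a = - parity a * cnj (X $ a $ b)"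
      by (simp add: quat_j_nth col)
    ultimately have "X $ twin a $ twin b * parity b = parity a * cnj (X $ a $ b)" by simp
    then have "X $ twin a $ twin b * (parity b * parity b) = parity a * parity b * cnj (X $ a $ b)"
      by (metis mult.assoc mult.commute)
    then show "X $ twin a $ twin b = parity a * parity b * cnj (X $ a $ b)" by simp
  qed
next
  assume X: "\<forall>a b. X $ twin a $ twin b = parity a * parity b * cnj (X $ a $ b)"
  have "quat_j (X *v v) $ a = (X *v quat_j v) $ a" for v and a :: "'m + 'm"
  proof -
    have "(X *v quat_j v) $ a = (\<Sum>b\<in>UNIV. X $ a $ b * (parity b * cnj (v $ twin b)))"
      by (simp add: matrix_vector_mult_def quat_j_nth)
    also have "\<dots> = (\<Sum>b\<in>UNIV. X $ a $ twin b * (- parity b * cnj (v $ b)))"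
      using sum.reindex_bij_betw[OF bij_twin,
          of "\<lambda>b. X $ a $ b * (parity b * cnj (v $ twin b))"] by simp
    also have "\<dots> = (\<Sum>b\<in>UNIV. parity a * (cnj (X $ twin a $ b) * cnj (v $ b)))"
    proof (rule sum.cong[OF refl])
      fix b :: "'m + 'm"
      have "X $ a $ twin b = - parity a * parity b * cnj (X $ twin a $ b)"
        using X[rule_format, of "twin a" b] by simp
      then have "X $ a $ twin b * (- parity b * cnj (v $ b))
          = (parity b * parity b) * (parity a * (cnj (X $ twin a $ b) * cnj (v $ b)))"
        by (simp only: ac_simps minus_minus mult_minus_left mult_minus_right)
      then show "X $ a $ twin b * (- parity b * cnj (v $ b))
          = parity a * (cnj (X $ twin a $ b) * cnj (v $ b))" by simp
    qed
    also have "\<dots> = quat_j (X *v v) $ a"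
      by (simp add: quat_j_nth matrix_vector_mult_def sum_distrib_left)
    finally show ?thesis by simp
  qed
  then show "X \<in> quat_linear" by (simp add: quat_linear_def vec_eq_iff)
qed

lemma subspace_quat_linear: "subspace quat_linear"
  by (auto simp: subspace_def quat_linear_iff algebra_simps)

lemma quat_linear_one: "mat 1 \<in> quat_linear" by (simp add: quat_linear_def)

lemma quat_linear_mult: "X \<in> quat_linear \<Longrightarrow> Y \<in> quat_linear \<Longrightarrow> X ** Y \<in> quat_linear"
  by (simp add: quat_linear_def flip: matrix_vector_mul_assoc)

lemma quat_linear_inverse:
  assumes X: "X \<in> quat_linear" and inv: "X ** Y = mat 1"
  shows "Y \<in> quat_linear"
proof -
  have YX: "Y ** X = mat 1" using inv matrix_left_right_inverse by blast
  have "quat_j (Y *v v) = Y *v quat_j v" for v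
  proof -
    have "X *v quat_j (Y *v v) = quat_j (X *v (Y *v v))" using X by (simp add: quat_linear_def)
    also have "\<dots> = quat_j v" by (simp add: matrix_vector_mul_assoc inv)
    finally have "Y *v (X *v quat_j (Y *v v)) = Y *v quat_j v" by simp
    then show ?thesis by (simp add: matrix_vector_mul_assoc YX)
  qed
  then show ?thesis by (simp add: quat_linear_def)
qed

lemma det_map_cnj: "det (map_matrix cnj X) = cnj (det X)" for X :: "complex^'n^'n::finite"
  by (simp add: det_def)

lemma det_cadj: "det (cadj X) = cnj (det X)" for X :: "complex^'n^'n::finite"
  unfolding cadj_def det_map_cnj by (simp add: det_transpose)

lemma quat_j_eq: "quat_j v = quat_J *v (\<chi> i. cnj (v $ i))" by (simp add: quat_j_def)

lemma map_cnj_mult_vector: "(\<chi> i. cnj ((X *v v) $ i)) = map_matrix cnj X *v (\<chi> i. cnj (v $ i))"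
  for X :: "complex^'n^'n::finite"
  by (simp add: vec_eq_iff matrix_vector_mult_def)

lemma quat_J_square: "quat_J ** quat_J = - mat 1"
proof -
  have "(quat_J ** quat_J) *v v = (- mat 1) *v v" for v :: "complex^('a + 'a)"
  proof -
    define u :: "complex^('a + 'a)" where "u = (\<chi> i. cnj (v $ i))"
    have "v = (\<chi> i. cnj (u $ i))" by (simp add: u_def vec_eq_iff)
    then have "quat_J *v v = quat_j u" by (simp add: quat_j_eq)
    then have "(quat_J ** quat_J) *v v = quat_J *v quat_j u" by (simp flip: matrix_vector_mul_assoc)
    also have "\<dots> = quat_j (\<chi> i. cnj (quat_j u $ i))"
      unfolding quat_j_eq[of "\<chi> i. cnj (quat_j u $ i)"] by simp
    also have "\<dots> = - v" by (simp add: vec_eq_iff quat_j_nth u_def)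
    finally show ?thesis
      by (simp add: vec_eq_iff matrix_vector_mult_def mat_def sum_negf if_distrib[of "\<lambda>x. x * _"]
          cong: if_cong)
  qed
  then show ?thesis by (simp add: matrix_eq)
qed

text \<open>\<open>X\<close> is similar to its complex conjugate through the invertible matrix
  \<open>quat_J\<close>.\<close>

lemma det_quat_linear_real:
  fixes X :: "complex^('m + 'm)^('m::finite + 'm)"
  assumes "X \<in> quat_linear"
  shows "cnj (det X) = det X"
proof -
  have "(quat_J ** map_matrix cnj X) *v v = (X ** quat_J) *v v" for v
  proof -
    define u :: "complex^('m + 'm)" where "u = (\<chi> i. cnj (v $ i))"
    have v: "v = (\<chi> i. cnj (u $ i))" by (simp add: u_def vec_eq_iff)
    have "quat_j (X *v u) = X *v quat_j u" using assms by (simp add: quat_linear_def)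
    then show ?thesis
      unfolding quat_j_eq map_cnj_mult_vector v[symmetric] by (simp add: matrix_vector_mul_assoc)
  qed
  then have "quat_J ** map_matrix cnj X = X ** quat_J" by (simp add: matrix_eq)
  then have "det (quat_J ** map_matrix cnj X) = det (X ** quat_J)" by simp
  then have "det (quat_J :: complex^('m + 'm)^('m + 'm)) * cnj (det X)
      = det X * det (quat_J :: complex^('m + 'm)^('m + 'm))"
    by (simp only: det_mul det_map_cnj)
  moreover have "det (quat_J :: complex^('m + 'm)^('m + 'm)) \<noteq> 0"
  proof -
    have "quat_J ** (- quat_J) = (mat 1 :: complex^('m + 'm)^('m + 'm))"
      by (simp add: mmult.minus_right quat_J_square)
    then show ?thesis using invertible_det_nz invertible_right_inverse by blast
  qed
  ultimately show ?thesis by simp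
qed

lemma K0_eq: "K0 = {u \<in> unitary. det u = 1 \<and> u \<in> quat_linear}"
  by (auto simp: K0_def SU_def SL_def G0_def unitary_def quat_linear_def cadj_def)

lemma compact_K0: "compact (K0 :: (complex^('m + 'm)^('m::finite + 'm)) set)"
proof -
  have "continuous_on UNIV (det :: complex^('m + 'm)^('m + 'm) \<Rightarrow> complex)"
    unfolding det_def by (intro continuous_intros)
  then have "closed (det -` {1 :: complex} :: (complex^('m + 'm)^('m + 'm)) set)"
    by (simp add: closed_vimage)
  then have "closed (det -` {1 :: complex} \<inter> (quat_linear :: (complex^('m + 'm)^('m + 'm)) set))"
    using closed_subspace[OF subspace_quat_linear] by (rule closed_Int)
  from compact_Int_closed[OF compact_unitary this]
  have "compact (unitary \<inter> (det -` {1 :: complex} \<inter> (quat_linear :: (complex^('m + 'm)^('m + 'm)) set)))" .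
  moreover have "unitary \<inter> (det -` {1 :: complex} \<inter> quat_linear) = (K0 :: (complex^('m + 'm)^('m + 'm)) set)"
    unfolding K0_eq by blast
  ultimately show ?thesis by simp
qed

lemma K0_unitary: "u \<in> K0 \<Longrightarrow> u \<in> unitary" and K0_quat_linear: "u \<in> K0 \<Longrightarrow> u \<in> quat_linear"
  by (simp_all add: K0_eq)

lemma K0_invertible: "u \<in> K0 \<Longrightarrow> invertible u"
  by (rule unitary_invertible[OF K0_unitary])

lemma K0_one: "mat 1 \<in> K0"
  by (simp add: K0_eq quat_linear_one unitary_def) (simp add: vec_eq_iff mat_def)

lemma K0_mult: "u \<in> K0 \<Longrightarrow> v \<in> K0 \<Longrightarrow> u ** v \<in> K0"
  by (simp add: K0_eq unitary_mult det_mul quat_linear_mult)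

lemma K0_cadj: "u \<in> K0 \<Longrightarrow> cadj u \<in> K0"
  using quat_linear_inverse[of u "cadj u"]
  by (auto simp: K0_eq unitary_cadj det_cadj unitary_def[symmetric]) (simp_all add: unitary_def)

text \<open>The Lie algebra of the compact symplectic group \<open>K0\<close>. The condition on the
  determinant imposes no further equation, as \<open>cayley_K0\<close> shows.\<close>

definition k0 :: "(complex^('m + 'm)^('m::finite + 'm)) set" where
  "k0 = {X \<in> quat_linear. cadj X = - X}"

lemma linear_cadj: "linear cadj"
  by (auto intro!: linearI simp: vec_eq_iff)

lemma subspace_k0: "subspace k0"
  using subspace_quat_linear
  by (auto simp: k0_def subspace_def linear_add[OF linear_cadj] linear_scale[OF linear_cadj]
      linear_0[OF linear_cadj])

text \<open>The linear condition passes to limits of secants; the unitary condition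
  \<open>x ** cadj x = mat 1\<close> is differentiated along them.\<close>

lemma tangent_cone_K0:
  "tangent_cone (K0 :: (complex^('m + 'm)^('m::finite + 'm)) set) (mat 1) \<subseteq> k0"
proof
  fix Z :: "complex^('m + 'm)^('m + 'm)" assume "Z \<in> tangent_cone K0 (mat 1)"
  then obtain x t where x: "\<And>n. x n \<in> K0" and t: "\<And>n. t n > 0" "t \<longlonglongrightarrow> 0"
    and Z: "(\<lambda>n. (x n - mat 1) /\<^sub>R t n) \<longlonglongrightarrow> Z" and x1: "x \<longlonglongrightarrow> mat 1"
    by (rule tangent_coneE) blast
  have mem: "(x n - mat 1) /\<^sub>R t n \<in> quat_linear" for n
    using subspace_quat_linear quat_linear_one K0_quat_linear[OF x[of n]]
    by (intro subspace_scale subspace_diff)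
  have Zq: "Z \<in> quat_linear" by (rule Lim_in_subspace[OF subspace_quat_linear mem Z])
  have cZ: "(\<lambda>n. cadj ((x n - mat 1) /\<^sub>R t n)) \<longlonglongrightarrow> cadj Z"
    using continuous_on_tendsto_compose[OF continuous_on_cadj[of UNIV] Z] by simp
  have "(\<lambda>n. (x n - mat 1) /\<^sub>R t n ** cadj (x n) + cadj ((x n - mat 1) /\<^sub>R t n))
      \<longlonglongrightarrow> Z ** cadj (mat 1) + cadj Z"
    using continuous_on_tendsto_compose[OF continuous_on_cadj[of UNIV] x1]
    by (intro tendsto_add mmult.tendsto Z cZ) simp
  moreover have "(x n - mat 1) /\<^sub>R t n ** cadj (x n) + cadj ((x n - mat 1) /\<^sub>R t n) = 0" for n
  proof -
    have c1: "cadj (mat 1 :: complex^('m + 'm)^('m + 'm)) = mat 1" by (simp add: vec_eq_iff mat_def)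
    have "x n ** cadj (x n) = mat 1" using K0_unitary[OF x[of n]] by (simp add: unitary_def)
    then show ?thesis
      by (simp add: mmult.scaleR_left mmult.diff_left linear_scale[OF linear_cadj]
          linear_diff[OF linear_cadj] c1 scaleR_diff_right)
  qed
  ultimately have "Z ** cadj (mat 1) + cadj Z = 0" by (simp add: LIMSEQ_const_iff)
  moreover have c1: "cadj (mat 1 :: complex^('m + 'm)^('m + 'm)) = mat 1" by (simp add: vec_eq_iff mat_def)
  ultimately have "cadj Z = - Z" by (simp add: add_eq_0_iff)
  then show "Z \<in> k0" using Zq by (simp add: k0_def)
qed

text \<open>A rational substitute for the exponential: it takes skew-Hermitian matrices to unitary
  ones, and it stays in any unital algebra of matrices closed under inverses, such as
  \<open>quat_linear\<close> or a flag algebra.\<close>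

definition cayley :: "complex^'n^'n \<Rightarrow> complex^'n^'n::finite" where
  "cayley X = (mat 1 + X) ** matrix_inv (mat 1 - X)"

lemma herm_cadj: "herm (X *v v) w = herm v (cadj X *v w)" for X :: "complex^'n^'n::finite"
proof -
  have "herm (X *v v) w = (\<Sum>a\<in>UNIV. \<Sum>b\<in>UNIV. X $ a $ b * v $ b * cnj (w $ a))"
    by (simp add: herm_def matrix_vector_mult_def sum_distrib_right)
  also have "\<dots> = (\<Sum>b\<in>UNIV. \<Sum>a\<in>UNIV. X $ a $ b * v $ b * cnj (w $ a))" by (rule sum.swap)
  also have "\<dots> = herm v (cadj X *v w)"
    by (simp add: herm_def matrix_vector_mult_def sum_distrib_left ac_simps)
  finally show ?thesis .
qed

text \<open>A fixed vector \<open>v\<close> of a skew-Hermitian matrix satisfies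
  \<open>herm v v = - herm v v\<close>.\<close>

lemma skew_invertible:
  fixes X :: "complex^'n^'n::finite"
  assumes "cadj X = - X"
  shows "invertible (mat 1 - X)"
proof -
  have "v = 0" if v: "(mat 1 - X) *v v = 0" for v
  proof -
    have Xv: "X *v v = v" using v by (simp add: matrix_vector_mult_diff_rdistrib)
    have "(- X) *v v = - v" using Xv
      by (simp add: vec_eq_iff matrix_vector_mult_def sum_negf)
    then have "herm v v = herm v (- v)" using herm_cadj[of X v v] assms Xv by simp
    also have "\<dots> = - herm v v" by (simp add: herm_def sum_negf)
    finally have "herm v v = 0" by simp
    then show ?thesis by (simp add: herm_self)
  qed
  then have "inj ((*v) (mat 1 - X))" using vec.inj_iff_eq_0 by blast
  then show ?thesis
    using matrix_left_invertible_injective invertible_left_inverse by blast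
qed

lemma cayley_mult:
  assumes "cadj X = - X"
  shows "cayley X ** (mat 1 - X) = mat 1 + X"
  unfolding cayley_def by (rule mult_matrix_inv_cancel(4)[OF skew_invertible[OF assms]])

lemma cayley_unique:
  assumes "cadj X = - X" "W ** (mat 1 - X) = mat 1 + X"
  shows "W = cayley X"
  unfolding cayley_def assms(2)[symmetric]
  by (rule mult_matrix_inv_cancel(3)[OF skew_invertible[OF assms(1)], symmetric])

lemma cayley_unitary:
  fixes X :: "complex^'n^'n::finite"
  assumes X: "cadj X = - X"
  shows "cayley X \<in> unitary"
proof -
  let ?A = "mat 1 - X" and ?B = "mat 1 + X"
  have c1: "cadj (mat 1 :: complex^'n^'n) = mat 1" by (simp add: vec_eq_iff mat_def)
  have cA: "cadj ?A = ?B" and cB: "cadj ?B = ?A"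
    by (simp_all add: linear_diff[OF linear_cadj] linear_add[OF linear_cadj] c1 X)
  have invA: "invertible ?A" by (rule skew_invertible[OF X])
  have "cadj (- X) = - (- X)" by (simp add: linear_neg[OF linear_cadj] X)
  from skew_invertible[OF this] have invB: "invertible ?B" by simp
  have comm: "?A ** ?B = ?B ** ?A"
    by (simp add: mmult.add_left mmult.add_right mmult.diff_left mmult.diff_right)
  have "cadj (cayley X ** ?A) ** (cayley X ** ?A) = cadj ?B ** ?B" by (simp add: cayley_mult[OF X])
  \<comment> \<open>The matrices \<open>?A\<close> and \<open>?B\<close> are adjoint to each other
    and commute, so both cancel and leave the unitarity relation.\<close>
  then have "?B ** (cadj (cayley X) ** cayley X) ** ?A = ?B ** ?A"
    by (simp add: cadj_mult cA cB comm matrix_mul_assoc)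
  then have "matrix_inv ?B ** (?B ** (cadj (cayley X) ** cayley X) ** ?A) ** matrix_inv ?A
      = matrix_inv ?B ** (?B ** mat 1 ** ?A) ** matrix_inv ?A" by simp
  then have "cadj (cayley X) ** cayley X = mat 1"
    unfolding invertible_left_mult_linear(3)[OF invB invA] .
  then show ?thesis unfolding unitary_def using matrix_left_right_inverse by blast
qed

text \<open>Numerator and denominator are adjoint, so their determinants are complex conjugates;
  both are real by \<open>det_quat_linear_real\<close>, hence equal.\<close>

lemma cayley_K0:
  assumes X: "X \<in> k0"
  shows "cayley X \<in> K0"
proof -
  have sk: "cadj X = - X" and q: "X \<in> quat_linear" using X by (simp_all add: k0_def)
  have invA: "invertible (mat 1 - X)" by (rule skew_invertible[OF sk])
  have qA: "mat 1 - X \<in> quat_linear" "mat 1 + X \<in> quat_linear"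
    using q quat_linear_one subspace_quat_linear by (auto intro: subspace_diff subspace_add)
  have c1: "cadj (mat 1 :: complex^('a + 'a)^('a + 'a)) = mat 1" by (simp add: vec_eq_iff mat_def)
  have "cadj (mat 1 - X) = mat 1 + X" by (simp add: linear_diff[OF linear_cadj] c1 sk)
  then have "det (mat 1 + X) = det (mat 1 - X)"
    using det_cadj[of "mat 1 - X"] det_quat_linear_real[OF qA(1)] by simp
  moreover have "det (cayley X) * det (mat 1 - X) = det (mat 1 + X)"
    using cayley_mult[OF sk] det_mul by metis
  ultimately have "det (cayley X) = 1" using invA by (simp add: invertible_det_nz)
  moreover have "cayley X \<in> quat_linear" unfolding cayley_def
    using qA quat_linear_inverse[OF qA(1) matrix_inv_mult(1)[OF invA]] by (simp add: quat_linear_mult)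
  ultimately show ?thesis using cayley_unitary[OF sk] by (simp add: K0_eq)
qed

lemma cayley_curve:
  fixes X :: "complex^'n^'n::finite"
  assumes X: "cadj X = - X"
  shows "((\<lambda>s::real. (cayley ((s / 2) *\<^sub>R X) - mat 1) /\<^sub>R s) \<longlongrightarrow> X) (at_right 0)"
proof -
  \<comment> \<open>The Cayley transform has derivative \<open>2 * X\<close> at 0, whence the
    half.\<close>
  define c where "c s = cayley ((s / 2) *\<^sub>R X)" for s :: real
  have sk: "cadj ((s / 2) *\<^sub>R X) = - ((s / 2) *\<^sub>R X)" for s :: real
    by (simp add: linear_scale[OF linear_cadj] X)
  have cu: "c s \<in> unitary" for s unfolding c_def by (rule cayley_unitary[OF sk])
  \<comment> \<open>This relation avoids differentiating an inverse: boundedness of unitary matrices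
    first gives that \<open>c\<close> tends to the identity, and then the limit of the
    secants.\<close>
  have eq: "c s - mat 1 = (s / 2) *\<^sub>R (X + c s ** X)" for s
    using cayley_mult[OF sk[of s]]
    by (simp add: c_def[symmetric] mmult.diff_right mmult.scaleR_right algebra_simps)
  obtain b where b: "\<And>u :: complex^'n^'n. u \<in> unitary \<Longrightarrow> norm u \<le> b"
    using compact_imp_bounded[OF compact_unitary] unfolding bounded_iff by auto
  obtain M where M: "M > 0"
    "\<And>(u :: complex^'n^'n) (v :: complex^'n^'n). norm (u ** v) \<le> norm u * norm v * M"
    using mmult.pos_bounded by blast
  define q where "q = (norm X + b * norm X * M) / 2"
  have "norm (c s - mat 1) \<le> \<bar>s\<bar> * q" for s
  proof -
    have "norm (X + c s ** X) \<le> norm X + norm (c s) * norm X * M"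
      using norm_triangle_ineq[of X "c s ** X"] M(2)[of "c s" X] by linarith
    also have "\<dots> \<le> norm X + b * norm X * M"
      using b[OF cu[of s]] M(1) by (intro add_left_mono mult_right_mono) auto
    also have "\<dots> = 2 * q" by (simp add: q_def)
    finally have "\<bar>s / 2\<bar> * norm (X + c s ** X) \<le> \<bar>s / 2\<bar> * (2 * q)"
      by (rule mult_left_mono) simp
    then show ?thesis by (simp add: eq)
  qed
  moreover have "((\<lambda>s::real. \<bar>s\<bar> * q) \<longlongrightarrow> \<bar>0\<bar> * q) (at_right 0)" by (intro tendsto_intros)
  ultimately have "((\<lambda>s. c s - mat 1) \<longlongrightarrow> 0) (at_right 0)"
    by (intro Lim_null_comparison[OF always_eventually, of "\<lambda>s. c s - mat 1" "\<lambda>s. \<bar>s\<bar> * q"]) simp_all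
  then have c1: "(c \<longlongrightarrow> mat 1) (at_right 0)" by (simp add: LIM_zero_iff)
  have "((\<lambda>s. (1 / 2) *\<^sub>R (X + c s ** X)) \<longlongrightarrow> (1 / 2) *\<^sub>R (X + mat 1 ** X)) (at_right 0)"
    by (intro tendsto_intros mmult.tendsto c1)
  moreover have "(1 / 2) *\<^sub>R (X + mat 1 ** X) = X" by (simp flip: scaleR_2)
  moreover have "\<forall>\<^sub>F s in at_right 0. (1 / 2) *\<^sub>R (X + c s ** X) = (c s - mat 1) /\<^sub>R s"
    unfolding eventually_at_right_field by (auto simp: eq intro!: exI[of _ 1])
  ultimately have "((\<lambda>s. (c s - mat 1) /\<^sub>R s) \<longlongrightarrow> X) (at_right 0)"
    using Lim_transform_eventually[of "\<lambda>s. (1 / 2) *\<^sub>R (X + c s ** X)" X "at_right 0"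
        "\<lambda>s. (c s - mat 1) /\<^sub>R s"] by simp
  then show ?thesis by (simp only: c_def)
qed

section \<open>Orbits of the compact group that are complex submanifolds\<close>

text \<open>A matrix takes \<open>V\<close> into the orbit exactly if it is an element of
  \<open>K0\<close> times an invertible element of the flag algebra, so
  \<open>tangent_cone_compact_mult\<close> applies.\<close>

lemma tangent_cone_K0_orbit:
  assumes V: "\<And>U. U \<in> set V \<Longrightarrow> vec.subspace U"
  shows "tangent_cone (preimage_flags V (orbit K0 V)) (mat 1) = {X + Y | X Y. X \<in> k0 \<and> Y \<in> flag_algebra V}"
proof -
  have "preimage_flags V (orbit K0 V) = {k ** s | k s. k \<in> K0 \<and> s \<in> flag_algebra V \<and> invertible s}"
  proof (intro equalityI subsetI)
    fix g assume "g \<in> preimage_flags V (orbit K0 V)"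
    then obtain k where k: "k \<in> K0" "act g V = act k V" "invertible g"
      by (auto simp: preimage_flags_def orbit_def)
    have ik: "invertible (cadj k)" by (rule K0_invertible[OF K0_cadj[OF k(1)]])
    have "cadj k ** k = mat 1" by (rule unitary_cadj(2)[OF K0_unitary[OF k(1)]])
    then have "act (cadj k ** g) V = V" using k(2) by (simp flip: act_act) (simp add: act_act)
    then have "cadj k ** g \<in> flag_algebra V" using act_eq_iff[OF V invertible_mult[OF ik k(3)]] by blast
    moreover have "g = k ** (cadj k ** g)"
      using K0_unitary[OF k(1)] by (simp add: matrix_mul_assoc unitary_def)
    ultimately show "g \<in> {k ** s | k s. k \<in> K0 \<and> s \<in> flag_algebra V \<and> invertible s}"
      using k(1) invertible_mult[OF ik k(3)] by blast
  next
    fix g assume "g \<in> {k ** s | k s. k \<in> K0 \<and> s \<in> flag_algebra V \<and> invertible s}"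
    then obtain k s where ks: "g = k ** s" "k \<in> K0" "s \<in> flag_algebra V" "invertible s" by blast
    have "act s V = V" using act_eq_iff[OF V ks(4)] ks(3) by blast
    then have "act g V = act k V" by (simp add: ks(1) flip: act_act)
    then show "g \<in> preimage_flags V (orbit K0 V)"
      using ks invertible_mult[OF K0_invertible] by (auto simp: preimage_flags_def orbit_def)
  qed
  moreover have "tangent_cone {k ** s | k s. k \<in> K0 \<and> s \<in> flag_algebra V \<and> invertible s} (mat 1)
      = {X + Y | X Y. X \<in> k0 \<and> Y \<in> flag_algebra V}"
  proof (rule tangent_cone_compact_mult[OF compact_K0 K0_one K0_mult _ subspace_k0 tangent_cone_K0 _
        subspace_flag_algebra[OF V] flag_algebra_one flag_algebra_mult flag_algebra_inverse[OF V]])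
    show "\<exists>y\<in>K0. x ** y = mat 1" if "x \<in> K0" for x :: "complex^('a + 'a)^('a + 'a)"
      using K0_cadj[OF that] K0_unitary[OF that] by (auto simp: unitary_def)
    fix X :: "complex^('a + 'a)^('a + 'a)" assume X: "X \<in> k0"
    have sX: "(s / 2) *\<^sub>R X \<in> k0" for s :: real using X subspace_k0 by (rule subspace_scale[rotated])
    have sk: "cadj X = - X" "cadj ((s / 2) *\<^sub>R X) = - ((s / 2) *\<^sub>R X)" for s :: real
      using X sX[of s] by (simp_all add: k0_def)
    \<comment> \<open>If \<open>X\<close> stabilizes the flag infinitesimally, the whole Cayley
      curve stays in the flag algebra, which is closed under products and inverses.\<close>
    have "cayley ((s / 2) *\<^sub>R X) \<in> flag_algebra V" if "X \<in> flag_algebra V" for s :: real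
    proof -
      have sV: "(s / 2) *\<^sub>R X \<in> flag_algebra V"
        using that subspace_flag_algebra[OF V] by (intro subspace_scale) auto
      have "mat 1 - (s / 2) *\<^sub>R X \<in> flag_algebra V" "mat 1 + (s / 2) *\<^sub>R X \<in> flag_algebra V"
        using sV flag_algebra_one subspace_flag_algebra[OF V] by (auto intro: subspace_diff subspace_add)
      then show ?thesis unfolding cayley_def
        using flag_algebra_mult flag_algebra_inverse[OF V] matrix_inv_mult(1)[OF skew_invertible[OF sk(2)]]
        by metis
    qed
    then show "\<exists>c. (\<forall>s>0. c s \<in> K0 \<and> (X \<in> flag_algebra V \<longrightarrow> c s \<in> flag_algebra V)) \<and>
        ((\<lambda>s::real. (c s - mat 1) /\<^sub>R s) \<longlongrightarrow> X) (at_right 0)"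
      using cayley_K0[OF sX] cayley_curve[OF sk(1)]
      by (intro exI[of _ "\<lambda>s. cayley ((s / 2) *\<^sub>R X)"]) simp
  qed
  ultimately show ?thesis by simp
qed

lemma self_in_K0_orbit: "V \<in> orbit K0 V"
  unfolding orbit_def using K0_one by (metis act_one image_eqI)

lemma act_K0_orbit:
  assumes u: "u \<in> K0"
  shows "act u ` orbit K0 V = orbit K0 V"
proof (intro equalityI subsetI)
  fix W assume "W \<in> act u ` orbit K0 V"
  then show "W \<in> orbit K0 V" using K0_mult[OF u] by (auto simp: orbit_def act_act)
next
  fix W assume "W \<in> orbit K0 V"
  then obtain k where k: "k \<in> K0" "W = act k V" by (auto simp: orbit_def)
  have "u ** (cadj u ** k) = k" using K0_unitary[OF u] by (simp add: matrix_mul_assoc unitary_def)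
  then have "W = act u (act (cadj u ** k) V)" by (simp add: act_act k(2))
  moreover have "act (cadj u ** k) V \<in> orbit K0 V"
    using K0_mult[OF K0_cadj[OF u] k(1)] by (auto simp: orbit_def)
  ultimately show "W \<in> act u ` orbit K0 V" by blast
qed

lemma orbit_K0_eq:
  assumes "W \<in> orbit K0 V"
  shows "orbit K0 W = orbit K0 V"
proof -
  obtain u where u: "u \<in> K0" "W = act u V" using assms by (auto simp: orbit_def)
  have "V = act (cadj u) W"
    using unitary_cadj(2)[OF K0_unitary[OF u(1)]] by (simp add: u(2) act_act)
  then have "orbit K0 V \<subseteq> orbit K0 W" using K0_mult[OF _ K0_cadj[OF u(1)]] by (auto simp: orbit_def act_act)
  moreover have "orbit K0 W \<subseteq> orbit K0 V" using K0_mult[OF _ u(1)] by (auto simp: orbit_def act_act u(2))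
  ultimately show ?thesis by blast
qed

text \<open>The first claim is stability under \<open>\<i>\<close> of the cone, \<open>k0\<close>
  plus the flag algebra. The second compares the dimension of this sum with that of the preimage;
  the dimension of the flag algebra cancels.\<close>

lemma complex_K0_orbit:
  fixes V :: "('m::finite + 'm) flag"
  assumes V: "V \<in> flag_manifold c" and C: "complex_submanifold (orbit K0 V)"
  shows "\<And>X. X \<in> k0 \<Longrightarrow> \<exists>X'\<in>k0. X' + map_matrix ((*) \<i>) X \<in> flag_algebra V"
    and "2 * analytic_dim (orbit K0 V) + dim (k0 \<inter> flag_algebra V)
      = dim (k0 :: (complex^('m + 'm)^('m + 'm)) set)"
proof -
  have s: "\<And>U. U \<in> set V \<Longrightarrow> vec.subspace U" by (rule flag_manifold_subspace[OF V])
  obtain k where k: "submanifold_at k (orbit K0 V) V"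
    using C self_in_K0_orbit unfolding complex_submanifold_def by blast
  have TC: "tangent_cone (preimage_flags V (orbit K0 V)) (mat 1)
      = {X + Y | X Y. X \<in> k0 \<and> Y \<in> flag_algebra V}" by (rule tangent_cone_K0_orbit[OF s])
  note T = submanifold_at_tangent_cone[OF k]
  have \<sigma>: "subspace (flag_algebra V)" by (rule subspace_flag_algebra[OF s])
  show "\<exists>X'\<in>k0. X' + map_matrix ((*) \<i>) X \<in> flag_algebra V" if X: "X \<in> k0" for X
  proof -
    have "X + 0 \<in> {X + Y | X Y. X \<in> k0 \<and> Y \<in> flag_algebra V}" using X subspace_0[OF \<sigma>] by blast
    then have "X \<in> tangent_cone (preimage_flags V (orbit K0 V)) (mat 1)" unfolding TC by simp
    from T(4)[OF this] obtain X' Y where XY: "map_matrix ((*) \<i>) X = X' + Y" "X' \<in> k0"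
        "Y \<in> flag_algebra V" unfolding TC by blast
    then have "- X' + map_matrix ((*) \<i>) X = Y" "- X' \<in> k0" using subspace_k0 by (auto intro: subspace_neg)
    then show ?thesis using XY(3) by metis
  qed
  have "j = k" if j: "submanifold_at j (orbit K0 V) W" for j W
  proof -
    obtain u where u: "u \<in> K0" "W = act u V"
      using submanifold_at_tangent_cone(1)[OF j] by (auto simp: orbit_def)
    show ?thesis
      using submanifold_at_unique_homogeneous[OF k j K0_invertible[OF u(1)] u(2) act_K0_orbit[OF u(1)]] by simp
  qed
  then have "{j. \<exists>W. submanifold_at j (orbit K0 V) W} = {k}" using k by blast
  then have "analytic_dim (orbit K0 V) = k" by (simp add: analytic_dim_def)
  then show "2 * analytic_dim (orbit K0 V) + dim (k0 \<inter> flag_algebra V)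
      = dim (k0 :: (complex^('m + 'm)^('m + 'm)) set)"
    using T(3) dim_sums_Int[OF subspace_k0 \<sigma>] unfolding TC by simp
qed

section \<open>Maxima of a height function on a \<open>K0\<close>-orbit\<close>

definition height :: "nat list \<Rightarrow> ('n \<Rightarrow> nat) \<Rightarrow> 'n \<Rightarrow> nat" where
  "height c q b = card {i. i < length c \<and> q b < psum c (Suc i)}"

lemma height_mono:
  assumes "q b \<le> q a"
  shows "height c q a \<le> height c q b"
  unfolding height_def using assms by (intro card_mono) auto

lemma later_iff_height: "(a, b) \<in> later c q \<longleftrightarrow> height c q a < height c q b"
proof
  assume "(a, b) \<in> later c q"
  then obtain i where i: "i < length c" "q b < psum c (Suc i)" "psum c (Suc i) \<le> q a"
    by (auto simp: later_def)
  let ?A = "\<lambda>a. {i. i < length c \<and> q a < psum c (Suc i)}"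
  have "?A a \<subseteq> ?A b" using i by auto
  moreover have "i \<in> ?A b" "i \<notin> ?A a" using i by auto
  ultimately have "?A a \<subset> ?A b" by blast
  then show "height c q a < height c q b" unfolding height_def by (intro psubset_card_mono) simp
next
  assume "height c q a < height c q b"
  have "\<not> {i. i < length c \<and> q b < psum c (Suc i)} \<subseteq> {i. i < length c \<and> q a < psum c (Suc i)}"
  proof
    assume "{i. i < length c \<and> q b < psum c (Suc i)} \<subseteq> {i. i < length c \<and> q a < psum c (Suc i)}"
    then have "height c q b \<le> height c q a" unfolding height_def by (intro card_mono) simp_all
    then show False using \<open>height c q a < height c q b\<close> by simp
  qed
  then show "(a, b) \<in> later c q" by (auto simp: later_def not_less)
qed

text \<open>The trace of \<open>diag w ** x ** diag \<mu> ** cadj x\<close>. For \<mu> given by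
  \<open>height\<close>, which counts the members of the coordinate flag containing a basis vector,
  and for unitary \<open>x\<close>, the last three factors form the sum of the orthogonal
  projections onto the members of the moved flag.\<close>

definition energy :: "('n \<Rightarrow> real) \<Rightarrow> ('n \<Rightarrow> real) \<Rightarrow> complex^'n^'n::finite \<Rightarrow> real" where
  "energy w \<mu> x = (\<Sum>a\<in>UNIV. \<Sum>b\<in>UNIV. w a * \<mu> b * (x $ a $ b \<bullet> x $ a $ b))"

lemma energy_derivative:
  fixes x :: "complex^'n^'n::finite"
  shows "(energy w \<mu> has_derivative (\<lambda>y. \<Sum>a\<in>UNIV. \<Sum>b\<in>UNIV. w a * \<mu> b * (2 * (x $ a $ b \<bullet> y $ a $ b)))) (at x)"
proof -
  have bl: "bounded_linear (\<lambda>y :: complex^'n^'n. y $ a $ b)" for a b :: 'n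
    by (intro bounded_linear_compose[OF bounded_linear_vec_nth] bounded_linear_vec_nth)
  have "((\<lambda>x :: complex^'n^'n. x $ a $ b \<bullet> x $ a $ b) has_derivative
      (\<lambda>y. x $ a $ b \<bullet> y $ a $ b + y $ a $ b \<bullet> x $ a $ b)) (at x)" for a b
    by (intro has_derivative_inner bounded_linear_imp_has_derivative[OF bl])
  then have "((\<lambda>x :: complex^'n^'n. x $ a $ b \<bullet> x $ a $ b) has_derivative
      (\<lambda>y. 2 * (x $ a $ b \<bullet> y $ a $ b))) (at x)" for a b
    by (simp add: inner_commute)
  then show ?thesis
    unfolding energy_def[abs_def]
    by (intro has_derivative_sum has_derivative_mult_right)
qed

lemma k0_tangent_cone: "X \<in> k0 \<Longrightarrow> X \<in> tangent_cone K0 (mat 1)"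
proof -
  assume X: "X \<in> k0"
  have t0: "(\<lambda>n. inverse (real (Suc n))) \<longlonglongrightarrow> 0" by (rule LIMSEQ_inverse_real_of_nat)
  then have "filterlim (\<lambda>n. inverse (real (Suc n))) (at_right 0) sequentially"
    by (intro tendsto_imp_filterlim_at_right) simp_all
  moreover have "cadj X = - X" using X by (simp add: k0_def)
  ultimately have "(\<lambda>n. (cayley ((inverse (real (Suc n)) / 2) *\<^sub>R X) - mat 1) /\<^sub>R inverse (real (Suc n)))
      \<longlonglongrightarrow> X" using filterlim_compose[OF cayley_curve] by blast
  moreover have "cayley ((inverse (real (Suc n)) / 2) *\<^sub>R X) \<in> K0" for n
    by (intro cayley_K0 subspace_scale[OF subspace_k0 X])
  ultimately show ?thesis
    using t0 by (intro tangent_coneI[where t = "\<lambda>n. inverse (real (Suc n))"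
          and x = "\<lambda>n. cayley ((inverse (real (Suc n)) / 2) *\<^sub>R X)"]) simp_all
qed

text \<open>At a maximum the derivative along any direction of \<open>k0\<close> is nonpositive;
  \<open>k0\<close> is a linear space, so \<open>- X\<close> gives the reverse inequality.\<close>

lemma energy_stationary:
  fixes x :: "complex^('m + 'm)^('m::finite + 'm)"
  assumes max: "\<And>k. k \<in> K0 \<Longrightarrow> energy w \<mu> (k ** x) \<le> energy w \<mu> x" and X: "X \<in> k0"
  shows "(\<Sum>a\<in>UNIV. \<Sum>b\<in>UNIV. w a * \<mu> b * (x $ a $ b \<bullet> (X ** x) $ a $ b)) = 0"
proof -
  define S where "S Y = (\<Sum>a\<in>UNIV. \<Sum>b\<in>UNIV. w a * \<mu> b * (x $ a $ b \<bullet> (Y ** x) $ a $ b))" for Y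
  have le: "S Y \<le> 0" if Y: "Y \<in> k0" for Y
  proof -
    have bl: "bounded_linear (\<lambda>k :: complex^('m + 'm)^('m + 'm). k ** x)" by (rule mmult.bounded_linear_left)
    have "Y ** x \<in> tangent_cone ((\<lambda>k. k ** x) ` K0) x"
      using tangent_cone_image_subset[OF bl, of K0 "mat 1"] k0_tangent_cone[OF Y] by auto
    then obtain y t where y: "\<And>n. y n \<in> (\<lambda>k. k ** x) ` K0" and t: "\<And>n. t n > 0" "t \<longlonglongrightarrow> 0"
      and lim: "(\<lambda>n. (y n - x) /\<^sub>R t n) \<longlonglongrightarrow> Y ** x" by (rule tangent_coneE) blast
    from tangent_cone_seq[OF energy_derivative t lim, of w \<mu>]
    have "(\<lambda>n. (energy w \<mu> (y n) - energy w \<mu> x) /\<^sub>R t n)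
       \<longlonglongrightarrow> (\<Sum>a\<in>UNIV. \<Sum>b\<in>UNIV. w a * \<mu> b * (2 * (x $ a $ b \<bullet> (Y ** x) $ a $ b)))" .
    moreover have "(energy w \<mu> (y n) - energy w \<mu> x) /\<^sub>R t n \<le> 0" for n
      using y[of n] max t(1)[of n] by (auto simp: mult_nonneg_nonpos)
    ultimately have "(\<Sum>a\<in>UNIV. \<Sum>b\<in>UNIV. w a * \<mu> b * (2 * (x $ a $ b \<bullet> (Y ** x) $ a $ b))) \<le> 0"
      by (intro LIMSEQ_le_const2) auto
    moreover have "(\<Sum>a\<in>UNIV. \<Sum>b\<in>UNIV. w a * \<mu> b * (2 * (x $ a $ b \<bullet> (Y ** x) $ a $ b))) = 2 * S Y"
      by (simp add: S_def sum_distrib_left ac_simps)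
    ultimately show ?thesis by simp
  qed
  have "S (- X) = - S X" by (simp add: S_def mmult.minus_left sum_negf)
  then show ?thesis
    using le[OF X] le[OF subspace_neg[OF subspace_k0 X]] by (simp add: S_def)
qed

definition diag :: "('n \<Rightarrow> real) \<Rightarrow> complex^'n^'n::finite" where
  "diag w = (\<chi> a b. if a = b then of_real (w a) else 0)"

lemma diag_mult: "(diag w ** X) $ a $ b = of_real (w a) * X $ a $ b"
  by (simp add: diag_def matrix_matrix_mult_def if_distrib[of "\<lambda>x. x * _"] cong: if_cong)

lemma mult_diag: "(X ** diag w) $ a $ b = X $ a $ b * of_real (w b)"
  by (simp add: diag_def matrix_matrix_mult_def if_distrib[of "(*) _"] cong: if_cong)

text \<open>Rewrites the stationarity condition in the frame \<open>x\<close>, where the moved flag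
  becomes a coordinate flag and its flag algebra a matrix pattern.\<close>

lemma trace_pairing:
  fixes x X :: "complex^'n^'n::finite" and w \<mu> :: "'n \<Rightarrow> real"
  assumes x: "x \<in> unitary"
  defines "A \<equiv> cadj x ** diag w ** x" and "X' \<equiv> cadj x ** X ** x"
  shows "(\<Sum>a\<in>UNIV. \<Sum>b\<in>UNIV. w a * \<mu> b * (x $ a $ b \<bullet> (X ** x) $ a $ b))
    = (\<Sum>b\<in>UNIV. \<Sum>c\<in>UNIV. \<mu> b * Re (A $ b $ c * X' $ c $ b))"
proof -
  have xx: "x ** cadj x = mat 1" using x by (simp add: unitary_def)
  have "A ** X' = cadj x ** diag w ** (x ** cadj x) ** X ** x"
    by (simp only: A_def X'_def matrix_mul_assoc)
  then have AX: "A ** X' = cadj x ** (diag w ** (X ** x))" by (simp add: xx matrix_mul_assoc)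
  have "(\<Sum>c\<in>UNIV. \<mu> b * Re (A $ b $ c * X' $ c $ b))
      = (\<Sum>a\<in>UNIV. w a * \<mu> b * (x $ a $ b \<bullet> (X ** x) $ a $ b))" for b
  proof -
    have "(\<Sum>c\<in>UNIV. \<mu> b * Re (A $ b $ c * X' $ c $ b)) = \<mu> b * Re ((A ** X') $ b $ b)"
      by (simp add: matrix_matrix_mult_def sum_distrib_left Re_sum)
    also have "(A ** X') $ b $ b = (\<Sum>a\<in>UNIV. cnj (x $ a $ b) * (of_real (w a) * (X ** x) $ a $ b))"
      unfolding AX matrix_matrix_mult_def[of "cadj x"] by (simp add: diag_mult)
    also have "\<mu> b * Re \<dots> = (\<Sum>a\<in>UNIV. w a * \<mu> b * (x $ a $ b \<bullet> (X ** x) $ a $ b))"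
      unfolding Re_sum sum_distrib_left
      by (intro sum.cong refl) (simp add: inner_complex_def algebra_simps)
    finally show ?thesis .
  qed
  then have "(\<Sum>b\<in>UNIV. \<Sum>c\<in>UNIV. \<mu> b * Re (A $ b $ c * X' $ c $ b))
      = (\<Sum>b\<in>UNIV. \<Sum>a\<in>UNIV. w a * \<mu> b * (x $ a $ b \<bullet> (X ** x) $ a $ b))" by simp
  also have "\<dots> = (\<Sum>a\<in>UNIV. \<Sum>b\<in>UNIV. w a * \<mu> b * (x $ a $ b \<bullet> (X ** x) $ a $ b))"
    by (rule sum.swap)
  finally show ?thesis by simp
qed

text \<open>Both pairs \<open>(b, c)\<close> and \<open>(c, b)\<close> contribute a nonpositive multiple of
  \<open>\<bar>A\<^sub>b\<^sub>c\<bar>\<^sup>2\<close> to the vanishing sum.\<close>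

lemma trace_pairing_zero:
  fixes A X :: "complex^'n^'n::finite" and \<mu> :: "'n \<Rightarrow> real"
  assumes A: "cadj A = A" and X: "cadj X = - X"
    and AX: "\<And>b c. \<mu> b < \<mu> c \<Longrightarrow> X $ b $ c = - A $ b $ c"
    and sum: "(\<Sum>b\<in>UNIV. \<Sum>c\<in>UNIV. \<mu> b * Re (A $ b $ c * X $ c $ b)) = 0"
    and bc: "\<mu> b \<noteq> \<mu> c"
  shows "A $ b $ c = 0"
proof -
  have A': "A $ c $ b = cnj (A $ b $ c)" for b c using A by (metis cadj_nth)
  have X': "X $ c $ b = - cnj (X $ b $ c)" for b c
  proof -
    have "cnj (X $ b $ c) = (- X) $ c $ b" using X by (metis cadj_nth)
    then show ?thesis by simp
  qed
  have Re_mult_cnj: "Re (z * cnj z) = (cmod z)\<^sup>2" for z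
    by (metis complex_norm_square Re_complex_of_real)
  define t where "t b c = \<mu> b * Re (A $ b $ c * X $ c $ b)" for b c
  define s where "s b c = - (t b c + t c b)" for b c
  have ts: "t b c + t c b = (\<mu> b - \<mu> c) * Re (A $ b $ c * X $ c $ b)" for b c
    unfolding t_def using A'[of b c] X'[of c b] by (simp add: algebra_simps)
  have s: "s b c = \<bar>\<mu> b - \<mu> c\<bar> * (cmod (A $ b $ c))\<^sup>2" for b c
  proof -
    consider "\<mu> b < \<mu> c" | "\<mu> b = \<mu> c" | "\<mu> c < \<mu> b" by linarith
    then show ?thesis
    proof cases
      case 1
      then have "X $ c $ b = cnj (A $ b $ c)" using X'[of c b] AX[OF 1] by simp
      then have R: "Re (A $ b $ c * X $ c $ b) = (cmod (A $ b $ c))\<^sup>2" by (simp only: Re_mult_cnj)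
      show ?thesis unfolding s_def ts R using 1 by (simp add: abs_if algebra_simps)
    next
      case 3
      then have "X $ c $ b = - cnj (A $ b $ c)" using AX[OF 3] A'[of b c] by simp
      then have R: "Re (A $ b $ c * X $ c $ b) = - (cmod (A $ b $ c))\<^sup>2"
        by (simp only: mult_minus_right uminus_complex.sel Re_mult_cnj)
      show ?thesis unfolding s_def ts R using 3 by (simp add: abs_if algebra_simps)
    qed (simp add: s_def ts)
  qed
  have "(\<Sum>b\<in>UNIV. \<Sum>c\<in>UNIV. t c b) = (\<Sum>b\<in>UNIV. \<Sum>c\<in>UNIV. t b c)" by (rule sum.swap)
  then have "(\<Sum>b\<in>UNIV. \<Sum>c\<in>UNIV. s b c) = 0"
    using sum[folded t_def] by (simp add: s_def sum_negf sum.distrib sum_subtractf)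
  moreover have nn: "s b c \<ge> 0" for b c by (simp add: s)
  ultimately have "(\<Sum>c\<in>UNIV. s b c) = 0"
    using sum_nonneg_eq_0_iff[of UNIV "\<lambda>b. \<Sum>c\<in>UNIV. s b c"] by (simp add: sum_nonneg)
  then have "s b c = 0" using nn sum_nonneg_eq_0_iff[of UNIV "s b"] by simp
  then show ?thesis using bc by (simp add: s)
qed

text \<open>The hypothesis says that \<open>cadj x ** diag w ** x\<close> commutes with
  \<open>diag \<mu>\<close>. Then \<open>H\<close> commutes with \<open>diag w\<close>, whose
  entries are distinct, so \<open>H\<close> is diagonal; its entries \<nu> are matched to \<mu>
  through \<open>H ** x = x ** diag \<mu>\<close>.\<close>

lemma unitary_diagonal:
  fixes x :: "complex^'n^'n::finite"
  assumes x: "x \<in> unitary" and w: "inj w"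
    and A: "\<And>b c. \<mu> b \<noteq> \<mu> c \<Longrightarrow> (cadj x ** diag w ** x) $ b $ c = 0"
  obtains \<nu> where "\<And>a b. x $ a $ b \<noteq> 0 \<Longrightarrow> \<nu> a = \<mu> b"
    "\<And>a. \<nu> a = (\<Sum>b\<in>UNIV. \<mu> b * (x $ a $ b \<bullet> x $ a $ b))"
proof -
  define H where "H = x ** diag \<mu> ** cadj x"
  let ?A = "cadj x ** diag w ** x"
  have xx: "x ** cadj x = mat 1" and xx': "cadj x ** x = mat 1"
    using x unitary_cadj by (auto simp: unitary_def)
  have comm: "?A ** diag \<mu> = diag \<mu> ** ?A"
  proof -
    have "(?A ** diag \<mu>) $ b $ c = (diag \<mu> ** ?A) $ b $ c" for b c
      unfolding mult_diag diag_mult using A[of b c] by (cases "\<mu> b = \<mu> c") auto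
    then show ?thesis by (simp add: vec_eq_iff)
  qed
  have "diag w ** H = (x ** cadj x) ** diag w ** H" by (simp add: xx)
  also have "\<dots> = x ** (?A ** diag \<mu>) ** cadj x" by (simp only: H_def matrix_mul_assoc)
  also have "\<dots> = H ** diag w ** (x ** cadj x)" unfolding comm by (simp only: H_def matrix_mul_assoc)
  finally have wH: "diag w ** H = H ** diag w" by (simp add: xx)
  have H0: "H $ a $ b = 0" if "a \<noteq> b" for a b
  proof -
    have "of_real (w a) * H $ a $ b = H $ a $ b * of_real (w b)"
      using arg_cong[OF wH, of "\<lambda>M. M $ a $ b"] by (simp add: diag_mult mult_diag)
    then have "(of_real (w a) - of_real (w b)) * H $ a $ b = 0" by (simp add: algebra_simps)
    moreover have "w a \<noteq> w b" using w that by (simp add: inj_eq)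
    ultimately show ?thesis by simp
  qed
  define \<nu> where "\<nu> a = (\<Sum>b\<in>UNIV. \<mu> b * (x $ a $ b \<bullet> x $ a $ b))" for a
  have Haa: "H $ a $ a = of_real (\<nu> a)" for a
  proof -
    have "H $ a $ a = (\<Sum>b\<in>UNIV. (x ** diag \<mu>) $ a $ b * cnj (x $ a $ b))"
      unfolding H_def matrix_matrix_mult_def[of _ "cadj x"] by simp
    also have "\<dots> = (\<Sum>b\<in>UNIV. of_real (\<mu> b * (x $ a $ b \<bullet> x $ a $ b)))"
      unfolding mult_diag
      by (intro sum.cong refl) (simp add: complex_eq_iff inner_complex_def algebra_simps)
    finally show ?thesis by (simp add: \<nu>_def)
  qed
  have "H ** x = x ** diag \<mu> ** (cadj x ** x)" by (simp only: H_def matrix_mul_assoc)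
  then have Hx: "H ** x = x ** diag \<mu>" by (simp add: xx')
  have "\<nu> a = \<mu> b" if "x $ a $ b \<noteq> 0" for a b
  proof -
    have "(H ** x) $ a $ b = (\<Sum>c\<in>UNIV. H $ a $ c * x $ c $ b)"
      by (simp add: matrix_matrix_mult_def)
    also have "\<dots> = (\<Sum>c\<in>UNIV. if c = a then H $ a $ a * x $ a $ b else 0)"
      by (intro sum.cong refl) (auto simp: H0)
    also have "\<dots> = of_real (\<nu> a) * x $ a $ b" by (simp add: Haa)
    finally have "x $ a $ b * of_real (\<mu> b) = of_real (\<nu> a) * x $ a $ b"
      unfolding Hx mult_diag .
    then show ?thesis using that by auto
  qed
  then show ?thesis using that \<nu>_def by blast
qed

text \<open>The swap exchanges \<open>\<alpha>\<close> with \<open>\<beta>\<close> and their twins; its generator satisfies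
  \<open>X\<^sup>3 = - X\<close>, so that \<open>1 + X + X\<^sup>2\<close> is the Cayley transform of \<open>X\<close>.\<close>

definition swap_perm :: "'m + 'm \<Rightarrow> 'm + 'm \<Rightarrow> 'm + 'm \<Rightarrow> 'm + 'm" where
  "swap_perm \<alpha> \<beta> a = (if a = \<alpha> then \<beta> else if a = \<beta> then \<alpha> else
     if a = twin \<alpha> then twin \<beta> else if a = twin \<beta> then twin \<alpha> else a)"

definition swap_sign :: "'m + 'm \<Rightarrow> 'm + 'm \<Rightarrow> 'm + 'm \<Rightarrow> complex" where
  "swap_sign \<alpha> \<beta> b = (if b = \<alpha> then 1 else if b = \<beta> then -1 else
     if b = twin \<alpha> then parity \<alpha> * parity \<beta> else if b = twin \<beta> then - parity \<alpha> * parity \<beta> else 0)"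

definition swap_generator :: "'m + 'm \<Rightarrow> 'm + 'm \<Rightarrow> complex^('m + 'm)^('m::finite + 'm)" where
  "swap_generator \<alpha> \<beta> = (\<chi> a b. if a = swap_perm \<alpha> \<beta> b then swap_sign \<alpha> \<beta> b else 0)"

lemma parity_cases: "parity a = 1 \<or> parity a = -1"
  by (cases a) (simp_all add: parity_def)

lemma twin_swap_eq: "twin a = b \<longleftrightarrow> a = twin b" by auto

lemma neq_twin [simp]: "a \<noteq> twin a" using twin_neq[of a] by metis

lemma swap_perm_twin: "swap_perm \<alpha> \<beta> (twin a) = twin (swap_perm \<alpha> \<beta> a)"
  by (auto simp: swap_perm_def twin_swap_eq)

lemma swap_perm_involution [simp]: "swap_perm \<alpha> \<beta> (swap_perm \<alpha> \<beta> a) = a"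
  by (auto simp: swap_perm_def split: if_splits)

lemma swap_perm_eq: "a = swap_perm \<alpha> \<beta> b \<longleftrightarrow> b = swap_perm \<alpha> \<beta> a"
  by (metis swap_perm_involution)

lemma swap_sign_perm:
  assumes "\<alpha> \<noteq> \<beta>"
  shows "swap_sign \<alpha> \<beta> (swap_perm \<alpha> \<beta> b) = - swap_sign \<alpha> \<beta> b"
  using assms by (auto simp: swap_sign_def swap_perm_def)

lemma swap_sign_twin:
  assumes "\<alpha> \<noteq> \<beta>"
  shows "swap_sign \<alpha> \<beta> (twin b) = parity (swap_perm \<alpha> \<beta> b) * parity b * swap_sign \<alpha> \<beta> b"
  using assms parity_cases[of \<alpha>] parity_cases[of \<beta>]
  by (auto simp: swap_sign_def swap_perm_def twin_swap_eq)

lemma swap_sign_real: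
  "cnj (swap_sign \<alpha> \<beta> b) = swap_sign \<alpha> \<beta> b"
  "swap_sign \<alpha> \<beta> b = 0 \<or> swap_sign \<alpha> \<beta> b = 1 \<or> swap_sign \<alpha> \<beta> b = -1"
  "swap_sign \<alpha> \<beta> b = 0 \<Longrightarrow> swap_perm \<alpha> \<beta> b = b"
  using parity_cases[of \<alpha>] parity_cases[of \<beta>] by (auto simp: swap_sign_def swap_perm_def split: if_splits)

lemma swap_generator_k0:
  assumes "\<alpha> \<noteq> \<beta>"
  shows "swap_generator \<alpha> \<beta> \<in> k0"
proof -
  have "swap_generator \<alpha> \<beta> $ twin a $ twin b = parity a * parity b * cnj (swap_generator \<alpha> \<beta> $ a $ b)"
    for a b
    using swap_sign_twin[OF assms, of b] by (simp add: swap_generator_def swap_perm_twin swap_sign_real(1))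
  then have "swap_generator \<alpha> \<beta> \<in> quat_linear" by (simp add: quat_linear_iff)
  moreover have "cadj (swap_generator \<alpha> \<beta>) $ a $ b = (- swap_generator \<alpha> \<beta>) $ a $ b" for a b
    using swap_perm_eq[of b \<alpha> \<beta> a] swap_sign_perm[OF assms, of b]
    by (auto simp: swap_generator_def swap_sign_real(1))
  ultimately show ?thesis by (simp add: k0_def vec_eq_iff)
qed

lemma swap_in_K0:
  assumes ne: "\<alpha> \<noteq> \<beta>"
  obtains W s where "W \<in> K0" "\<And>a. cmod (s a) = 1"
    "\<And>(x :: complex^('m + 'm)^('m::finite + 'm)) a b. (W ** x) $ a $ b = s a * x $ swap_perm \<alpha> \<beta> a $ b"
proof -
  let ?X = "swap_generator \<alpha> \<beta> :: complex^('m + 'm)^('m + 'm)"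
  let ?\<pi> = "swap_perm \<alpha> \<beta>" and ?r = "swap_sign \<alpha> \<beta>"
  have mult: "(?X ** Y) $ a $ b = - ?r a * Y $ ?\<pi> a $ b" for Y :: "complex^('m + 'm)^('m + 'm)" and a b
  proof -
    have "(?X ** Y) $ a $ b = (\<Sum>c\<in>UNIV. ?X $ a $ c * Y $ c $ b)"
      by (simp add: matrix_matrix_mult_def)
    also have "\<dots> = (\<Sum>c\<in>UNIV. if c = ?\<pi> a then ?r (?\<pi> a) * Y $ ?\<pi> a $ b else 0)"
      by (intro sum.cong refl) (auto simp: swap_generator_def swap_perm_eq[of a])
    finally show ?thesis by (simp add: swap_sign_perm[OF ne])
  qed
  have r2: "?r a * (?r a * ?r a) = ?r a" for a using swap_sign_real(2)[of \<alpha> \<beta> a] by auto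
  define W where "W = mat 1 + ?X + ?X ** ?X"
  have "(?X ** (?X ** ?X)) $ a $ b = - ?X $ a $ b" for a b
  proof -
    have "(?X ** (?X ** ?X)) $ a $ b = - (?r a * ?r a * ?X $ a $ b)"
      unfolding mult by (simp add: swap_sign_perm[OF ne])
    also have "\<dots> = - ?X $ a $ b"
      using r2[of b] swap_sign_perm[OF ne, of b] by (simp add: swap_generator_def)
    finally show ?thesis .
  qed
  then have X3: "?X ** (?X ** ?X) = - ?X" by (simp add: vec_eq_iff)
  have sk: "cadj ?X = - ?X" using swap_generator_k0[OF ne] by (simp add: k0_def)
  have "W ** (mat 1 - ?X) = mat 1 + ?X"
    using X3 by (simp add: W_def mmult.add_left mmult.diff_right matrix_mul_assoc)
  then have "W = cayley ?X" by (rule cayley_unique[OF sk])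
  then have WK: "W \<in> K0" using cayley_K0[OF swap_generator_k0[OF ne]] by simp
  define s where "s a = (if ?r a = 0 then 1 else - ?r a)" for a
  have "(W ** x) $ a $ b = s a * x $ ?\<pi> a $ b" for x :: "complex^('m + 'm)^('m + 'm)" and a b
  proof -
    have "(W ** x) $ a $ b = x $ a $ b + (?X ** x) $ a $ b + (?X ** (?X ** x)) $ a $ b"
      by (simp add: W_def mmult.add_left matrix_mul_assoc)
    also have "\<dots> = x $ a $ b - ?r a * x $ ?\<pi> a $ b - ?r a * ?r a * x $ a $ b"
      unfolding mult by (simp add: swap_sign_perm[OF ne])
    also have "\<dots> = s a * x $ ?\<pi> a $ b"
      using swap_sign_real(2,3)[of \<alpha> \<beta> a] by (auto simp: s_def)
    finally show ?thesis .
  qed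
  moreover have "cmod (s a) = 1" for a using swap_sign_real(2)[of \<alpha> \<beta> a] by (auto simp: s_def)
  ultimately show ?thesis using that WK by blast
qed

text \<open>A rearrangement argument: moving the larger \<nu> to the larger weight would raise the
  energy. The swap also exchanges the twins, with opposite weights; the last hypothesis makes that
  contribution nonnegative.\<close>

lemma swap_energy:
  fixes x :: "complex^('m + 'm)^('m::finite + 'm)" and w :: "'m + 'm \<Rightarrow> real"
  assumes max: "\<And>k. k \<in> K0 \<Longrightarrow> energy w \<mu> (k ** x) \<le> energy w \<mu> x"
    and \<nu>: "\<And>a. \<nu> a = (\<Sum>b\<in>UNIV. \<mu> b * (x $ a $ b \<bullet> x $ a $ b))"
    and w: "\<And>a. w (twin a) = - w a" and less: "w \<alpha> < w \<beta>" and twins: "\<nu> (twin \<alpha>) \<le> \<nu> (twin \<beta>)"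
  shows "\<nu> \<alpha> \<le> \<nu> \<beta>"
proof (rule ccontr)
  assume gt: "\<not> \<nu> \<alpha> \<le> \<nu> \<beta>"
  have ne: "\<alpha> \<noteq> \<beta>" using less by auto
  let ?\<pi> = "swap_perm \<alpha> \<beta>"
  obtain W s where W: "W \<in> K0" and s: "\<And>a. cmod (s a) = 1"
    and Wx: "\<And>a b. (W ** x) $ a $ b = s a * x $ ?\<pi> a $ b" using swap_in_K0[OF ne] by metis
  have e: "energy w \<mu> x = (\<Sum>a\<in>UNIV. w a * \<nu> a)"
    by (simp add: energy_def \<nu> sum_distrib_left mult.assoc)
  have "(W ** x) $ a $ b \<bullet> (W ** x) $ a $ b = x $ ?\<pi> a $ b \<bullet> x $ ?\<pi> a $ b" for a b
    unfolding Wx power2_norm_eq_inner[symmetric] by (simp add: norm_mult s)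
  then have "energy w \<mu> (W ** x) = (\<Sum>a\<in>UNIV. w a * \<nu> (?\<pi> a))"
    by (simp add: energy_def \<nu> sum_distrib_left mult.assoc)
  also have "\<dots> = (\<Sum>a\<in>UNIV. w (?\<pi> a) * \<nu> a)"
  proof -
    have "bij ?\<pi>" by (rule o_bij[of ?\<pi>]) (auto simp: fun_eq_iff)
    from sum.reindex_bij_betw[OF this, of "\<lambda>a. w (?\<pi> a) * \<nu> a"] show ?thesis by simp
  qed
  finally have "(\<Sum>a\<in>UNIV. w (?\<pi> a) * \<nu> a) - (\<Sum>a\<in>UNIV. w a * \<nu> a) \<le> 0"
    using max[OF W] e by simp
  then have le: "(\<Sum>a\<in>UNIV. (w (?\<pi> a) - w a) * \<nu> a) \<le> 0"
    by (simp add: left_diff_distrib sum_subtractf)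
  have T: "(\<Sum>a\<in>UNIV. (w (?\<pi> a) - w a) * \<nu> a)
      = (\<Sum>a\<in>{\<alpha>, \<beta>, twin \<alpha>, twin \<beta>}. (w (?\<pi> a) - w a) * \<nu> a)"
    by (rule sum.mono_neutral_right) (auto simp: swap_perm_def)
  have pos: "(w \<beta> - w \<alpha>) * (\<nu> \<alpha> - \<nu> \<beta>) > 0" using less gt by simp
  show False
  proof (cases "\<beta> = twin \<alpha>")
    case True
    then have "{\<alpha>, \<beta>, twin \<alpha>, twin \<beta>} = {\<alpha>, \<beta>}" by auto
    then have "(\<Sum>a\<in>UNIV. (w (?\<pi> a) - w a) * \<nu> a) = (w \<beta> - w \<alpha>) * (\<nu> \<alpha> - \<nu> \<beta>)"
      unfolding T using ne by (simp add: swap_perm_def algebra_simps)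
    then show False using le pos by simp
  next
    case False
    then have d: "\<beta> \<noteq> twin \<alpha>" "\<alpha> \<noteq> twin \<beta>" "\<alpha> \<noteq> twin \<alpha>" "\<beta> \<noteq> twin \<beta>"
      by (auto simp: twin_neq[symmetric])
    have "(\<Sum>a\<in>UNIV. (w (?\<pi> a) - w a) * \<nu> a)
        = (w \<beta> - w \<alpha>) * (\<nu> \<alpha> - \<nu> \<beta>) + (w \<beta> - w \<alpha>) * (\<nu> (twin \<beta>) - \<nu> (twin \<alpha>))"
      unfolding T using ne d d[symmetric] by (simp add: swap_perm_def w algebra_simps)
    moreover have "(w \<beta> - w \<alpha>) * (\<nu> (twin \<beta>) - \<nu> (twin \<alpha>)) \<ge> 0" using less twins by simp
    ultimately show False using le pos by linarith
  qed
qed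

lemma flag_algebra_unitary:
  assumes x: "x \<in> unitary" and Z: "Z \<in> flag_algebra (act x (coord_flag c q))"
  shows "cadj x ** Z ** x \<in> pattern (- later c q)"
proof -
  have "cadj x ** x = mat 1" by (rule unitary_cadj(2)[OF x])
  then have "act (cadj x) (act x (coord_flag c q)) = coord_flag c q" by (simp add: act_act)
  moreover have "matrix_inv (cadj x) = x"
  proof -
    have inv: "invertible (cadj x)" by (intro unitary_invertible unitary_cadj(1) x)
    have "matrix_inv (cadj x) ** (cadj x ** x) = x" by (rule mult_matrix_inv_cancel(2)[OF inv])
    then show ?thesis using unitary_cadj(2)[OF x] by simp
  qed
  moreover have "invertible (cadj x)" by (intro unitary_invertible unitary_cadj(1) x)
  ultimately have "cadj x ** Z ** x \<in> flag_algebra (coord_flag c q)"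
    using flag_algebra_act[of "cadj x" "act x (coord_flag c q)"] Z by auto
  then show ?thesis by (simp add: flag_algebra_coord_flag)
qed

text \<open>A maximum of \<open>energy\<close> on the orbit is a coordinate flag since it is fixed by the
  infinitesimal action of the regular element \<open>diag w\<close> of \<open>\<i> \<kk>\<close>; the swaps show that
  it is the standard one.\<close>

lemma complex_K0_orbit_coord_flag:
  fixes V :: "('m::finite + 'm) flag" and q :: "'m + 'm \<Rightarrow> nat"
  assumes q: "bij_betw q UNIV {..<CARD('m + 'm)}" and qt: "\<And>a. q a + q (twin a) + 1 = CARD('m + 'm)"
    and c: "composition c CARD('m + 'm)" and V: "V \<in> flag_manifold c"
    and C: "complex_submanifold (orbit K0 V)"
  shows "coord_flag c q \<in> orbit K0 V"
proof -
  let ?E = "coord_flag c q"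
  \<comment> \<open>Affine and strictly decreasing in \<open>q\<close>, and centred so that twins,
    which have mirror positions, receive opposite weights.\<close>
  define w where "w a = real CARD('m + 'm) - 1 - 2 * real (q a)" for a
  define \<mu> where "\<mu> b = real (height c q b)" for b
  have wt: "w (twin a) = - w a" for a
  proof -
    have "real (q a) + real (q (twin a)) + 1 = real CARD('m + 'm)" using qt[of a] by (metis of_nat_1 of_nat_add)
    then show ?thesis by (simp add: w_def)
  qed
  have winj: "inj w" using q by (auto simp: w_def inj_def bij_betw_def)
  obtain g where g: "g \<in> unitary" "act g ?E = V" using flag_unitary[OF q c V] .
  have "continuous_on UNIV (\<lambda>k. energy w \<mu> (k ** g))"
    unfolding energy_def
    by (intro continuous_intros continuous_on_inner
        bounded_linear.continuous_on[OF bounded_linear_vec_nth] mmult.continuous_on)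
  then have "continuous_on K0 (\<lambda>k. energy w \<mu> (k ** g))" using continuous_on_subset by blast
  then obtain k0' where k0': "k0' \<in> K0" "\<And>k. k \<in> K0 \<Longrightarrow> energy w \<mu> (k ** g) \<le> energy w \<mu> (k0' ** g)"
    using continuous_attains_sup[OF compact_K0, of "\<lambda>k. energy w \<mu> (k ** g)"] K0_one by blast
  define x where "x = k0' ** g"
  have x: "x \<in> unitary" unfolding x_def by (intro unitary_mult K0_unitary k0'(1) g(1))
  have max: "energy w \<mu> (k ** x) \<le> energy w \<mu> x" if "k \<in> K0" for k
    using k0'(2)[OF K0_mult[OF that k0'(1)]] by (simp add: x_def matrix_mul_assoc)
  have xV: "act x ?E \<in> orbit K0 V" using k0'(1) by (auto simp: x_def g(2) orbit_def simp flip: act_act)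
  have Vx: "act x ?E \<in> flag_manifold c"
    by (rule act_flag_manifold[OF coord_flag_manifold[OF q c] unitary_invertible[OF x]])
  have cx: "\<exists>X'\<in>k0. X' + map_matrix ((*) \<i>) X \<in> flag_algebra (act x ?E)" if "X \<in> k0" for X
  proof -
    have "complex_submanifold (orbit K0 (act x ?E))" using C orbit_K0_eq[OF xV] by simp
    from complex_K0_orbit(1)[OF Vx this that] show ?thesis .
  qed
  have T0: "(cadj x ** Z ** x) $ a $ b = 0" if "Z \<in> flag_algebra (act x ?E)" "\<mu> a < \<mu> b" for Z a b
    using flag_algebra_unitary[OF x that(1)] that(2) by (simp add: pattern_def later_iff_height \<mu>_def)
  have xx: "x ** cadj x = mat 1" using x by (simp add: unitary_def)
  have "(cadj x ** diag w ** x) $ b $ c = 0" if bc: "\<mu> b \<noteq> \<mu> c" for b c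
  proof -
    \<comment> \<open>A factor \<open>- \<i>\<close> turns the Hermitian \<open>diag w\<close> into
      an element of \<open>k0\<close>, antisymmetry of \<open>w\<close> giving quaternionic
      linearity. Applying \<open>cx\<close> then yields \<open>X\<close> in \<open>k0\<close> with
      \<open>X + diag w\<close> in the flag algebra.\<close>
    define iA where "iA = map_matrix ((*) (- \<i>)) (diag w :: complex^('m + 'm)^('m + 'm))"
    have "iA \<in> quat_linear"
      unfolding quat_linear_iff by (auto simp: iA_def diag_def wt)
    moreover have "cadj iA = - iA" by (auto simp: iA_def diag_def vec_eq_iff)
    ultimately have "iA \<in> k0" by (simp add: k0_def)
    moreover have "map_matrix ((*) \<i>) iA = diag w" by (simp add: iA_def vec_eq_iff)
    ultimately obtain X where X: "X \<in> k0" "X + diag w \<in> flag_algebra (act x ?E)" using cx by metis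
    show ?thesis
    proof (rule trace_pairing_zero[where X = "cadj x ** X ** x" and \<mu> = \<mu>])
      show "cadj (cadj x ** diag w ** x) = cadj x ** diag w ** x"
      proof -
        have "cadj (diag w) = (diag w :: complex^('m + 'm)^('m + 'm))" by (auto simp: vec_eq_iff diag_def)
        then show ?thesis by (simp add: cadj_mult matrix_mul_assoc)
      qed
      show "cadj (cadj x ** X ** x) = - (cadj x ** X ** x)"
        using X(1) by (simp add: cadj_mult matrix_mul_assoc k0_def mmult.minus_left mmult.minus_right)
      show "(cadj x ** X ** x) $ b $ c = - (cadj x ** diag w ** x) $ b $ c" if "\<mu> b < \<mu> c" for b c
      proof -
        have "(cadj x ** X ** x) $ b $ c + (cadj x ** diag w ** x) $ b $ c
            = (cadj x ** (X + diag w) ** x) $ b $ c" by (simp add: mmult.add_left mmult.add_right)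
        then show ?thesis using T0[OF X(2) that] by (simp add: add_eq_0_iff2)
      qed
      show "(\<Sum>b\<in>UNIV. \<Sum>c\<in>UNIV. \<mu> b * Re ((cadj x ** diag w ** x) $ b $ c * (cadj x ** X ** x) $ c $ b)) = 0"
        using energy_stationary[OF max X(1)] trace_pairing[OF x, of w \<mu> X] by simp
      show "\<mu> b \<noteq> \<mu> c" by (rule bc)
    qed
  qed
  then obtain \<nu> where \<nu>: "\<And>a b. x $ a $ b \<noteq> 0 \<Longrightarrow> \<nu> a = \<mu> b"
    "\<And>a. \<nu> a = (\<Sum>b\<in>UNIV. \<mu> b * (x $ a $ b \<bullet> x $ a $ b))"
    by (rule unitary_diagonal[OF x winj, of \<mu>]) blast+
  \<comment> \<open>Transfers the vanishing pattern from the frame \<open>x\<close> to the standard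
    coordinates: nonzero entries of \<open>x\<close> only join indices with \<nu> of the row equal
    to \<mu> of the column.\<close>
  have Z0: "Z $ a $ b = 0" if Z: "Z \<in> flag_algebra (act x ?E)" and ab: "\<nu> a < \<nu> b" for Z a b
  proof -
    have "Z = (x ** cadj x) ** Z ** (x ** cadj x)" by (simp add: xx)
    also have "\<dots> = x ** (cadj x ** Z ** x) ** cadj x" by (simp only: matrix_mul_assoc)
    finally have "Z $ a $ b = (x ** (cadj x ** Z ** x) ** cadj x) $ a $ b" by (rule arg_cong)
    also have "\<dots> = (\<Sum>d\<in>UNIV. (\<Sum>e\<in>UNIV. x $ a $ e * (cadj x ** Z ** x) $ e $ d) * cnj (x $ b $ d))"
      unfolding matrix_matrix_mult_def[of _ "cadj x"] matrix_matrix_mult_def[of x] by simp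
    also have "\<dots> = 0"
    proof (intro sum.neutral ballI)
      fix d
      show "(\<Sum>e\<in>UNIV. x $ a $ e * (cadj x ** Z ** x) $ e $ d) * cnj (x $ b $ d) = 0"
      proof (cases "x $ b $ d = 0")
        case False
        have "x $ a $ e * (cadj x ** Z ** x) $ e $ d = 0" for e
        proof (cases "x $ a $ e = 0")
          case False
          then have "\<mu> e < \<mu> d" using \<nu>(1)[OF \<open>x $ b $ d \<noteq> 0\<close>] \<nu>(1)[OF False] ab by simp
          then show ?thesis using T0[OF Z] by simp
        qed simp
        then show ?thesis by (simp add: sum.neutral)
      qed simp
    qed
    finally show ?thesis .
  qed
  have \<nu>mono: "\<nu> \<alpha> \<le> \<nu> \<beta>" if "q \<beta> \<le> q \<alpha>" for \<alpha> \<beta>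
  proof (rule ccontr)
    assume gt: "\<not> \<nu> \<alpha> \<le> \<nu> \<beta>"
    then have ne: "\<alpha> \<noteq> \<beta>" by auto
    then have "q \<beta> \<noteq> q \<alpha>" using q by (auto simp: bij_betw_def inj_def)
    then have less: "w \<alpha> < w \<beta>" using that by (simp add: w_def)
    \<comment> \<open>Otherwise \<open>Z0\<close> annihilates both the entry at \<beta>, \<alpha>
      and its twin entry of \<open>X'\<close> plus \<open>\<i>\<close> times \<open>X\<close>.
      Quaternionic matrices have conjugate twin entries up to sign, and conjugation reverses
      \<open>\<i>\<close>, so the two equations contradict each other.\<close>
    have "\<nu> (twin \<alpha>) \<le> \<nu> (twin \<beta>)"
    proof (rule ccontr)
      assume gt': "\<not> \<nu> (twin \<alpha>) \<le> \<nu> (twin \<beta>)"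
      define X where "X = (swap_generator \<alpha> \<beta> :: complex^('m + 'm)^('m + 'm))"
      have X: "X \<in> k0" unfolding X_def by (rule swap_generator_k0[OF ne])
      obtain X' where X': "X' \<in> k0" "X' + map_matrix ((*) \<i>) X \<in> flag_algebra (act x ?E)"
        using cx[OF X] by blast
      have X1: "X $ \<beta> $ \<alpha> = 1" by (simp add: X_def swap_generator_def swap_perm_def swap_sign_def)
      have q1: "X $ twin \<beta> $ twin \<alpha> = parity \<beta> * parity \<alpha> * cnj (X $ \<beta> $ \<alpha>)"
        using X by (simp add: k0_def quat_linear_iff)
      have q2: "X' $ twin \<beta> $ twin \<alpha> = parity \<beta> * parity \<alpha> * cnj (X' $ \<beta> $ \<alpha>)"
        using X'(1) by (simp add: k0_def quat_linear_iff)
      have "X' $ \<beta> $ \<alpha> = - \<i>"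
        using Z0[OF X'(2), of \<beta> \<alpha>] gt by (simp add: X1 add_eq_0_iff2)
      moreover have "X' $ twin \<beta> $ twin \<alpha> = - \<i> * X $ twin \<beta> $ twin \<alpha>"
        using Z0[OF X'(2), of "twin \<beta>" "twin \<alpha>"] gt' by (simp add: add_eq_0_iff2)
      ultimately have "parity \<beta> * parity \<alpha> * \<i> = - \<i> * (parity \<beta> * parity \<alpha>)"
        using q1 q2 X1 by simp
      then show False
        using parity_cases[of \<alpha>] parity_cases[of \<beta>] by (auto simp: complex_eq_iff)
    qed
    from swap_energy[OF max \<nu>(2) wt less this] gt show False by blast
  qed
  have \<mu>mono: "\<mu> \<alpha> \<le> \<mu> \<beta>" if "q \<beta> \<le> q \<alpha>" for \<alpha> \<beta>
    using height_mono[of q \<beta> \<alpha> c] that by (simp add: \<mu>_def)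
  \<comment> \<open>By monotonicity both superlevel sets are initial segments for \<open>q\<close>,
    hence nested. The matrix \<open>x\<close> and its adjoint map the coordinate spaces of the two
    sets into each other, so the sets have equal size.\<close>
  have level: "{a. t \<le> \<nu> a} = {a. t \<le> \<mu> a}" (is "?N = ?M") for t
  proof -
    have card_le: "card S \<le> card T" if "u \<in> unitary" "\<And>a b. u $ a $ b \<noteq> 0 \<Longrightarrow> b \<in> S \<Longrightarrow> a \<in> T"
      for u and S T :: "('m + 'm) set"
    proof -
      have "(*v) u ` coord S \<subseteq> coord T" unfolding image_coord_subset using that(2) by blast
      then have "vec.dim ((*v) u ` coord S) \<le> vec.dim (coord T)" by (rule vec.dim_subset)
      then show ?thesis by (simp add: dim_image_invertible[OF unitary_invertible[OF that(1)]] dim_coord)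
    qed
    have "card ?M \<le> card ?N" using \<nu>(1) by (intro card_le[OF x]) auto
    moreover have "card ?N \<le> card ?M"
      using \<nu>(1) by (intro card_le[OF unitary_cadj(1)[OF x]]) (auto simp flip: \<nu>(1))
    moreover have "?M \<subseteq> ?N \<or> ?N \<subseteq> ?M"
    proof (rule ccontr)
      assume "\<not> (?M \<subseteq> ?N \<or> ?N \<subseteq> ?M)"
      then obtain a b where ab: "t \<le> \<mu> a" "\<not> t \<le> \<nu> a" "t \<le> \<nu> b" "\<not> t \<le> \<mu> b" by blast
      show False using ab \<mu>mono[where \<alpha> = a and \<beta> = b] \<nu>mono[where \<alpha> = b and \<beta> = a] by (cases "q a \<le> q b") auto
    qed
    moreover have "finite ?M" "finite ?N" by simp_all
    ultimately show ?thesis using card_seteq[of ?M ?N] card_seteq[of ?N ?M] by blast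
  qed
  have "x \<in> flag_algebra ?E"
    unfolding flag_algebra_coord_flag pattern_def
  proof (intro CollectI allI impI)
    fix a b assume "(a, b) \<notin> - later c q"
    then have "\<mu> a < \<mu> b" by (simp add: later_iff_height \<mu>_def)
    moreover have "\<mu> b \<le> \<mu> a" if ab: "x $ a $ b \<noteq> 0"
    proof -
      have "a \<in> {a. \<mu> b \<le> \<nu> a}" using \<nu>(1)[OF ab] by simp
      then show ?thesis unfolding level by simp
    qed
    ultimately show "x $ a $ b = 0" using not_le by blast
  qed
  then have "act x ?E = ?E"
    using act_eq_iff[OF flag_manifold_subspace[OF coord_flag_manifold[OF q c]] unitary_invertible[OF x]] by blast
  then show ?thesis using xV by simp
qed

text \<open>An element of \<open>k0\<close> that preserves a member of the flag also preserves its
  orthogonal complement and the quaternionic image of that. In the mirror order this image is the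
  coordinate space of complementary dimension.\<close>

lemma k0_flag_algebra_subset:
  fixes q :: "'m::finite + 'm \<Rightarrow> nat"
  assumes qt: "\<And>a. q a + q (twin a) + 1 = CARD('m + 'm)"
    and sub: "\<And>i. i < length d \<Longrightarrow> \<exists>k<length f. psum d (Suc i) = psum f (Suc k)
      \<or> psum d (Suc i) + psum f (Suc k) = CARD('m + 'm) \<or> psum d (Suc i) \<ge> CARD('m + 'm)"
  shows "k0 \<inter> flag_algebra (coord_flag f q) \<subseteq> flag_algebra (coord_flag d q)"
proof
  fix X :: "complex^('m + 'm)^('m + 'm)" assume X: "X \<in> k0 \<inter> flag_algebra (coord_flag f q)"
  have X0: "X $ a $ b = 0" if "(a, b) \<in> later f q" for a b
    using X that by (auto simp: flag_algebra_coord_flag pattern_def)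
  have "X $ a $ b = 0" if ab: "(a, b) \<in> later d q" for a b
  proof -
    obtain i where i: "i < length d" "q b < psum d (Suc i)" "psum d (Suc i) \<le> q a"
      using ab by (auto simp: later_def)
    obtain k where k: "k < length f" "psum d (Suc i) = psum f (Suc k)
      \<or> psum d (Suc i) + psum f (Suc k) = CARD('m + 'm) \<or> psum d (Suc i) \<ge> CARD('m + 'm)"
      using sub[OF i(1)] by blast
    from k(2) show ?thesis
    proof (elim disjE)
      assume "psum d (Suc i) = psum f (Suc k)"
      then show ?thesis using i k(1) by (intro X0) (auto simp: later_def)
    next
      assume "psum d (Suc i) + psum f (Suc k) = CARD('m + 'm)"
      then have "q (twin a) < psum f (Suc k)" "psum f (Suc k) \<le> q (twin b)"
        using i qt[of a] qt[of b] by linarith+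
      then have "X $ twin b $ twin a = 0" using k(1) by (intro X0) (auto simp: later_def)
      then have "X $ b $ a = 0" using X by (simp add: k0_def quat_linear_iff)
      moreover have "cadj X $ a $ b = - X $ a $ b" using X by (simp add: k0_def)
      ultimately show ?thesis by simp
    next
      assume "psum d (Suc i) \<ge> CARD('m + 'm)"
      then show ?thesis using i(3) qt[of a] by linarith
    qed
  qed
  then show "X \<in> flag_algebra (coord_flag d q)" by (simp add: flag_algebra_coord_flag pattern_def)
qed

lemma twin_order_exists:
  obtains q :: "'m::finite + 'm \<Rightarrow> nat" where "bij_betw q UNIV {..<CARD('m + 'm)}"
    "\<And>a. q a + q (twin a) + 1 = CARD('m + 'm)"
proof -
  obtain h :: "'m \<Rightarrow> nat" where h: "bij_betw h UNIV {..<CARD('m)}"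
    using finite_same_card_bij[of "UNIV :: 'm set" "{..<CARD('m)}"] by auto
  have hl: "h i < CARD('m)" for i using h by (auto simp: bij_betw_def)
  \<comment> \<open>The \<open>Inl\<close> coordinates fill the first half in the order
    \<open>h\<close>, their twins the second half in reverse order.\<close>
  define q where "q a = (case a of Inl i \<Rightarrow> h i | Inr i \<Rightarrow> 2 * CARD('m) - 1 - h i)" for a :: "'m + 'm"
  have n: "CARD('m + 'm) = 2 * CARD('m)" by (simp add: mult_2)
  have inj: "inj q"
  proof (rule injI)
    fix a b assume e: "q a = q b"
    have hi: "h i = h j \<longleftrightarrow> i = j" for i j using h by (auto simp: bij_betw_def inj_def)
    show "a = b"
      using e hl[of "projl a"] hl[of "projl b"] hl[of "projr a"] hl[of "projr b"]
      by (cases a; cases b) (auto simp: q_def simp flip: hi)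
  qed
  have "q a < 2 * CARD('m)" for a
  proof (cases a)
    case (Inl i)
    then show ?thesis using hl[of i] by (simp add: q_def)
  next
    case (Inr i)
    then show ?thesis using hl[of i] by (simp add: q_def)
  qed
  then have "q ` UNIV \<subseteq> {..<CARD('m + 'm)}" unfolding n by auto
  then have "q ` UNIV = {..<CARD('m + 'm)}"
    using inj by (intro card_subset_eq) (simp_all add: card_image)
  then have "bij_betw q UNIV {..<CARD('m + 'm)}" using inj by (simp add: bij_betw_def)
  moreover have "q a + q (twin a) + 1 = CARD('m + 'm)" for a
    unfolding n using hl[of "projl a"] hl[of "projr a"] by (cases a) (auto simp: q_def twin_def)
  ultimately show ?thesis using that by blast
qed

section \<open>The measurable model\<close>

lemma map_matrix_mult_eq: "map_matrix ((*) z) g = mat z ** g" for g :: "complex^'n^'n::finite"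
  by (simp add: vec_eq_iff matrix_matrix_mult_def mat_def if_distrib[of "\<lambda>x. x * _"] cong: if_cong)

lemma det_mat: "det (mat z :: complex^'n^'n::finite) = z ^ CARD('n)"
  using det_diagonal[of "mat z :: complex^'n^'n"] by (simp add: mat_def)

lemma invertible_scale_SL:
  fixes g :: "complex^'n^'n::finite"
  assumes "invertible g"
  obtains z where "z \<noteq> 0" "map_matrix ((*) z) g \<in> SL"
proof -
  have d: "det g \<noteq> 0" using assms by (simp add: invertible_det_nz)
  then obtain z where z: "z \<noteq> 0" "1 / det g = z ^ CARD('n)"
    using exists_complex_root_nonzero[of "1 / det g" "CARD('n)"] by auto
  have "det (map_matrix ((*) z) g) = 1"
    unfolding map_matrix_mult_eq det_mul det_mat z(2)[symmetric] using d by simp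
  then show ?thesis using that z(1) by (simp add: SL_def)
qed

lemma image_map_matrix_mult:
  fixes g :: "complex^'n^'n::finite"
  assumes U: "vec.subspace U" and z: "z \<noteq> 0"
  shows "(*v) (map_matrix ((*) z) g) ` U = (*v) g ` U"
proof -
  have "(*v) (map_matrix ((*) z) g) ` U = (*v) g ` ((*s) z ` U)"
    unfolding image_image by (intro image_cong refl) (simp add: map_matrix_mult_vector vec.scale)
  moreover have "(*s) z ` U = U"
  proof (intro equalityI subsetI)
    fix v assume "v \<in> U"
    then have "inverse z *s v \<in> U" "v = z *s (inverse z *s v)"
      using U z by (simp_all add: vec.subspace_scale)
    then show "v \<in> (*s) z ` U" by blast
  qed (use U vec.subspace_scale in blast)
  ultimately show ?thesis by simp
qed

text \<open>For \<open>v\<close> in the member \<open>A\<close> the stabilizer contains, up to a scalar, \<open>1 + T\<close> with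
  \<open>T\<close> of rank one that vanishes on the preceding member \<open>P\<close> and maps \<open>u\<close> to \<open>v\<close>.\<close>

lemma chain_invariant_subspace:
  fixes S :: "(complex^'n::finite) set set"
  assumes fin: "finite S" and sub: "\<And>A. A \<in> S \<Longrightarrow> vec.subspace A"
    and chain: "\<And>A B. A \<in> S \<Longrightarrow> B \<in> S \<Longrightarrow> A \<subseteq> B \<or> B \<subseteq> A" and top: "UNIV \<in> S"
    and U: "vec.subspace U"
    and inv: "\<And>g. g \<in> SL \<Longrightarrow> (\<And>A. A \<in> S \<Longrightarrow> (*v) g ` A = A) \<Longrightarrow> (*v) g ` U \<subseteq> U"
  shows "U \<in> S \<or> U = {0}"
proof -
  have chain_fin: "\<exists>M\<in>T. \<forall>B\<in>T. M \<subseteq> B" "\<exists>M\<in>T. \<forall>B\<in>T. B \<subseteq> M" if T: "T \<subseteq> insert {0} S" "T \<noteq> {}" for T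
  proof -
    have "finite T" using T(1) fin finite_subset by blast
    moreover have ch: "A \<subseteq> B \<or> B \<subseteq> A" if "A \<in> T" "B \<in> T" for A B
    proof -
      have "{0} \<subseteq> A" if "A \<in> S" for A using vec.subspace_0[OF sub[OF that]] by blast
      then show ?thesis using that T(1) chain by blast
    qed
    ultimately show "\<exists>M\<in>T. \<forall>B\<in>T. M \<subseteq> B" "\<exists>M\<in>T. \<forall>B\<in>T. B \<subseteq> M"
      using finite_has_minimal[of T] finite_has_maximal[of T] T(2) by metis+
  qed
  show ?thesis
  proof (cases "U = {0}")
    case False
    \<comment> \<open>\<open>A\<close> is the least member containing \<open>U\<close>, and
      \<open>P\<close> will be the largest member, or 0, that does not contain it. It remains to
      show that \<open>A\<close> is contained in \<open>U\<close>.\<close>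
    obtain A where A: "A \<in> S" "U \<subseteq> A" and Amin: "\<And>B. B \<in> S \<Longrightarrow> U \<subseteq> B \<Longrightarrow> A \<subseteq> B"
      using chain_fin(1)[of "{B \<in> S. U \<subseteq> B}"] top by blast
    let ?T = "{B \<in> insert {0} S. \<not> U \<subseteq> B}"
    have "{0} \<in> ?T" using False vec.subspace_0[OF U] by auto
    then have ne: "?T \<noteq> {}" by blast
    have "?T \<subseteq> insert {0} S" by blast
    from chain_fin(2)[OF this ne] obtain P where P': "P \<in> ?T" "\<forall>B\<in>?T. B \<subseteq> P" by blast
    have P: "P \<in> insert {0} S" "\<not> U \<subseteq> P" using P'(1) by simp_all
    have Pmax: "B \<subseteq> P" if "B \<in> S" "\<not> U \<subseteq> B" for B using P'(2) that by simp
    have sP: "vec.subspace P" using P(1) sub by (auto simp: vec.subspace_single_0)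
    obtain u where u: "u \<in> U" "u \<notin> P" using P(2) by blast
    have key: "v \<in> U" if v: "v \<in> A" "u \<notin> vec.span (insert v P)" for v
    proof -
      obtain B where B: "B \<subseteq> vec.span (insert v P)" "vec.independent B" "vec.span (insert v P) \<subseteq> vec.span B"
        using vec.basis_exists[of "vec.span (insert v P)"] by metis
      have spB: "vec.span B = vec.span (insert v P)"
        using B vec.span_mono[OF B(1)] by (simp add: vec.span_span)
      have "vec.independent (insert u B)"
        using vec.independent_insertI[OF _ B(2), of u] v(2) spB by simp
      from vec.linear_independent_extend_subspace[OF this, of "\<lambda>x. if x = u then v else 0"]
      obtain T where T: "Vector_Spaces.linear (*s) (*s) T"
        "\<forall>x\<in>insert u B. T x = (if x = u then v else 0)"
        "range T = vec.span ((\<lambda>x. if x = u then v else 0) ` insert u B)" by blast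
      have uB: "u \<notin> B" using vec.span_base[of u B] spB v(2) by blast
      have Tu: "T u = v" using T(2) by simp
      have T0: "T x = 0" if "x \<in> vec.span (insert v P)" for x
      proof (rule vec.linear_eq_0_on_span[OF T(1)])
        show "x \<in> vec.span B" using that spB by simp
        show "T y = 0" if "y \<in> B" for y using T(2) uB that by auto
      qed
      have Tv: "T v = 0" by (intro T0 vec.span_base) simp
      have Trange: "\<exists>k. T x = k *s v" for x
      proof -
        have "vec.span ((\<lambda>x. if x = u then v else 0) ` insert u B) \<subseteq> vec.span {v}"
          by (rule vec.span_minimal) (auto intro: vec.span_base vec.span_zero)
        then have "T x \<in> vec.span {v}" using T(3) by blast
        then show ?thesis by (auto simp: vec.span_singleton)
      qed
      define M where "M = matrix T"
      have M: "M *v x = T x" for x unfolding M_def by (rule matrix_works[OF T(1)])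
      \<comment> \<open>The range of \<open>T\<close> is spanned by \<open>v\<close> and
        \<open>T v = 0\<close>; with square zero, \<open>mat 1 + M\<close> has inverse
        \<open>mat 1 - M\<close>.\<close>
      have MM: "M ** M = 0"
      proof -
        have "(M ** M) *v x = 0 *v x" for x
        proof -
          obtain k where k: "T x = k *s v" using Trange by blast
          have "(M ** M) *v x = M *v (k *s v)" by (simp add: M k flip: matrix_vector_mul_assoc)
          also have "\<dots> = k *s (M *v v)" by (rule vec.scale)
          also have "\<dots> = 0 *v x" unfolding M Tv by (simp add: vec_eq_iff matrix_vector_mult_def)
          finally show ?thesis .
        qed
        then show ?thesis by (simp add: matrix_eq)
      qed
      have "(mat 1 + M) ** (mat 1 - M) = mat 1"
        by (simp add: mmult.add_left mmult.diff_right MM)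
      then have inv1: "invertible (mat 1 + M)" using invertible_right_inverse by blast
      have vM: "(mat 1 + M) *v x = x + T x" for x by (simp add: matrix_vector_mult_add_rdistrib M)
      \<comment> \<open>A member containing \<open>A\<close> absorbs the range of \<open>T\<close>;
        any other member is contained in \<open>P\<close>, where \<open>T\<close> vanishes.\<close>
      have fix_mem: "(*v) (mat 1 + M) ` B = B" if B: "B \<in> S" for B
      proof (cases "A \<subseteq> B")
        case True
        have "(*v) (mat 1 + M) ` B \<subseteq> B"
        proof clarify
          fix x assume x: "x \<in> B"
          obtain k where "T x = k *s v" using Trange by blast
          then show "(mat 1 + M) *v x \<in> B"
            using x v(1) True sub[OF B] by (auto simp: vM intro: vec.subspace_add vec.subspace_scale)
        qed
        moreover have "vec.subspace ((*v) (mat 1 + M) ` B)"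
          by (rule vec.linear_subspace_image[OF matrix_vector_mul_linear_gen sub[OF B]])
        ultimately show ?thesis
          using vec.subspace_dim_equal[OF _ sub[OF B]] dim_image_invertible[OF inv1] by simp
      next
        case False
        then have "B \<subseteq> P" using Amin[OF B] Pmax[OF B] by blast
        then have "T x = 0" if "x \<in> B" for x using that by (intro T0 vec.span_base) blast
        then show ?thesis by (simp add: vM)
      qed
      obtain z where z: "z \<noteq> 0" "map_matrix ((*) z) (mat 1 + M) \<in> SL"
        using invertible_scale_SL[OF inv1] .
      have "(*v) (map_matrix ((*) z) (mat 1 + M)) ` U \<subseteq> U"
        by (rule inv[OF z(2)]) (simp add: image_map_matrix_mult[OF sub z(1)] fix_mem)
      then have "(*v) (mat 1 + M) ` U \<subseteq> U" by (simp add: image_map_matrix_mult[OF U z(1)])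
      then have "u + v \<in> U" using u(1) Tu vM[of u] by (metis image_subset_iff)
      then show ?thesis using vec.subspace_diff[OF U _ u(1), of "u + v"] by simp
    qed
    have PA: "P \<subseteq> A"
    proof (cases "P = {0}")
      case True
      then show ?thesis using vec.subspace_0[OF sub[OF A(1)]] by blast
    next
      case False
      then show ?thesis using P A chain[of P A] by blast
    qed
    have "v \<in> U" if v: "v \<in> A" for v
    proof (cases "u \<in> vec.span (insert v P)")
      case True
      \<comment> \<open>The remaining case follows by exchange: \<open>v\<close> differs from a
        multiple of \<open>u\<close> by an element of \<open>P\<close>, and \<open>key\<close>
        applies to this element.\<close>
      have spP: "vec.span P = P" using sP by (simp only: vec.span_eq_iff)
      have "u \<notin> vec.span P" using u(2) by (simp only: spP not_False_eq_True)
      then have "v \<in> vec.span (insert u P)" using vec.in_span_insert[OF True] by blast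
      then obtain k where k: "v - k *s u \<in> vec.span P" using vec.span_breakdown_eq by blast
      then have kP: "v - k *s u \<in> P" by (simp only: spP)
      have "insert (v - k *s u) P = P" using kP by blast
      then have "v - k *s u \<in> U" using key[of "v - k *s u"] kP PA \<open>u \<notin> vec.span P\<close> by auto
      then have "(v - k *s u) + k *s u \<in> U" using u(1) U by (intro vec.subspace_add vec.subspace_scale)
      then show ?thesis by simp
    qed (rule key[OF v])
    then show ?thesis using A by (metis subsetI subset_antisym)
  qed simp
qed

section \<open>The involution \<open>tau\<close> and the stabilizer of the flag in the measurable
  model\<close>

lemma tau_mult_vector: "tau X *v quat_j v = quat_j (X *v v)"
proof -
  have inj: "inj quat_j" by (rule inj_on_inverseI[where g = "\<lambda>v. quat_j (- v)"])
      (simp add: vec_eq_iff quat_j_nth)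
  have surj: "quat_j (quat_j (- v)) = v" for v :: "complex^('a + 'a)" by (simp add: quat_j_quat_j)
  have "inv quat_j v = quat_j (- v)" for v :: "complex^('a + 'a)"
    using inj surj by (rule inv_f_eq)
  then have t: "tau X = matrix (\<lambda>v. quat_j (X *v quat_j (- v)))" by (simp add: tau_def)
  have "Vector_Spaces.linear (*s) (*s) (\<lambda>v. quat_j (X *v quat_j (- v)))"
  proof (rule Vector_Spaces.linear_iff[THEN iffD2], intro conjI allI)
    have add: "quat_j (u + v) = quat_j u + quat_j v" for u v :: "complex^('a + 'a)"
      by (simp add: vec_eq_iff quat_j_nth distrib_left)
    have sc: "quat_j (z *s v) = cnj z *s quat_j v" for z and v :: "complex^('a + 'a)"
      by (simp add: vec_eq_iff quat_j_nth)
    fix u v :: "complex^('a + 'a)" and z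
    show "quat_j (X *v quat_j (- (u + v))) = quat_j (X *v quat_j (- u)) + quat_j (X *v quat_j (- v))"
      by (simp only: minus_add_distrib add vec.add)
    have "- (z *s v) = z *s (- v)" by (simp add: vec_eq_iff)
    then show "quat_j (X *v quat_j (- (z *s v))) = z *s quat_j (X *v quat_j (- v))"
      by (simp only: sc vec.scale complex_cnj_cnj)
  qed (rule vec.vector_space_axioms)+
  moreover have "quat_j (- quat_j v) = v" by (simp add: vec_eq_iff quat_j_nth)
  ultimately show ?thesis
    using matrix_works[of "\<lambda>v. quat_j (X *v quat_j (- v))" "quat_j v"] by (simp add: t)
qed

lemma surj_quat_j: "quat_j (quat_j (- v)) = v" by (simp add: quat_j_quat_j)

lemma tau_tau: "tau (tau X) = X"
proof -
  have "tau (tau X) *v v = X *v v" for v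
    using tau_mult_vector[of "tau X" "quat_j (- v)"] tau_mult_vector[of X "- v"]
    by (simp add: surj_quat_j quat_j_quat_j vec.neg)
  then show ?thesis by (simp add: matrix_eq)
qed

lemma det_tau: "det (tau X) = cnj (det X)" for X :: "complex^('m + 'm)^('m::finite + 'm)"
proof -
  have "(tau X ** quat_J) *v v = (quat_J ** map_matrix cnj X) *v v" for v
  proof -
    define u :: "complex^('m + 'm)" where "u = (\<chi> i. cnj (v $ i))"
    have v: "v = (\<chi> i. cnj (u $ i))" by (simp add: u_def vec_eq_iff)
    have "tau X *v quat_j u = quat_j (X *v u)" by (rule tau_mult_vector)
    then show ?thesis
      unfolding quat_j_eq map_cnj_mult_vector v[symmetric] by (simp add: matrix_vector_mul_assoc)
  qed
  then have "tau X ** quat_J = quat_J ** map_matrix cnj X" by (simp add: matrix_eq)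
  then have "det (tau X ** quat_J) = det (quat_J ** map_matrix cnj X)" by simp
  then have "det (tau X) * det (quat_J :: complex^('m + 'm)^('m + 'm)) = det (quat_J :: complex^('m + 'm)^('m + 'm)) * cnj (det X)"
    by (simp only: det_mul det_map_cnj)
  moreover have "det (quat_J :: complex^('m + 'm)^('m + 'm)) \<noteq> 0"
  proof -
    have "quat_J ** (- quat_J) = (mat 1 :: complex^('m + 'm)^('m + 'm))"
      by (simp add: mmult.minus_right quat_J_square)
    then show ?thesis using invertible_det_nz invertible_right_inverse by blast
  qed
  ultimately show ?thesis by simp
qed

lemma quat_j_semilinear:
  "quat_j (u + v) = quat_j u + quat_j v" "quat_j (z *s v) = cnj z *s quat_j v"
  "quat_j 0 = 0"
  by (simp_all add: vec_eq_iff quat_j_nth distrib_left)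

lemma subspace_quat_j:
  assumes "vec.subspace U"
  shows "vec.subspace (quat_j ` U)"
  unfolding vec.subspace_def
proof (intro conjI ballI allI)
  show "0 \<in> quat_j ` U" using vec.subspace_0[OF assms] quat_j_semilinear(3) by (metis imageI)
next
  fix x y assume "x \<in> quat_j ` U" "y \<in> quat_j ` U"
  then show "x + y \<in> quat_j ` U"
    using vec.subspace_add[OF assms] by (auto simp flip: quat_j_semilinear(1))
next
  fix x z assume "x \<in> quat_j ` U"
  then obtain v where v: "v \<in> U" "x = quat_j v" by blast
  then have "z *s x = quat_j (cnj z *s v)" by (simp add: quat_j_semilinear)
  then show "z *s x \<in> quat_j ` U" using vec.subspace_scale[OF assms v(1)] by blast
qed

text \<open>Conjugate-linearity suffices to carry spanning sets to spanning sets, which bounds the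
  dimension from above; applying \<open>quat_j\<close> twice returns \<open>U\<close>, since its
  square is \<open>-1\<close>.\<close>

lemma dim_quat_j:
  assumes U: "vec.subspace U"
  shows "vec.dim (quat_j ` U) = vec.dim U"
proof -
  have le: "vec.dim (quat_j ` U) \<le> vec.dim U" if U: "vec.subspace U" for U :: "(complex^('a + 'a)) set"
  proof -
    obtain B where B: "B \<subseteq> U" "vec.independent B" "U \<subseteq> vec.span B" "card B = vec.dim U"
      using vec.basis_exists by metis
    have fin: "finite B" by (rule vec.finiteI_independent[OF B(2)])
    have "quat_j v \<in> vec.span (quat_j ` B)" if "v \<in> vec.span B" for v
      using that
    proof (induction rule: vec.span_induct_alt)
      case base
      then show ?case by (simp add: quat_j_semilinear vec.span_zero)
    next
      case (step z x y)
      then show ?case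
        by (auto simp: quat_j_semilinear intro!: vec.span_add vec.span_scale intro: vec.span_base)
    qed
    then have "vec.dim (quat_j ` U) \<le> card (quat_j ` B)"
      using B(3) fin by (intro vec.dim_le_card) auto
    then show ?thesis using card_image_le[OF fin, of quat_j] B(4) by simp
  qed
  have "quat_j ` quat_j ` U = U"
  proof -
    have "- v \<in> U" if "v \<in> U" for v using vec.subspace_neg[OF U that] .
    then have "uminus ` U = U" by (metis image_subset_iff imageI minus_minus subsetI subset_antisym)
    then show ?thesis by (simp add: image_image quat_j_quat_j)
  qed
  then show ?thesis using le[OF U] le[OF subspace_quat_j[OF U]] by simp
qed

lemma basis_flag_manifold:
  fixes b :: "(complex^'n::finite) list"
  assumes c: "composition c CARD('n)" and b: "length b = CARD('n)" "distinct b" "vec.independent (set b)"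
  shows "basis_flag c b \<in> flag_manifold c"
proof -
  have nth: "basis_flag c b ! i = vec.span (set (take (psum c (Suc i)) b))" if "i < length c" for i
    using that by (simp add: basis_flag_def psum_def)
  have "vec.dim (vec.span (set (take N b))) = N" if "N \<le> CARD('n)" for N
  proof -
    have "vec.independent (set (take N b))"
      using vec.independent_mono[OF b(3)] set_take_subset[of N b] by blast
    then have "vec.dim (vec.span (set (take N b))) = card (set (take N b))"
      by (rule vec.dim_span_eq_card_independent)
    also have "\<dots> = N" using that b by (simp add: distinct_card distinct_take)
    finally show ?thesis .
  qed
  moreover have "psum c i \<le> CARD('n)" for i using psum_le[of c i] c by (simp add: composition_def)
  moreover have "vec.span (set (take N b)) \<subseteq> vec.span (set (take M b))" if "N \<le> M" for N M
    using that by (intro vec.span_mono set_take_subset_set_take)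
  ultimately show ?thesis
    unfolding flag_manifold_iff using nth psum_mono by (auto simp: basis_flag_def psum_def[symmetric])
qed

lemma flag_manifold_top:
  fixes V :: "('n::finite) flag"
  assumes c: "composition c CARD('n)" and V: "V \<in> flag_manifold c"
  shows "UNIV \<in> set V"
proof -
  have "c \<noteq> []" using c by (auto simp: composition_def)
  then have i: "length c - 1 < length c" "Suc (length c - 1) = length c" by simp_all
  then have "vec.subspace (V ! (length c - 1))" "vec.dim (V ! (length c - 1)) = CARD('n)"
    using V c psum_length[of c] i unfolding flag_manifold_iff by (metis composition_def)+
  then have "V ! (length c - 1) = UNIV"
    using vec.subspace_dim_equal[of "V ! (length c - 1)" UNIV] vec_dim_card[where 'n = 'n and 'a = complex] by simp
  then show ?thesis using i(1) V by (metis flag_manifold_iff nth_mem)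
qed

lemma psum_rev: "psum (rev f) j = sum_list f - psum f (length f - j)"
proof -
  let ?k = "length f - j"
  have "psum (rev f) j = sum_list (drop ?k f)" by (simp add: psum_def take_rev)
  moreover have "sum_list (take ?k f @ drop ?k f) = psum f ?k + sum_list (drop ?k f)"
    by (simp only: sum_list_append psum_def)
  ultimately show ?thesis by simp
qed

lemma act_eqD: "act g V = V \<Longrightarrow> U \<in> set V \<Longrightarrow> (*v) g ` U = U"
  by (metis in_set_conv_nth nth_act)

text \<open>The equality of stabilizers is converted into one of subspaces by using
  \<open>chain_invariant_subspace\<close> in both directions, and then read off in
  dimensions.\<close>

lemma measurable_model_psum:
  fixes D :: "('m::finite + 'm) flag set"
  assumes model: "measurable_model D f d" and f: "composition f CARD('m + 'm)" and i: "i < length d"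
  shows "\<exists>k<length f. psum d (Suc i) = psum f (Suc k)
      \<or> psum d (Suc i) + psum f (Suc k) = CARD('m + 'm) \<or> psum d (Suc i) \<ge> CARD('m + 'm)"
proof -
  have n: "CARD('m + 'm) = 2 * CARD('m)" by (simp add: mult_2)
  obtain b :: "(complex^('m + 'm)) list" and V :: "('m + 'm) flag" where d: "composition d CARD('m + 'm)"
    and b: "length b = CARD('m + 'm)" "distinct b" "vec.independent (set b)"
    and V: "V \<in> flag_manifold d"
    and st: "stab V = stab (basis_flag f b) \<inter> tau ` stab (basis_flag (rev f) (rev b))"
    using model unfolding measurable_model_def n by blast
  define F where "F = basis_flag f b"
  define F' where "F' = basis_flag (rev f) (rev b)"
  have F: "F \<in> flag_manifold f" unfolding F_def by (rule basis_flag_manifold[OF f b])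
  have fr: "composition (rev f) CARD('m + 'm)" using f by (simp add: composition_def)
  have F': "F' \<in> flag_manifold (rev f)"
    unfolding F'_def by (rule basis_flag_manifold[OF fr]) (simp_all add: b)
  \<comment> \<open>The members that the two intersected groups preserve. \<open>SV\<close> and
    \<open>VS\<close> together say that \<open>stab V\<close> consists of the elements of
    \<open>SL\<close> fixing every member of \<open>S\<close>.\<close>
  define S where "S = set F \<union> (`) quat_j ` set F'"
  have SV: "(*v) g ` A = A" if g: "g \<in> stab V" and A: "A \<in> S" for g A
  proof (cases "A \<in> set F")
    case True
    have "act g F = F" using g st by (auto simp: stab_def F_def)
    then show ?thesis using True by (rule act_eqD)
  next
    case False
    then obtain U where U: "U \<in> set F'" "A = quat_j ` U" using A by (auto simp: S_def)
    obtain X where X: "g = tau X" "act X F' = F'" using g st by (auto simp: stab_def F'_def)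
    have "(*v) X ` U = U" using X(2) U(1) by (rule act_eqD)
    moreover have "(*v) g ` A = quat_j ` (*v) X ` U"
      by (simp add: X(1) U(2) image_image tau_mult_vector)
    ultimately show ?thesis by (simp add: U(2))
  qed
  have VS: "(*v) g ` V ! j = V ! j" if g: "g \<in> SL" "\<And>A. A \<in> S \<Longrightarrow> (*v) g ` A = A" and j: "j < length d" for g j
  proof -
    have "act g F = F" using g(2) by (simp add: act_def S_def map_idI)
    then have 1: "g \<in> stab F" using g(1) by (simp add: stab_def)
    have "(*v) (tau g) ` U = U" if U: "U \<in> set F'" for U
    proof -
      have inj: "inj (quat_j :: complex^('m + 'm) \<Rightarrow> _)"
        by (rule inj_on_inverseI[where g = "\<lambda>v. quat_j (- v)"]) (simp add: vec_eq_iff quat_j_nth)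
      have "quat_j ` (*v) (tau g) ` U = (*v) g ` quat_j ` U"
        using tau_mult_vector[of "tau g"] by (simp add: image_image tau_tau)
      also have "\<dots> = quat_j ` U" using g(2) U by (simp add: S_def)
      finally show ?thesis using inj by (simp add: inj_image_eq_iff)
    qed
    then have "act (tau g) F' = F'" by (simp add: act_def map_idI)
    moreover have "tau g \<in> SL" using g(1) by (simp add: SL_def det_tau)
    ultimately have "tau g \<in> stab F'" by (simp add: stab_def)
    then have "g \<in> tau ` stab F'" by (metis imageI tau_tau)
    then have "g \<in> stab V" using 1 st by (simp add: F_def F'_def)
    then have "act g V = V" by (simp add: stab_def)
    then show ?thesis using j V by (metis flag_manifold_iff nth_act)
  qed
  have subV: "vec.subspace A" if "A \<in> set V" for A by (rule flag_manifold_subspace[OF V that])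
  have subS: "vec.subspace A" if "A \<in> S" for A
    using that flag_manifold_subspace[OF F] flag_manifold_subspace[OF F'] subspace_quat_j
    by (auto simp: S_def)
  have chV: "A \<subseteq> B \<or> B \<subseteq> A" if AB: "A \<in> set V" "B \<in> set V" for A B
  proof -
    obtain k l where kl: "k < length V" "A = V ! k" "l < length V" "B = V ! l"
      using AB by (metis in_set_conv_nth)
    then show ?thesis using V unfolding flag_manifold_iff by (cases "k \<le> l") auto
  qed
  \<comment> \<open>\<open>S\<close> is not known to be a chain in advance. It is first embedded
    into the flag \<open>V\<close>, up to the zero space, and inherits the chain property from
    there.\<close>
  have S_V: "A \<in> set V \<or> A = {0}" if A: "A \<in> S" for A
  proof (rule chain_invariant_subspace[OF _ subV chV flag_manifold_top[OF d V] subS[OF A]])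
    show "(*v) g ` A \<subseteq> A" if "g \<in> SL" "\<And>B. B \<in> set V \<Longrightarrow> (*v) g ` B = B" for g
    proof -
      have "act g V = V" using that(2) by (simp add: act_def map_idI)
      then show ?thesis using SV[OF _ A] that(1) by (simp add: stab_def)
    qed
  qed simp
  have chS: "A \<subseteq> B \<or> B \<subseteq> A" if AB: "A \<in> S" "B \<in> S" for A B
  proof -
    have "{0} \<subseteq> A" "{0} \<subseteq> B" using vec.subspace_0 subS AB by blast+
    then show ?thesis using S_V[OF AB(1)] S_V[OF AB(2)] chV by blast
  qed
  have dimV: "vec.dim (V ! i) = psum d (Suc i)" "vec.subspace (V ! i)"
    using V i by (auto simp: flag_manifold_iff)
  \<comment> \<open>The second use of the chain lemma, now with \<open>S\<close> as the chain and a
    member of \<open>V\<close> as the invariant subspace.\<close>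
  have "V ! i \<in> S \<or> V ! i = {0}"
  proof (rule chain_invariant_subspace[OF _ subS chS _ dimV(2)])
    show "UNIV \<in> S" using flag_manifold_top[OF f F] by (simp add: S_def)
    show "(*v) g ` V ! i \<subseteq> V ! i" if "g \<in> SL" "\<And>A. A \<in> S \<Longrightarrow> (*v) g ` A = A" for g
      using VS[OF that i] by simp
  qed (simp add: S_def)
  moreover have "V ! i \<noteq> {0}"
  proof
    assume "V ! i = {0}"
    then have "psum d (Suc i) = 0" using dimV(1) vec.dim_eq_0[of "V ! i"] by simp
    then show False using psum_strict_mono[OF d, of 0 "Suc i"] i by simp
  qed
  ultimately consider "V ! i \<in> set F" | U where "U \<in> set F'" "V ! i = quat_j ` U" by (auto simp: S_def)
  then show ?thesis
  proof cases
    case 1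
    then obtain k where "k < length f" "V ! i = F ! k" using F by (metis flag_manifold_iff in_set_conv_nth)
    then show ?thesis using F dimV(1) unfolding flag_manifold_iff by metis
  next
    case 2
    then obtain k where k: "k < length f" "U = F' ! k"
      using F' by (metis flag_manifold_iff in_set_conv_nth length_rev)
    then have "vec.dim U = psum (rev f) (Suc k)" "vec.subspace U" using F' by (auto simp: flag_manifold_iff)
    then have e: "psum d (Suc i) = CARD('m + 'm) - psum f (length f - Suc k)"
      using dimV(1) 2(2) dim_quat_j[of U] f by (simp add: psum_rev composition_def)
    \<comment> \<open>Reversal gives the complement of a partial sum of \<open>f\<close>. The empty
      partial sum has no index \<open>k\<close>; it belongs to the whole space and falls under the
      third alternative.\<close>
    show ?thesis
    proof (cases "length f - Suc k")
      case 0
      then show ?thesis using e k(1) by auto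
    next
      case (Suc l)
      have "psum f (Suc l) \<le> CARD('m + 'm)" using psum_le[of f "Suc l"] f by (simp add: composition_def)
      then show ?thesis using e k(1) Suc by (intro exI[of _ l]) auto
    qed
  qed
qed

section \<open>Iwasawa-Schubert varieties as closures of cells\<close>

text \<open>Nonzero multiples of basis vectors span the same subspaces, so the signs of the
  quaternionic partners do not affect the flag.\<close>

lemma basis_flag_coord:
  fixes b :: "(complex^'n::finite) list"
  assumes c: "composition c CARD('n)" and len: "length b = CARD('n)"
    and \<tau>: "bij_betw \<tau> {..<CARD('n)} UNIV"
    and b: "\<And>k. k < CARD('n) \<Longrightarrow> s k \<noteq> 0 \<and> b ! k = s k *s axis (\<tau> k) 1"
  shows "basis_flag c b = coord_flag c (inv_into {..<CARD('n)} \<tau>)"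
proof -
  let ?p = "inv_into {..<CARD('n)} \<tau>"
  have p1: "?p (\<tau> k) = k" if "k < CARD('n)" for k
    using \<tau> that by (simp add: bij_betw_def inv_into_f_f)
  have p2: "\<tau> (?p a) = a" "?p a < CARD('n)" for a
    using bij_betw_inv_into_right[OF \<tau>, of a] bij_betwE[OF bij_betw_inv_into[OF \<tau>]] by auto
  have "vec.span (set (take N b)) = coord {a. ?p a < N}" if N: "N \<le> CARD('n)" for N
  proof -
    have set: "set (take N b) = (!) b ` {..<N}"
      using nth_image[of N b] N len by (simp add: atLeast0LessThan)
    have "vec.span ((!) b ` {..<N}) = vec.span ((\<lambda>a. axis a 1) ` \<tau> ` {..<N})"
    proof
      show "vec.span ((!) b ` {..<N}) \<subseteq> vec.span ((\<lambda>a. axis a 1) ` \<tau> ` {..<N})"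
        using b N by (intro vec.span_minimal) (auto intro!: vec.span_scale intro: vec.span_base)
      have "axis (\<tau> k) 1 \<in> vec.span ((!) b ` {..<N})" if k: "k < N" for k
      proof -
        have bk: "s k \<noteq> 0" "b ! k = s k *s axis (\<tau> k) 1" using b[of k] k N by auto
        then have "axis (\<tau> k) 1 = inverse (s k) *s b ! k" by (simp add: vec_eq_iff)
        also have "\<dots> \<in> vec.span ((!) b ` {..<N})" using k by (intro vec.span_scale vec.span_base) simp
        finally show ?thesis .
      qed
      then show "vec.span ((\<lambda>a. axis a 1) ` \<tau> ` {..<N}) \<subseteq> vec.span ((!) b ` {..<N})"
        by (intro vec.span_minimal) auto
    qed
    also have "\<dots> = coord (\<tau> ` {..<N})" by (rule span_axis)
    also have "\<tau> ` {..<N} = {a. ?p a < N}"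
    proof (intro equalityI subsetI)
      fix a assume "a \<in> \<tau> ` {..<N}"
      then show "a \<in> {a. ?p a < N}" using p1 N by auto
    next
      fix a assume "a \<in> {a. ?p a < N}"
      then show "a \<in> \<tau> ` {..<N}" using p2(1)[of a] by (metis imageI lessThan_iff mem_Collect_eq)
    qed
    finally show ?thesis by (simp add: set)
  qed
  moreover have "psum c i \<le> CARD('n)" for i using psum_le[of c i] c by (simp add: composition_def)
  ultimately show ?thesis by (simp add: basis_flag_def coord_flag_def psum_def[symmetric])
qed

lemma concat_pairs:
  "length (concat (map (\<lambda>i. [f i, g i]) xs)) = 2 * length xs"
  "k < 2 * length xs \<Longrightarrow> concat (map (\<lambda>i. [f i, g i]) xs) ! k
    = (if even k then f (xs ! (k div 2)) else g (xs ! (k div 2)))"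
proof -
  show "length (concat (map (\<lambda>i. [f i, g i]) xs)) = 2 * length xs" by (induction xs) auto
  show "k < 2 * length xs \<Longrightarrow> concat (map (\<lambda>i. [f i, g i]) xs) ! k
    = (if even k then f (xs ! (k div 2)) else g (xs ! (k div 2)))"
  proof (induction xs arbitrary: k)
    case (Cons x xs)
    consider "k = 0" | "k = 1" | l where "k = Suc (Suc l)" by (metis One_nat_def not0_implies_Suc)
    then show ?case
    proof cases
      case 3
      then have "concat (map (\<lambda>i. [f i, g i]) (x # xs)) ! k = concat (map (\<lambda>i. [f i, g i]) xs) ! l"
        by simp
      then show ?thesis using Cons 3 by simp
    qed simp_all
  qed simp
qed

text \<open>Positions count from 0 and \<open>e\<close> from 1; the positions \<open>2 * i\<close>
  and \<open>2 * i + 1\<close> hold a pair of twins.\<close>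

definition iwasawa_index :: "(nat \<Rightarrow> 'm) \<Rightarrow> nat \<Rightarrow> 'm + 'm" where
  "iwasawa_index e k = (if even k then Inl (e (Suc (k div 2))) else Inr (e (Suc (k div 2))))"

lemma quat_j_axis: "quat_j (axis (Inl i) 1) = (- 1) *s axis (Inr i) 1" for i :: "'m::finite"
proof -
  have "quat_j (axis (Inl i) 1) $ a = ((- 1) *s axis (Inr i) 1) $ a" for a :: "'m + 'm"
    by (cases a) (auto simp: quat_j_nth axis_def parity_def twin_def)
  then show ?thesis by (simp add: vec_eq_iff)
qed

lemma iwasawa_basis_nth:
  fixes e :: "nat \<Rightarrow> 'm::finite"
  shows "length (iwasawa_basis e) = CARD('m + 'm)"
    and "k < CARD('m + 'm) \<Longrightarrow>
      iwasawa_basis e ! k = (if even k then 1 else - 1) *s axis (iwasawa_index e k) 1"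
proof -
  have n: "CARD('m + 'm) = 2 * CARD('m)" by (simp add: mult_2)
  show "length (iwasawa_basis e) = CARD('m + 'm)"
    unfolding iwasawa_basis_def concat_pairs(1) n by simp
  assume k: "k < CARD('m + 'm)"
  then have "k < 2 * length [1..<Suc CARD('m)]" "[1..<Suc CARD('m)] ! (k div 2) = Suc (k div 2)"
    using nth_upt[of 1 "k div 2" "Suc CARD('m)"] unfolding n by auto
  then show "iwasawa_basis e ! k = (if even k then 1 else - 1) *s axis (iwasawa_index e k) 1"
    unfolding iwasawa_basis_def
    by (subst concat_pairs(2)) (simp_all add: iwasawa_index_def quat_j_axis del: upt_Suc)
qed

lemma bij_iwasawa_index:
  fixes e :: "nat \<Rightarrow> 'm::finite"
  assumes e: "bij_betw e {1..CARD('m)} UNIV"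
  shows "bij_betw (iwasawa_index e) {..<CARD('m + 'm)} UNIV"
proof -
  have n: "CARD('m + 'm) = 2 * CARD('m)" by (simp add: mult_2)
  have inj: "inj_on (iwasawa_index e) {..<CARD('m + 'm)}"
  proof (rule inj_onI)
    fix k l assume kl: "k \<in> {..<CARD('m + 'm)}" "l \<in> {..<CARD('m + 'm)}"
      and eq: "iwasawa_index e k = iwasawa_index e l"
    have par: "even k = even l" "e (Suc (k div 2)) = e (Suc (l div 2))"
      using eq by (auto simp: iwasawa_index_def split: if_splits)
    have "Suc (k div 2) \<in> {1..CARD('m)}" "Suc (l div 2) \<in> {1..CARD('m)}" using kl unfolding n by auto
    then have "k div 2 = l div 2" using par(2) e by (auto simp: bij_betw_def dest: inj_onD)
    then show "k = l" using par(1) by (metis div_mult_mod_eq even_iff_mod_2_eq_zero not_mod_2_eq_0_eq_1)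
  qed
  have "iwasawa_index e ` {..<CARD('m + 'm)} = UNIV"
    by (rule card_subset_eq) (simp_all only: card_image[OF inj] card_lessThan finite subset_UNIV)
  then show ?thesis using inj by (simp add: bij_betw_def)
qed

definition iwasawa_position :: "(nat \<Rightarrow> 'm) \<Rightarrow> 'm + 'm \<Rightarrow> nat" where
  "iwasawa_position e = inv_into {..<CARD('m + 'm)} (iwasawa_index e)"

text \<open>The place, counted from 0, of a coordinate in the basis permuted by \<open>w\<close>.
  Letters count from 1, hence the subtraction.\<close>

definition word_position :: "(nat \<Rightarrow> 'm) \<Rightarrow> nat list \<Rightarrow> 'm + 'm \<Rightarrow> nat" where
  "word_position e w = inv_into {..<CARD('m + 'm)} (\<lambda>k. iwasawa_index e (w ! k - 1))"

lemma bij_word: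
  assumes w: "distinct w" "set w = {1..n}"
  shows "bij_betw (\<lambda>k. w ! k - 1) {..<n} {..<n}" "length w = n"
proof -
  show len: "length w = n" using w distinct_card by fastforce
  have r: "w ! k \<in> {1..n}" if "k < n" for k using w(2) len that nth_mem by blast
  have inj: "inj_on (\<lambda>k. w ! k - 1) {..<n}"
  proof (rule inj_onI)
    fix k l assume "k \<in> {..<n}" "l \<in> {..<n}" "w ! k - 1 = w ! l - 1"
    then have "w ! k = w ! l" using r[of k] r[of l] by auto
    then show "k = l" using w(1) len \<open>k \<in> {..<n}\<close> \<open>l \<in> {..<n}\<close> by (simp add: nth_eq_iff_index_eq)
  qed
  have "w ! k - 1 < n" if "k < n" for k using r[OF that] by auto
  then have "(\<lambda>k. w ! k - 1) ` {..<n} \<subseteq> {..<n}" by auto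
  then have "(\<lambda>k. w ! k - 1) ` {..<n} = {..<n}" using inj by (intro card_subset_eq) (simp_all add: card_image)
  then show "bij_betw (\<lambda>k. w ! k - 1) {..<n} {..<n}" using inj by (simp add: bij_betw_def)
qed

lemma word_position:
  fixes e :: "nat \<Rightarrow> 'm::finite"
  assumes e: "bij_betw e {1..CARD('m)} UNIV" and w: "distinct w" "set w = {1..CARD('m + 'm)}"
  shows "bij_betw (\<lambda>k. iwasawa_index e (w ! k - 1)) {..<CARD('m + 'm)} UNIV"
    and "bij_betw (word_position e w) UNIV {..<CARD('m + 'm)}"
    and "bij_betw (iwasawa_position e) UNIV {..<CARD('m + 'm)}"
    and "\<And>a. iwasawa_position e a = w ! word_position e w a - 1"
    and "\<And>k. k < CARD('m + 'm) \<Longrightarrow> word_position e w (iwasawa_index e (w ! k - 1)) = k"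
proof -
  note \<sigma> = bij_iwasawa_index[OF e]
  show \<tau>: "bij_betw (\<lambda>k. iwasawa_index e (w ! k - 1)) {..<CARD('m + 'm)} UNIV"
    using bij_betw_trans[OF bij_word(1)[OF w] \<sigma>] by (simp add: o_def)
  show 2: "bij_betw (word_position e w) UNIV {..<CARD('m + 'm)}"
    unfolding word_position_def by (rule bij_betw_inv_into[OF \<tau>])
  show "bij_betw (iwasawa_position e) UNIV {..<CARD('m + 'm)}"
    unfolding iwasawa_position_def by (rule bij_betw_inv_into[OF \<sigma>])
  show "word_position e w (iwasawa_index e (w ! k - 1)) = k" if "k < CARD('m + 'm)" for k
    unfolding word_position_def using bij_betw_inv_into_left[OF \<tau>, of k] that by simp
  show "iwasawa_position e a = w ! word_position e w a - 1" for a
  proof -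
    let ?k = "word_position e w a"
    have k: "?k < CARD('m + 'm)" using 2 by (auto simp: bij_betw_def)
    have "iwasawa_index e (w ! ?k - 1) = a"
      unfolding word_position_def using bij_betw_inv_into_right[OF \<tau>, of a] by simp
    moreover have "w ! ?k - 1 < CARD('m + 'm)" using bij_word(1)[OF w] k by (auto simp: bij_betw_def)
    then have "iwasawa_position e (iwasawa_index e (w ! ?k - 1)) = w ! ?k - 1"
      unfolding iwasawa_position_def using bij_betw_inv_into_left[OF \<sigma>] by simp
    ultimately show ?thesis by simp
  qed
qed

lemma iwasawa_borel_eq:
  fixes e :: "nat \<Rightarrow> 'm::finite"
  assumes e: "bij_betw e {1..CARD('m)} UNIV"
  shows "iwasawa_borel e = SL \<inter> upper (iwasawa_position e)"
proof -
  let ?n = "CARD('m + 'm)" and ?\<rho> = "iwasawa_position e"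
  have n: "2 * CARD('m) = ?n" by (simp add: mult_2)
  note \<sigma> = bij_iwasawa_index[OF e]
  have \<rho>: "bij_betw ?\<rho> UNIV {..<?n}"
    unfolding iwasawa_position_def by (rule bij_betw_inv_into[OF \<sigma>])
  have c: "composition (replicate ?n 1) ?n" by (simp add: composition_def sum_list_replicate)
  have E: "basis_flag (replicate ?n 1) (iwasawa_basis e) = coord_flag (replicate ?n 1) ?\<rho>"
    unfolding iwasawa_position_def
    by (rule basis_flag_coord[OF c iwasawa_basis_nth(1) \<sigma>, where s = "\<lambda>k. if even k then 1 else - 1"])
      (simp add: iwasawa_basis_nth(2))
  have ps: "psum (replicate ?n 1) (Suc i) = Suc i" if "i < ?n" for i
    using that by (simp add: psum_def sum_list_replicate min_def del: replicate_Suc)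
  have \<rho>l: "?\<rho> a < ?n" for a using \<rho> by (auto simp: bij_betw_def)
  have later: "- later (replicate ?n 1) ?\<rho> = {(a, b). ?\<rho> a \<le> ?\<rho> b}"
  proof -
    have "(\<exists>i<?n. ?\<rho> b < psum (replicate ?n 1) (Suc i) \<and> psum (replicate ?n 1) (Suc i) \<le> ?\<rho> a)
        \<longleftrightarrow> ?\<rho> b < ?\<rho> a" for a b
      using ps \<rho>l[of b] by (auto intro!: exI[of _ "?\<rho> b"])
    then show ?thesis unfolding later_def length_replicate by (auto simp: not_less)
  qed
  note sub = flag_manifold_subspace[OF coord_flag_manifold[OF \<rho> c]]
  have "g \<in> stab (coord_flag (replicate ?n 1) ?\<rho>) \<longleftrightarrow> g \<in> SL \<and> g \<in> upper ?\<rho>" for g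
  proof (cases "g \<in> SL")
    case True
    then have "invertible g" by (simp add: SL_def invertible_det_nz)
    then have "act g (coord_flag (replicate ?n 1) ?\<rho>) = coord_flag (replicate ?n 1) ?\<rho> \<longleftrightarrow>
        g \<in> flag_algebra (coord_flag (replicate ?n 1) ?\<rho>)" 
      using act_eq_iff[of "coord_flag (replicate ?n 1) ?\<rho>" g] sub by blast
    moreover have "flag_algebra (coord_flag (replicate ?n 1) ?\<rho>) = upper ?\<rho>"
      unfolding flag_algebra_coord_flag later upper_def ..
    ultimately show ?thesis using True unfolding stab_def by blast
  qed (simp add: stab_def)
  then show ?thesis unfolding iwasawa_borel_def n E by blast
qed

text \<open>A suitable scalar multiple of an invertible matrix has determinant 1, and scalars act
  trivially on subspaces.\<close>

lemma orbit_upper_SL: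
  fixes V :: "('n::finite) flag"
  assumes V: "\<And>U. U \<in> set V \<Longrightarrow> vec.subspace U"
  shows "orbit (SL \<inter> upper \<rho>) V = orbit (upper_group \<rho>) V"
proof (intro equalityI subsetI)
  fix W assume "W \<in> orbit (SL \<inter> upper \<rho>) V"
  then show "W \<in> orbit (upper_group \<rho>) V"
    by (auto simp: orbit_def upper_group_def SL_def invertible_det_nz)
next
  fix W assume "W \<in> orbit (upper_group \<rho>) V"
  then obtain g where g: "g \<in> upper \<rho>" "invertible g" "W = act g V"
    by (auto simp: orbit_def upper_group_def)
  obtain z where z: "z \<noteq> 0" "map_matrix ((*) z) g \<in> SL" using invertible_scale_SL[OF g(2)] .
  have "map_matrix ((*) z) g \<in> upper \<rho>" using g(1) unfolding upper_def by (rule pattern_scale)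
  moreover have "act (map_matrix ((*) z) g) V = W"
    unfolding g(3) act_def using V z(1) by (simp add: image_map_matrix_mult)
  ultimately show "W \<in> orbit (SL \<inter> upper \<rho>) V" using z(2) by (auto simp: orbit_def)
qed

lemma word_basis_flag:
  fixes e :: "nat \<Rightarrow> 'm::finite"
  assumes e: "bij_betw e {1..CARD('m)} UNIV" and c: "composition c CARD('m + 'm)"
    and w: "distinct w" "set w = {1..CARD('m + 'm)}"
  shows "basis_flag c (map (\<lambda>k. iwasawa_basis e ! (k - 1)) w) = coord_flag c (word_position e w)"
  unfolding word_position_def
proof (rule basis_flag_coord[OF c _ word_position(1)[OF e w],
      where s = "\<lambda>k. if even (w ! k - 1) then 1 else - 1"])
  show "length (map (\<lambda>k. iwasawa_basis e ! (k - 1)) w) = CARD('m + 'm)" using bij_word(2)[OF w] by simp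
  fix k assume k: "k < CARD('m + 'm)"
  have "w ! k - 1 < CARD('m + 'm)" using bij_word(1)[OF w] k by (auto simp: bij_betw_def)
  then have "iwasawa_basis e ! (w ! k - 1)
      = (if even (w ! k - 1) then 1 else - 1) *s axis (iwasawa_index e (w ! k - 1)) 1"
    by (rule iwasawa_basis_nth(2))
  moreover have "map (\<lambda>k. iwasawa_basis e ! (k - 1)) w ! k = iwasawa_basis e ! (w ! k - 1)"
    using k bij_word(2)[OF w] by simp
  moreover have "(if even (w ! k - 1) then 1 else - 1 :: complex) \<noteq> 0" by simp
  ultimately show "(if even (w ! k - 1) then 1 else - 1 :: complex) \<noteq> 0 \<and>
      map (\<lambda>k. iwasawa_basis e ! (k - 1)) w ! k
        = (if even (w ! k - 1) then 1 else - 1) *s axis (iwasawa_index e (w ! k - 1)) 1"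
    by (intro conjI) (assumption, rule trans)
qed

lemma schubert_variety_eq:
  fixes e :: "nat \<Rightarrow> 'm::finite"
  assumes e: "bij_betw e {1..CARD('m)} UNIV" and c: "composition c CARD('m + 'm)"
    and w: "distinct w" "set w = {1..CARD('m + 'm)}"
  shows "schubert_variety e c w
    = flag_topology c closure_of schubert_cell c (iwasawa_position e) (word_position e w)"
proof -
  note sub = flag_manifold_subspace[OF coord_flag_manifold[OF word_position(2)[OF e w] c]]
  show ?thesis
    unfolding schubert_variety_def word_basis_flag[OF e c w] iwasawa_borel_eq[OF e] schubert_cell_def
    by (simp add: orbit_upper_SL[OF sub])
qed

section \<open>Sorting the blocks\<close>

text \<open>Passes to the minimal representative of the coset of \<open>w\<close>. The letters in
  each union of initial blocks are unchanged, and so is the flag.\<close>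

definition sort_blocks :: "nat list \<Rightarrow> nat list \<Rightarrow> nat list" where
  "sort_blocks c w = concat (map sort (blocks c w))"

lemma sort_blocks_Cons: "sort_blocks (k # c) w = sort (take k w) @ sort_blocks c (drop k w)"
  by (simp add: sort_blocks_def)

lemma sort_blocks:
  assumes "sum_list c = length w"
  shows "length (sort_blocks c w) = length w" "mset (sort_blocks c w) = mset w"
    "blocks c (sort_blocks c w) = map sort (blocks c w)"
    "set (take (psum c i) (sort_blocks c w)) = set (take (psum c i) w)"
proof -
  have "length (sort_blocks c w) = length w \<and> mset (sort_blocks c w) = mset w \<and>
    blocks c (sort_blocks c w) = map sort (blocks c w) \<and>
    set (take (psum c i) (sort_blocks c w)) = set (take (psum c i) w)"
    using assms
  proof (induction c arbitrary: w i)
    case Nil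
    then show ?case by (simp add: sort_blocks_def)
  next
    case (Cons k c)
    have l: "length (take k w) = k" using Cons.prems by simp
    have IH: "length (sort_blocks c (drop k w)) = length (drop k w)"
      "mset (sort_blocks c (drop k w)) = mset (drop k w)"
      "blocks c (sort_blocks c (drop k w)) = map sort (blocks c (drop k w))"
      "\<And>i. set (take (psum c i) (sort_blocks c (drop k w))) = set (take (psum c i) (drop k w))"
      using Cons.IH[of "drop k w"] Cons.prems by auto
    have "mset (sort_blocks (k # c) w) = mset (take k w) + mset (drop k w)"
      by (simp add: sort_blocks_Cons IH)
    also have "\<dots> = mset w" by (metis append_take_drop_id mset_append)
    finally have ms: "mset (sort_blocks (k # c) w) = mset w" .
    have "set (take (psum (k # c) i) (sort_blocks (k # c) w)) = set (take (psum (k # c) i) w)"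
    proof (cases i)
      case (Suc j)
      have "take (k + psum c j) w = take k w @ take (psum c j) (drop k w)" by (rule take_add)
      moreover have "take (k + psum c j) (sort_blocks (k # c) w)
          = sort (take k w) @ take (psum c j) (sort_blocks c (drop k w))"
        using l by (simp add: sort_blocks_Cons)
      ultimately show ?thesis using IH(4)[of j] by (simp add: Suc psum_Cons_Suc)
    qed simp
    then show ?case using ms IH l by (simp add: sort_blocks_Cons)
  qed
  then show "length (sort_blocks c w) = length w" "mset (sort_blocks c w) = mset w"
    "blocks c (sort_blocks c w) = map sort (blocks c w)"
    "set (take (psum c i) (sort_blocks c w)) = set (take (psum c i) w)" by blast+
qed

lemma minimal_representative_sort_blocks:
  assumes w: "distinct w" "set w = {1..sum_list c}"
  shows "minimal_representative c (sort_blocks c w)"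
proof -
  have len: "sum_list c = length w" using bij_word(2)[OF w] by simp
  note sb = sort_blocks[OF len]
  have "distinct (sort_blocks c w)" using w(1) sb(2) by (metis distinct_count_atmost_1 set_mset_mset)
  moreover have "set (sort_blocks c w) = {1..sum_list c}" using w(2) sb(2) by (metis set_mset_mset)
  ultimately show ?thesis by (auto simp: minimal_representative_def sb(3))
qed

lemma basis_flag_sort_blocks:
  assumes "sum_list c = length w"
  shows "basis_flag c (map h (sort_blocks c w)) = basis_flag c (map h w)"
  using sort_blocks(4)[OF assms] by (simp add: basis_flag_def take_map psum_def[symmetric])

section \<open>Inversions and strictly decreasing groups of blocks\<close>

lemma psum_block_exists:
  assumes c: "composition c n" and y: "y < n"
  obtains i where "i < length c" "psum c i \<le> y" "y < psum c (Suc i)"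
proof -
  have l: "y < psum c (length c)" using c y by (simp add: psum_length composition_def)
  define k where "k = (LEAST k. y < psum c k)"
  have k: "y < psum c k" unfolding k_def using l by (rule LeastI)
  then obtain i where i: "k = Suc i" by (cases k) auto
  have "\<not> y < psum c i" using not_less_Least[of i "\<lambda>k. y < psum c k"] i by (simp add: k_def)
  moreover have "k \<le> length c" unfolding k_def using l by (rule Least_le)
  ultimately show ?thesis using that[of i] i k by simp
qed

text \<open>On the left, every pair of positions in one block of \<open>f\<close> but in different
  blocks of \<open>d\<close> is an inversion. Since the blocks of \<open>d\<close> increase, it is
  enough to compare the last letter of a block with the first letter of the preceding one.\<close>

lemma strictly_decreasing_iff:
  assumes g: "grouping t f d" and d: "composition d n"
    and w: "distinct w" "set w = {1..n}" "\<forall>B\<in>set (blocks d w). sorted B"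
  shows "(\<forall>x y. x < n \<longrightarrow> y < n \<longrightarrow> (\<exists>i<length d. y < psum d (Suc i) \<and> psum d (Suc i) \<le> x) \<longrightarrow>
      \<not> (\<exists>j<length f. y < psum f (Suc j) \<and> psum f (Suc j) \<le> x) \<longrightarrow> w ! x \<le> w ! y)
    \<longleftrightarrow> (\<forall>j<length t. t ! j > 1 \<longrightarrow> strictly_decreasing (blocks t (blocks d w) ! j))" (is "?L \<longleftrightarrow> ?R")
proof -
  have len: "length w = n" by (rule bij_word(2)[OF w(1,2)])
  have dpos: "d ! i > 0" if "i < length d" for i using d that by (simp add: composition_def)
  have dn: "psum d i \<le> n" for i using psum_le[of d i] d by (simp add: composition_def)
  have t: "composition t (length d)" using g by (simp add: grouping_def)
  have pf: "psum f j = psum d (psum t j)" if "j \<le> length t" for j by (rule grouping_psum[OF g that])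
  have lf: "length f = length t" by (rule grouping_length[OF g])
  have tle: "psum t j \<le> length d" for j using psum_le[of t j] t by (simp add: composition_def)
  have d_less: "psum d i < psum d k \<longleftrightarrow> i < k" if "i \<le> length d" "k \<le> length d" for i k
    using psum_strict_mono[OF d, of i k] psum_mono[of k i d] that by (meson leD leI)
  have block: "blocks d w ! i \<noteq> []" "hd (blocks d w ! i) = w ! psum d i"
    "last (blocks d w ! i) = w ! (psum d (Suc i) - 1)" if i: "i < length d" for i
  proof -
    have le: "psum d i + d ! i \<le> length w" using dn[of "Suc i"] i len by (simp add: psum_Suc)
    have B: "blocks d w ! i = take (d ! i) (drop (psum d i) w)" by (rule blocks_nth[OF i])
    show ne: "blocks d w ! i \<noteq> []" using dpos[OF i] le unfolding B by auto
    show "hd (blocks d w ! i) = w ! psum d i"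
      using dpos[OF i] le unfolding B by (simp add: hd_drop_conv_nth)
    show "last (blocks d w ! i) = w ! (psum d (Suc i) - 1)"
      using ne dpos[OF i] le unfolding B by (subst last_conv_nth) (auto simp: psum_Suc[OF i])
  qed
  have sorted: "w ! x \<le> w ! y" if i: "i < length d" and xy: "psum d i \<le> x" "x \<le> y" "y < psum d (Suc i)" for i x y
  proof -
    have le: "psum d i + d ! i \<le> length w" using dn[of "Suc i"] i len by (simp add: psum_Suc)
    have B: "blocks d w ! i = take (d ! i) (drop (psum d i) w)" by (rule blocks_nth[OF i])
    have "sorted (blocks d w ! i)" using w(3) i by simp
    then have "blocks d w ! i ! (x - psum d i) \<le> blocks d w ! i ! (y - psum d i)"
      using xy le psum_Suc[OF i] unfolding B by (intro sorted_nth_mono) auto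
    then show ?thesis using xy le psum_Suc[OF i] unfolding B by simp
  qed
  have sd: "strictly_decreasing (blocks t (blocks d w) ! j) \<longleftrightarrow>
      (\<forall>i. psum t j \<le> i \<longrightarrow> Suc i < psum t (Suc j) \<longrightarrow> w ! (psum d (Suc (Suc i)) - 1) < w ! psum d i)"
    if j: "j < length t" for j
  proof -
    have le: "psum t j + t ! j \<le> length d" using tle[of "Suc j"] j by (simp add: psum_Suc)
    have G: "blocks t (blocks d w) ! j = take (t ! j) (drop (psum t j) (blocks d w))" by (rule blocks_nth[OF j])
    have lG: "length (blocks t (blocks d w) ! j) = t ! j" using le unfolding G by simp
    have nG: "blocks t (blocks d w) ! j ! k = blocks d w ! (psum t j + k)" if "k < t ! j" for k
      using le that unfolding G by simp
    have "strictly_decreasing (blocks t (blocks d w) ! j) \<longleftrightarrow>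
        (\<forall>k. Suc k < t ! j \<longrightarrow> w ! (psum d (Suc (Suc (psum t j + k))) - 1) < w ! psum d (psum t j + k))"
      unfolding strictly_decreasing_def lG using nG block(2,3) le by simp
    also have "\<dots> \<longleftrightarrow> (\<forall>i. psum t j \<le> i \<longrightarrow> Suc i < psum t (Suc j)
        \<longrightarrow> w ! (psum d (Suc (Suc i)) - 1) < w ! psum d i)"
    proof (intro iffI allI impI)
      fix i assume a: "\<forall>k. Suc k < t ! j \<longrightarrow> w ! (psum d (Suc (Suc (psum t j + k))) - 1) < w ! psum d (psum t j + k)"
        and i: "psum t j \<le> i" "Suc i < psum t (Suc j)"
      show "w ! (psum d (Suc (Suc i)) - 1) < w ! psum d i"
        using a[rule_format, of "i - psum t j"] i j by (simp add: psum_Suc)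
    next
      fix k assume a: "\<forall>i. psum t j \<le> i \<longrightarrow> Suc i < psum t (Suc j)
        \<longrightarrow> w ! (psum d (Suc (Suc i)) - 1) < w ! psum d i" and k: "Suc k < t ! j"
      show "w ! (psum d (Suc (Suc (psum t j + k))) - 1) < w ! psum d (psum t j + k)"
        using a[rule_format, of "psum t j + k"] k j by (simp add: psum_Suc)
    qed
    finally show ?thesis .
  qed
  show ?thesis
  proof
    assume L: ?L
    have "w ! (psum d (Suc (Suc i)) - 1) < w ! psum d i"
      if j: "j < length t" and i: "psum t j \<le> i" "Suc i < psum t (Suc j)" for i j
    proof -
      \<comment> \<open>The extreme pair: the last position of block \<open>Suc i\<close> and the
        first position of block \<open>i\<close>.\<close>
      let ?x = "psum d (Suc (Suc i)) - 1" and ?y = "psum d i"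
      have il: "Suc i < length d" using i(2) tle[of "Suc j"] by simp
      have lt: "psum d i < psum d (Suc i)" "psum d (Suc i) < psum d (Suc (Suc i))"
        using il d_less[of i "Suc i"] d_less[of "Suc i" "Suc (Suc i)"] by simp_all
      have x: "?x < n" "?y < ?x" "psum d (Suc i) \<le> ?x" using lt dn[of "Suc (Suc i)"] by linarith+
      \<comment> \<open>The only boundary of \<open>d\<close> between these positions is the one at
        \<open>Suc i\<close>, which lies strictly inside the group \<open>j\<close> and hence is no
        boundary of \<open>f\<close>.\<close>
      have "\<not> (\<exists>k<length f. ?y < psum f (Suc k) \<and> psum f (Suc k) \<le> ?x)"
      proof
        assume "\<exists>k<length f. ?y < psum f (Suc k) \<and> psum f (Suc k) \<le> ?x"
        then obtain k where k: "k < length t" "?y < psum d (psum t (Suc k))" "psum d (psum t (Suc k)) \<le> ?x"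
          using pf lf by (metis Suc_leI)
        have "psum d (psum t (Suc k)) < psum d (Suc (Suc i))" using k(3) lt(2) by linarith
        then have "i < psum t (Suc k)" "psum t (Suc k) < Suc (Suc i)"
          using k(2) d_less[of i "psum t (Suc k)"] d_less[of "psum t (Suc k)" "Suc (Suc i)"] il tle[of "Suc k"] by simp_all
        then have e: "psum t (Suc k) = Suc i" by simp
        show False
        proof (cases "k < j")
          case True
          then show False using psum_mono[of "Suc k" j t] i(1) e by simp
        next
          case False
          then show False using psum_mono[of "Suc j" "Suc k" t] i(2) e by simp
        qed
      qed
      then have "w ! ?x \<le> w ! ?y" using L x lt il by (meson Suc_lessD less_trans)
      moreover have "w ! ?x \<noteq> w ! ?y" using x w(1) len by (simp add: nth_eq_iff_index_eq)
      ultimately show ?thesis by simp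
    qed
    then show ?R using sd by simp
  next
    assume R: ?R
    have dec: "w ! (psum d (Suc (Suc i)) - 1) < w ! psum d i"
      if j: "j < length t" and i: "psum t j \<le> i" "Suc i < psum t (Suc j)" for i j
    proof -
      \<comment> \<open>Two consecutive blocks in a group already force the group to have more than
        one block, so the restriction in \<open>?R\<close> is satisfied.\<close>
      have "t ! j > 1" using i psum_Suc[OF j] by simp
      then show ?thesis using R sd[OF j] j i by blast
    qed
    \<comment> \<open>Neighbouring comparisons compose because inside each intermediate block the
      first letter is at most the last.\<close>
    have chain: "w ! (psum d (Suc k) - 1) < w ! psum d i"
      if j: "j < length t" and ik: "psum t j \<le> i" "i < k" "k < psum t (Suc j)" for i j k
      using ik(2,3)
    proof (induction k rule: less_induct)
      case (less k)
      obtain l where l: "k = Suc l" using less.prems by (cases k) auto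
      have "w ! (psum d (Suc k) - 1) < w ! psum d l"
        using dec[OF j, of l] less.prems ik(1) l by simp
      also have "w ! psum d l \<le> w ! psum d i"
      proof (cases "i = l")
        case False
        then have "w ! (psum d (Suc l) - 1) < w ! psum d i" using less.IH[of l] less.prems l by simp
        moreover have "l < length d" using less.prems l tle[of "Suc j"] by simp
        then have "w ! psum d l \<le> w ! (psum d (Suc l) - 1)"
          using dpos[of l] psum_Suc[of l d] by (intro sorted[of l]) auto
        ultimately show ?thesis by simp
      qed simp
      finally show ?case .
    qed
    show ?L
    proof (intro allI impI)
      fix x y assume x: "x < n" and y: "y < n"
        and later: "\<exists>i<length d. y < psum d (Suc i) \<and> psum d (Suc i) \<le> x"
        and nlater: "\<not> (\<exists>j<length f. y < psum f (Suc j) \<and> psum f (Suc j) \<le> x)"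
      obtain i where i: "i < length d" "psum d i \<le> y" "y < psum d (Suc i)" by (rule psum_block_exists[OF d y])
      obtain k where k: "k < length d" "psum d k \<le> x" "x < psum d (Suc k)" by (rule psum_block_exists[OF d x])
      obtain j where j: "j < length t" "psum t j \<le> i" "i < psum t (Suc j)" by (rule psum_block_exists[OF t i(1)])
      have ik: "i < k"
      proof -
        obtain l where l: "l < length d" "y < psum d (Suc l)" "psum d (Suc l) \<le> x" using later by blast
        have "psum d i < psum d (Suc l)" "psum d (Suc l) < psum d (Suc k)" using i l k by linarith+
        then show ?thesis using d_less[of i "Suc l"] d_less[of "Suc l" "Suc k"] i l k by simp
      qed
      have "k < psum t (Suc j)"
      proof (rule ccontr)
        assume "\<not> k < psum t (Suc j)"
        then have "psum d (psum t (Suc j)) \<le> psum d k" by (intro psum_mono) simp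
        moreover have "psum d (Suc i) \<le> psum d (psum t (Suc j))" using j(3) by (intro psum_mono) simp
        ultimately have "y < psum f (Suc j)" "psum f (Suc j) \<le> x" using i k pf[of "Suc j"] j(1) by simp_all
        then show False using nlater j(1) lf by auto
      qed
      have "w ! x \<le> w ! (psum d (Suc k) - 1)" using k by (intro sorted[of k]) auto
      also have "\<dots> < w ! psum d i" by (rule chain[OF j(1,2) ik \<open>k < psum t (Suc j)\<close>])
      also have "\<dots> \<le> w ! y" using i by (intro sorted[of i]) auto
      finally show "w ! x \<le> w ! y" by simp
    qed
  qed
qed

section \<open>The projection of an Iwasawa-Schubert variety\<close>

text \<open>The order \<open>q\<close> depends neither on the orbit nor on the dimension sequence,
  so one choice describes the cycles in both flag manifolds.\<close>

lemma base_cycle_K0_orbit: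
  fixes D C :: "('m::finite + 'm) flag set"
  assumes q: "bij_betw q UNIV {..<CARD('m + 'm)}" "\<And>a. q a + q (twin a) + 1 = CARD('m + 'm)"
    and c: "composition c CARD('m + 'm)" and D: "open_orbit c D" and C: "base_cycle D C"
  shows "C = orbit K0 (coord_flag c q)" "complex_submanifold C"
    "2 * analytic_dim C + dim (k0 \<inter> flag_algebra (coord_flag c q))
      = dim (k0 :: (complex^('m + 'm)^('m + 'm)) set)"
proof -
  obtain V where V: "V \<in> D" "C = orbit K0 V" and cC: "complex_submanifold C"
    using C by (auto simp: base_cycle_def)
  obtain V0 where V0: "V0 \<in> flag_manifold c" "D = orbit G0 V0" using D by (auto simp: open_orbit_def)
  obtain g where g: "g \<in> G0" "V = act g V0" using V(1) V0(2) by (auto simp: orbit_def)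
  have "invertible g" using g(1) by (simp add: G0_def SL_def invertible_det_nz)
  then have Vc: "V \<in> flag_manifold c" using V0(1) g(2) act_flag_manifold by blast
  have "coord_flag c q \<in> C"
    using complex_K0_orbit_coord_flag[OF q c Vc] cC V(2) by simp
  then show e: "C = orbit K0 (coord_flag c q)" using orbit_K0_eq V(2) by metis
  show "complex_submanifold C" by (rule cC)
  show "2 * analytic_dim C + dim (k0 \<inter> flag_algebra (coord_flag c q))
      = dim (k0 :: (complex^('m + 'm)^('m + 'm)) set)"
    using complex_K0_orbit(2)[OF coord_flag_manifold[OF q(1) c]] cC unfolding e by simp
qed

lemma flag_proj_schubert_cell:
  assumes "grouping t f d"
  shows "flag_proj t ` schubert_cell d \<rho> p = schubert_cell f \<rho> p"
proof -
  have "flag_proj t (act g (coord_flag d p)) = act g (coord_flag f p)" for g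
    by (simp add: flag_proj_act[OF assms] flag_proj_coord_flag[OF assms])
  then show ?thesis by (simp add: schubert_cell_def orbit_def image_image)
qed

text \<open>Every block boundary of \<open>f\<close> is also a block boundary of
  \<open>d\<close>.\<close>

lemma later_grouping_subset:
  assumes g: "grouping t f d"
  shows "later f p \<subseteq> later d p"
proof clarify
  fix a b assume "(a, b) \<in> later f p"
  then obtain j where j: "j < length t" "p b < psum f (Suc j)" "psum f (Suc j) \<le> p a"
    using grouping_length[OF g] by (auto simp: later_def)
  obtain i where i: "psum t (Suc j) = Suc i" "i < length d"
    using grouping_psum_pos[OF g j(1)] by (cases "psum t (Suc j)") auto
  have "psum f (Suc j) = psum d (Suc i)" using grouping_psum[OF g, of "Suc j"] j(1) i(1) by simp
  then show "(a, b) \<in> later d p" using j i(2) by (auto simp: later_def)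
qed

theorem proposition32:
  fixes e :: "nat \<Rightarrow> 'm::finite" and f d t w :: "nat list"
    and D C Dh Ch :: "('m + 'm) flag set"
  assumes "bij_betw e {1..CARD('m)} UNIV"
    and "composition f (2 * CARD('m))"
    and "open_orbit f D" and "\<not> measurable_orbit f D" and "base_cycle D C"
    and "measurable_model D f d" and "grouping t f d"
    and "open_orbit d Dh" and "base_cycle Dh Ch"
    and "minimal_representative d w" and "schubert_variety e d w \<in> schubert_set e d Ch"
  shows "flag_proj t ` schubert_variety e d w \<in> schubert_set e f C \<longleftrightarrow>
    (\<forall>j<length t. t ! j > 1 \<longrightarrow> strictly_decreasing (blocks t (blocks d w) ! j))"
proof -
  let ?n = "CARD('m + 'm)"
  have n: "2 * CARD('m) = ?n" by (simp add: mult_2)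
  note e = assms(1) and g = assms(7)
  have f: "composition f ?n" using assms(2) unfolding n .
  have d: "composition d ?n" using assms(6) unfolding measurable_model_def n by blast
  have w: "distinct w" "set w = {1..?n}" and sorted: "\<forall>B\<in>set (blocks d w). sorted B"
    using assms(10) d by (auto simp: minimal_representative_def composition_def)
  define \<rho> where "\<rho> = iwasawa_position e"
  define p where "p = word_position e w"
  have p: "bij_betw p UNIV {..<?n}" unfolding p_def by (rule word_position(2)[OF e w])
  have \<rho>: "inj \<rho>" unfolding \<rho>_def using word_position(3)[OF e w] by (simp add: bij_betw_def)
  have Sd: "schubert_variety e d w = flag_topology d closure_of schubert_cell d \<rho> p"
    unfolding \<rho>_def p_def by (rule schubert_variety_eq[OF e d w])
  have proj: "flag_proj t ` schubert_variety e d w = flag_topology f closure_of schubert_cell f \<rho> p"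
    unfolding Sd flag_proj_closure_of[OF g d schubert_cell_subset[OF p d]] flag_proj_schubert_cell[OF g] ..
  obtain q :: "'m + 'm \<Rightarrow> nat" where q: "bij_betw q UNIV {..<?n}" "\<And>a. q a + q (twin a) + 1 = ?n"
    by (rule twin_order_exists) (rule that)
  note cycle = base_cycle_K0_orbit[OF q f assms(3,5)] and cycleh = base_cycle_K0_orbit[OF q d assms(8,9)]
  \<comment> \<open>The inclusion into the algebra of the finer flag relies on the complementary
    dimensions in the measurable model; the reverse one holds because the finer flag has the smaller
    flag algebra.\<close>
  have "k0 \<inter> flag_algebra (coord_flag f q) = k0 \<inter> flag_algebra (coord_flag d q)"
  proof
    show "k0 \<inter> flag_algebra (coord_flag f q) \<subseteq> k0 \<inter> flag_algebra (coord_flag d q)"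
      using k0_flag_algebra_subset[of q d f, OF q(2) measurable_model_psum[OF assms(6) f]] by blast
    show "k0 \<inter> flag_algebra (coord_flag d q) \<subseteq> k0 \<inter> flag_algebra (coord_flag f q)"
      using later_grouping_subset[OF g, of q] by (auto simp: flag_algebra_coord_flag pattern_def)
  qed
  then have dimC: "analytic_dim C = analytic_dim Ch" using cycle(3) cycleh(3) by simp
  have "flag_proj t ` Ch = C"
  proof -
    have "flag_proj t (act u (coord_flag d q)) = act u (coord_flag f q)" for u
      by (simp add: flag_proj_act[OF g] flag_proj_coord_flag[OF g])
    then show ?thesis unfolding cycle(1) cycleh(1) by (simp add: orbit_def image_image)
  qed
  moreover have "schubert_variety e d w \<inter> Ch \<noteq> {}" using assms(11) by (auto simp: schubert_set_def)
  ultimately have meets: "flag_proj t ` schubert_variety e d w \<inter> C \<noteq> {}" by blast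
  define Id where "Id = {(a, b) \<in> later d p. \<rho> a \<le> \<rho> b}"
  define If where "If = {(a, b) \<in> later f p. \<rho> a \<le> \<rho> b}"
  have dimS: "analytic_dim (schubert_variety e d w) = card Id"
    unfolding Sd Id_def by (rule analytic_dim_schubert[OF p d \<rho>])
  have dim\<pi>: "analytic_dim (flag_proj t ` schubert_variety e d w) = card If"
    unfolding proj If_def by (rule analytic_dim_schubert[OF p f \<rho>])
  have dimd: "card Id + analytic_dim Ch = card (later d p)"
    using assms(11) dimS analytic_dim_flag_manifold[OF p d] by (auto simp: schubert_set_def)
  \<comment> \<open>The word \<open>w\<close> still describes the projected flag but need not be
    minimal for \<open>f\<close>; sorting its blocks yields the index required by
    \<open>schubert_set\<close>.\<close>
  define w' where "w' = sort_blocks f w"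
  have sf: "sum_list f = ?n" using f by (simp add: composition_def)
  have lw: "sum_list f = length w" using bij_word(2)[OF w] sf by simp
  have w': "minimal_representative f w'"
    unfolding w'_def using w by (intro minimal_representative_sort_blocks) (simp_all add: sf)
  have dw': "distinct w'" "set w' = {1..?n}" using w' sf by (simp_all add: minimal_representative_def)
  have Sf: "schubert_variety e f w' = flag_topology f closure_of schubert_cell f \<rho> p"
  proof -
    have "coord_flag f (word_position e w') = coord_flag f p"
      using basis_flag_sort_blocks[OF lw, of "\<lambda>k. iwasawa_basis e ! (k - 1)"]
        word_basis_flag[OF e f dw'] word_basis_flag[OF e f w] by (simp only: w'_def p_def)
    then have "schubert_cell f \<rho> (word_position e w') = schubert_cell f \<rho> p" by (simp add: schubert_cell_def)
    then show ?thesis unfolding \<rho>_def using schubert_variety_eq[OF e f dw'] by simp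
  qed
  have "flag_proj t ` schubert_variety e d w \<in> schubert_set e f C \<longleftrightarrow> card If + analytic_dim C = card (later f p)"
  proof
    assume "flag_proj t ` schubert_variety e d w \<in> schubert_set e f C"
    then have "analytic_dim (flag_proj t ` schubert_variety e d w) + analytic_dim C
        = analytic_dim (flag_manifold f :: ('m + 'm) flag set)" by (auto simp: schubert_set_def)
    then show "card If + analytic_dim C = card (later f p)"
      by (simp add: dim\<pi> analytic_dim_flag_manifold[OF p f])
  next
    assume a: "card If + analytic_dim C = card (later f p)"
    have "flag_proj t ` schubert_variety e d w = schubert_variety e f w'" using proj Sf by simp
    moreover have "analytic_dim (schubert_variety e f w') + analytic_dim C
        = analytic_dim (flag_manifold f :: ('m + 'm) flag set)"
      using a dim\<pi> calculation by (simp add: analytic_dim_flag_manifold[OF p f])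
    ultimately show "flag_proj t ` schubert_variety e d w \<in> schubert_set e f C"
      unfolding schubert_set_def using w' meets by auto
  qed
  also have "\<dots> \<longleftrightarrow> (\<forall>(a, b)\<in>later d p - later f p. \<rho> a \<le> \<rho> b)"
  proof -
    \<comment> \<open>Pairs of positions in the same block of \<open>f\<close> but in different
      blocks of \<open>d\<close>; their number is the dimension of the fibre of the
      projection.\<close>
    let ?\<Delta> = "later d p - later f p"
    have sub: "later f p \<subseteq> later d p" by (rule later_grouping_subset[OF g])
    have "later d p = later f p \<union> ?\<Delta>" "Id = If \<union> {(a, b) \<in> ?\<Delta>. \<rho> a \<le> \<rho> b}"
      using sub by (auto simp: Id_def If_def)
    then have c1: "card (later d p) = card (later f p) + card ?\<Delta>"
      and c2: "card Id = card If + card {(a, b) \<in> ?\<Delta>. \<rho> a \<le> \<rho> b}"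
      using card_Un_disjoint[of "later f p" ?\<Delta>] card_Un_disjoint[of If "{(a, b) \<in> ?\<Delta>. \<rho> a \<le> \<rho> b}"]
      by (auto simp: If_def)
    \<comment> \<open>Subtracting the dimension equation upstairs, with cycles of equal dimension,
      leaves the condition that the inversions among the pairs in \<open>?\<Delta>\<close> are as
      many as these pairs.\<close>
    have "card If + analytic_dim C = card (later f p) \<longleftrightarrow> card {(a, b) \<in> ?\<Delta>. \<rho> a \<le> \<rho> b} = card ?\<Delta>"
      using c1 c2 dimd dimC by linarith
    also have "\<dots> \<longleftrightarrow> {(a, b) \<in> ?\<Delta>. \<rho> a \<le> \<rho> b} = ?\<Delta>"
      using card_subset_eq[of ?\<Delta> "{(a, b) \<in> ?\<Delta>. \<rho> a \<le> \<rho> b}"] by auto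
    also have "\<dots> \<longleftrightarrow> (\<forall>(a, b)\<in>?\<Delta>. \<rho> a \<le> \<rho> b)" by auto
    finally show ?thesis .
  qed
  also have "\<dots> \<longleftrightarrow> (\<forall>x y. x < ?n \<longrightarrow> y < ?n \<longrightarrow> (\<exists>i<length d. y < psum d (Suc i) \<and> psum d (Suc i) \<le> x) \<longrightarrow>
      \<not> (\<exists>j<length f. y < psum f (Suc j) \<and> psum f (Suc j) \<le> x) \<longrightarrow> w ! x \<le> w ! y)"
  proof -
    have r: "\<rho> a = w ! p a - 1" for a unfolding \<rho>_def p_def by (rule word_position(4)[OF e w])
    have pn: "p a < ?n" for a using p by (auto simp: bij_betw_def)
    \<comment> \<open>Letters are at least 1, so the truncated subtraction in \<open>r\<close>
      preserves comparisons.\<close>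
    have wpos: "w ! x \<ge> 1" if "x < ?n" for x
      using w(2) bij_word(2)[OF w] that nth_mem[of x w] by auto
    have le: "\<rho> a \<le> \<rho> b \<longleftrightarrow> w ! p a \<le> w ! p b" for a b
      using wpos[OF pn[of a]] wpos[OF pn[of b]] unfolding r by linarith
    have surj: "\<exists>a. p a = x" if "x < ?n" for x
    proof -
      have "x \<in> range p" using p that by (simp add: bij_betw_def)
      then show ?thesis by blast
    qed
    show ?thesis
    proof (intro iffI allI impI)
      fix x y assume a: "\<forall>(a, b)\<in>later d p - later f p. \<rho> a \<le> \<rho> b" and xy: "x < ?n" "y < ?n"
        and l: "\<exists>i<length d. y < psum d (Suc i) \<and> psum d (Suc i) \<le> x"
          "\<not> (\<exists>j<length f. y < psum f (Suc j) \<and> psum f (Suc j) \<le> x)"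
      obtain u v where uv: "p u = x" "p v = y" using surj xy by metis
      have "(u, v) \<in> later d p - later f p" using l by (simp add: later_def uv)
      then show "w ! x \<le> w ! y" using a le uv by auto
    next
      assume a: "\<forall>x y. x < ?n \<longrightarrow> y < ?n \<longrightarrow> (\<exists>i<length d. y < psum d (Suc i) \<and> psum d (Suc i) \<le> x) \<longrightarrow>
        \<not> (\<exists>j<length f. y < psum f (Suc j) \<and> psum f (Suc j) \<le> x) \<longrightarrow> w ! x \<le> w ! y"
      show "\<forall>(a, b)\<in>later d p - later f p. \<rho> a \<le> \<rho> b"
      proof clarify
        fix u v assume uv: "(u, v) \<in> later d p" "(u, v) \<notin> later f p"
        have "w ! p u \<le> w ! p v"
          by (rule a[rule_format, OF pn pn]) (use uv in \<open>simp_all only: later_def mem_Collect_eq case_prod_conv not_False_eq_True\<close>)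
        then show "\<rho> u \<le> \<rho> v" by (simp only: le)
      qed
    qed
  qed
  also have "\<dots> \<longleftrightarrow> (\<forall>j<length t. t ! j > 1 \<longrightarrow> strictly_decreasing (blocks t (blocks d w) ! j))"
    by (rule strictly_decreasing_iff[OF g d w sorted])
  finally show ?thesis .
qed

end
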